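(* Let $G$ be a 3-connected cubic graph without a 3-decomposition that has the minimum number of vertices among all 3-connected cubic graphs without a 3-decomposition. Then $G$ contains none of the following graphs as a subgraph: the triangle, $K_{2,3}$, the Petersen graph with one vertex removed, the claw-square, the twin-house, the domino. In particular: (i) the girth of $G$ is at least 4; (ii) every cycle of length 4, 5 or 6 in $G$ is an induced subgraph of $G$; (iii) for every edge $wx$ of $G$ there is an induced path $v_1v_2v_3v_4v_5v_6$ in $G$ on six vertices with $\{v_3,v_4\}=\{w,x\}$.
   Context: All graphs are finite and simple; cubic means 3-regular. A 3-decomposition of a graph $G$ is a partition of $E(G)$ into the edge sets of a spanning tree, a (possibly empty) 2-regular subgraph, and a (possibly empty) matching. The claw-square is the graph on vertices $a_1,a_2,a_3,a_4,b_1,b_2,b_3,c$ with edges $a_1a_2,a_2a_3,a_3a_4,a_4a_1$, $cb_1,cb_2,cb_3$ and $b_1a_1,b_2a_2,b_3a_3$. The twin-house is the graph on vertices $p_1,\dots,p_6$ with edges $p_1p_2,p_1p_5,p_2p_6,p_5p_3,p_5p_4,p_6p_3,p_6p_4$. The domino is the $2\times 3$ grid graph (two 4-cycles sharing an edge). *)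

theory Defs
  imports Main
begin

text \<open>Finite simple graphs: a finite vertex set V and a set E of 2-element subsets of V.\<close>

definition graph :: "'a set \<Rightarrow> 'a set set \<Rightarrow> bool" where
  "graph V E \<longleftrightarrow> finite V \<and> (\<forall>e\<in>E. \<exists>u v. u \<in> V \<and> v \<in> V \<and> u \<noteq> v \<and> e = {u, v})"

definition deg :: "'a set set \<Rightarrow> 'a \<Rightarrow> nat" where
  "deg E v = card {e \<in> E. v \<in> e}"

definition cubic :: "'a set \<Rightarrow> 'a set set \<Rightarrow> bool" where
  "cubic V E \<longleftrightarrow> graph V E \<and> (\<forall>v\<in>V. deg E v = 3)"

definition adj :: "'a set set \<Rightarrow> ('a \<times> 'a) set" where
  "adj E = {(u, v). {u, v} \<in> E}"

definition connected :: "'a set \<Rightarrow> 'a set set \<Rightarrow> bool" where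
  "connected V E \<longleftrightarrow> (\<forall>u\<in>V. \<forall>v\<in>V. (u, v) \<in> (adj E \<inter> V \<times> V)\<^sup>*)"

text \<open>k-connected (k = 3): more than 3 vertices, and removing fewer than 3 vertices leaves a connected graph.\<close>
definition three_connected :: "'a set \<Rightarrow> 'a set set \<Rightarrow> bool" where
  "three_connected V E \<longleftrightarrow> card V > 3 \<and>
     (\<forall>S \<subseteq> V. card S < 3 \<longrightarrow> connected (V - S) {e \<in> E. e \<inter> S = {}})"

text \<open>A cycle: list of at least 3 distinct vertices, consecutive ones (cyclically) adjacent.\<close>
definition is_cycle :: "'a set set \<Rightarrow> 'a list \<Rightarrow> bool" where
  "is_cycle E c \<longleftrightarrow> length c \<ge> 3 \<and> distinct c \<and>
     (\<forall>i < length c. {c ! i, c ! ((i + 1) mod length c)} \<in> E)"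

definition cycle_edges :: "'a list \<Rightarrow> 'a set set" where
  "cycle_edges c = {{c ! i, c ! ((i + 1) mod length c)} | i. i < length c}"

definition acyclic_edges :: "'a set set \<Rightarrow> bool" where
  "acyclic_edges E \<longleftrightarrow> \<not> (\<exists>c. is_cycle E c)"

definition spanning_tree :: "'a set \<Rightarrow> 'a set set \<Rightarrow> 'a set set \<Rightarrow> bool" where
  "spanning_tree V E T \<longleftrightarrow> T \<subseteq> E \<and> connected V T \<and> acyclic_edges T"

definition two_regular_sub :: "'a set set \<Rightarrow> 'a set set \<Rightarrow> bool" where
  "two_regular_sub E C \<longleftrightarrow> C \<subseteq> E \<and> (\<forall>v. deg C v = 0 \<or> deg C v = 2)"

definition matching :: "'a set set \<Rightarrow> 'a set set \<Rightarrow> bool" where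
  "matching E M \<longleftrightarrow> M \<subseteq> E \<and> (\<forall>v. deg M v \<le> 1)"

definition three_decomposition :: "'a set \<Rightarrow> 'a set set \<Rightarrow> bool" where
  "three_decomposition V E \<longleftrightarrow> (\<exists>T C M. T \<union> C \<union> M = E \<and> T \<inter> C = {} \<and> T \<inter> M = {} \<and> C \<inter> M = {}
      \<and> spanning_tree V E T \<and> two_regular_sub E C \<and> matching E M)"

text \<open>H = (VH,EH) is (isomorphic to) a (not necessarily induced) subgraph of G = (V,E).\<close>
definition contains_subgraph :: "'a set \<Rightarrow> 'a set set \<Rightarrow> 'b set \<Rightarrow> 'b set set \<Rightarrow> bool" where
  "contains_subgraph V E VH EH \<longleftrightarrow>
     (\<exists>f. inj_on f VH \<and> f ` VH \<subseteq> V \<and> (\<forall>e\<in>EH. f ` e \<in> E))"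

definition induced_cycle :: "'a set set \<Rightarrow> 'a list \<Rightarrow> bool" where
  "induced_cycle E c \<longleftrightarrow> is_cycle E c \<and>
     (\<forall>u\<in>set c. \<forall>v\<in>set c. {u, v} \<in> E \<longrightarrow> {u, v} \<in> cycle_edges c)"

definition induced_path :: "'a set set \<Rightarrow> 'a list \<Rightarrow> bool" where
  "induced_path E p \<longleftrightarrow> distinct p \<and>
     (\<forall>i j. i < length p \<and> j < length p \<longrightarrow> ({p ! i, p ! j} \<in> E \<longleftrightarrow> (j = i + 1 \<or> i = j + 1)))"

definition edges_of :: "(nat \<times> nat) list \<Rightarrow> nat set set" where
  "edges_of l = (\<lambda>(a, b). {a, b}) ` set l"

text \<open>The forbidden graphs, on natural-number vertices.\<close>
definition triangle_V :: "nat set" where "triangle_V = {0, 1, 2}"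
definition triangle_E :: "nat set set" where "triangle_E = edges_of [(0,1),(1,2),(2,0)]"

text \<open>K_{2,3}: parts {0,1} and {2,3,4}.\<close>
definition K23_V :: "nat set" where "K23_V = {0..4}"
definition K23_E :: "nat set set" where
  "K23_E = edges_of [(0,2),(0,3),(0,4),(1,2),(1,3),(1,4)]"

text \<open>Petersen graph (outer 5-cycle 0..4, spokes i--i+5, inner pentagram 5-7-9-6-8-5) minus vertex 0.\<close>
definition petersen_minus_V :: "nat set" where "petersen_minus_V = {1..9}"
definition petersen_minus_E :: "nat set set" where
  "petersen_minus_E = edges_of [(1,2),(2,3),(3,4),(1,6),(2,7),(3,8),(4,9),
                                (5,7),(7,9),(9,6),(6,8),(8,5)]"

text \<open>Claw-square: a1..a4 = 0..3, b1..b3 = 4..6, c = 7.\<close>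
definition claw_square_V :: "nat set" where "claw_square_V = {0..7}"
definition claw_square_E :: "nat set set" where
  "claw_square_E = edges_of [(0,1),(1,2),(2,3),(3,0),(7,4),(7,5),(7,6),(4,0),(5,1),(6,2)]"

text \<open>Twin-house: p1..p6 = 1..6.\<close>
definition twin_house_V :: "nat set" where "twin_house_V = {1..6}"
definition twin_house_E :: "nat set set" where
  "twin_house_E = edges_of [(1,2),(1,5),(2,6),(5,3),(5,4),(6,3),(6,4)]"

text \<open>Domino: 2x3 grid, rows 0-1-2 and 3-4-5.\<close>
definition domino_V :: "nat set" where "domino_V = {0..5}"
definition domino_E :: "nat set set" where
  "domino_E = edges_of [(0,1),(1,2),(3,4),(4,5),(0,3),(1,4),(2,5)]"

end

theory Submission
  imports Defs
begin

text \<open>A decomposition colours the edges with three types (tree, cycle, matching). Each excluded graph is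
  replaced by something smaller: the triangle, \<open>K\<^sub>2\<^sub>,\<^sub>3\<close> and the Petersen graph without a vertex have
  three outgoing edges and are contracted to a vertex; the other three have four outgoing edges and
  are replaced by two adjacent vertices, each taking two of the outgoing edges. For cubic graphs
  3-connectivity means that all edge cuts have size at least 3, and it fails in the smaller graph only
  if a bridge of the outside graph separates the two pairs; a count of edges shows that this cannot
  happen for two different pairings. By minimality the smaller graph has a decomposition. For every
  possible list of types on the outgoing edges there is a fitting assignment of types inside the piece;
  in a few cases matching edges are turned into tree edges, depending on which outer ends are joined
  in the tree outside. That the result contains a spanning tree follows from connectivity and the
  number of its edges, where connectivity is expressed by two-colourings without bichromatic edges.\<close>

section \<open>Connectivity and spanning trees\<close>

text \<open>Replacing a piece must leave the graph simple and 3-connected. With three outgoing edges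
  this fails only if all their outer ends coincide, and then the graph is the piece and one further
  vertex. With four, two edges assigned to the same new vertex might end in the same outer vertex;
  that vertex has only one further edge, which is again a bridge between the two pairs. So a bridge
  is the only obstacle, and one of two pairings avoids it. For the domino a failed pairing is even
  used: its bridge forces the outer ends behind it to be joined in the outer tree. Acyclicity is
  never tracked. The number of tree edges is adjusted to the number of vertices, so only
  connectivity remains, and this is a deduction of equal colours from finitely many known
  equalities, which can be evaluated. Turning a matching edge into a tree edge is harmless outside,
  as it only lowers degrees in the matching; inside, a whole cycle serves as compensation. For
  (iii), if an edge is not the middle of an induced path, all candidate paths around it have chords,
  and every combination of chords yields an excluded graph or a vertex with four neighbours.\<close>

definition monochromatic :: "('a \<Rightarrow> bool) \<Rightarrow> 'a set set \<Rightarrow> bool" where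
  "monochromatic c T \<longleftrightarrow> (\<forall>u v. {u, v} \<in> T \<longrightarrow> c u = c v)"

lemma monochromaticD: "monochromatic c T \<Longrightarrow> {u, v} \<in> T \<Longrightarrow> c u = c v"
  by (auto simp: monochromatic_def)

lemma graph_edgeE:
  assumes "graph V E" "e \<in> E"
  obtains u v where "u \<in> V" "v \<in> V" "u \<noteq> v" "e = {u, v}"
  using assms unfolding graph_def by blast

lemma graph_edgeD:
  assumes "graph V E" "{u, v} \<in> E"
  shows "u \<in> V" "v \<in> V" "u \<noteq> v"
  using graph_edgeE[OF assms] by (auto simp: doubleton_eq_iff)

lemma graph_finite_edges: "graph V E \<Longrightarrow> finite E"
  by (rule finite_subset[of _ "Pow V"]) (auto simp: graph_def)

lemma graph_subset: "graph V E \<Longrightarrow> T \<subseteq> E \<Longrightarrow> graph V T"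
  by (auto simp: graph_def)

text \<open>Colouring the vertices by whether they are reachable from \<open>u\<close> gives the
  converse.\<close>

lemma connected_iff_monochromatic:
  assumes "graph V T"
  shows "connected V T \<longleftrightarrow> (\<forall>c. monochromatic c T \<longrightarrow> (\<forall>u\<in>V. \<forall>v\<in>V. c u = c v))"
proof
  assume con: "connected V T"
  show "\<forall>c. monochromatic c T \<longrightarrow> (\<forall>u\<in>V. \<forall>v\<in>V. c u = c v)"
  proof (intro allI impI ballI)
    fix c u v assume c: "monochromatic c T" and uv: "u \<in> V" "v \<in> V"
    have "(u, v) \<in> (adj T \<inter> V \<times> V)\<^sup>*" using con uv by (auto simp: connected_def)
    then show "c u = c v"
      by (induction rule: rtrancl_induct) (use monochromaticD[OF c] in \<open>auto simp: adj_def\<close>)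
  qed
next
  assume *: "\<forall>c. monochromatic c T \<longrightarrow> (\<forall>u\<in>V. \<forall>v\<in>V. c u = c v)"
  show "connected V T"
    unfolding connected_def
  proof (intro ballI)
    fix u v assume uv: "u \<in> V" "v \<in> V"
    let ?R = "adj T \<inter> V \<times> V"
    have "monochromatic (\<lambda>w. (u, w) \<in> ?R\<^sup>*) T"
      unfolding monochromatic_def
    proof (intro allI impI)
      fix a b assume ab: "{a, b} \<in> T"
      then have "(a, b) \<in> ?R" "(b, a) \<in> ?R"
        using graph_edgeD[OF assms ab] by (auto simp: adj_def insert_commute)
      then show "((u, a) \<in> ?R\<^sup>*) = ((u, b) \<in> ?R\<^sup>*)"
        by (meson rtrancl.rtrancl_into_rtrancl)
    qed
    then show "(u, v) \<in> ?R\<^sup>*" using * uv by blast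
  qed
qed

lemma reachable_imp_path:
  assumes "(u, v) \<in> (adj T)\<^sup>*"
  shows "\<exists>p. p \<noteq> [] \<and> p ! 0 = u \<and> last p = v \<and> distinct p \<and>
           (\<forall>i. Suc i < length p \<longrightarrow> {p ! i, p ! Suc i} \<in> T)"
  using assms
proof (induction rule: rtrancl_induct)
  case base
  show ?case by (rule exI[of _ "[u]"]) auto
next
  case (step y z)
  then obtain p where p: "p \<noteq> []" "p ! 0 = u" "last p = y" "distinct p"
    "\<And>i. Suc i < length p \<Longrightarrow> {p ! i, p ! Suc i} \<in> T" by blast
  show ?case
  proof (cases "z \<in> set p")
    case True
    then obtain k where k: "k < length p" "p ! k = z" by (auto simp: in_set_conv_nth)
    have last_take: "last (take (Suc k) p) = z" using k by (simp add: take_Suc_conv_app_nth)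
    moreover have "{take (Suc k) p ! i, take (Suc k) p ! Suc i} \<in> T" if "Suc i < length (take (Suc k) p)" for i
      using that k p(5)[of i] by simp
    ultimately show ?thesis
      using p(1,2,4) by (intro exI[of _ "take (Suc k) p"]) simp
  next
    case False
    have "{(p @ [z]) ! i, (p @ [z]) ! Suc i} \<in> T" if "Suc i < length (p @ [z])" for i
    proof (cases "Suc i < length p")
      case True
      then show ?thesis using p(5)[of i] by (auto simp: nth_append)
    next
      case False
      then have "i = length p - 1" "Suc i = length p" using that p(1) by auto
      then show ?thesis using step(2) p(1,3) by (auto simp: nth_append adj_def last_conv_nth)
    qed
    then show ?thesis
      by (intro exI[of _ "p @ [z]"]) (use p False in \<open>auto simp: nth_append\<close>)
  qed
qed

lemma is_cycle_mono: "is_cycle T c \<Longrightarrow> T \<subseteq> T' \<Longrightarrow> is_cycle T' c"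
  by (auto simp: is_cycle_def)

text \<open>A path from \<open>u\<close> to \<open>v\<close> in \<open>T\<close> would be closed to
  a cycle by the new edge; it has at least three vertices because the edge itself is not in
  \<open>T\<close>.\<close>

lemma acyclic_insert_separates:
  assumes "acyclic_edges (insert {u, v} T)" "{u, v} \<notin> T" "u \<noteq> v"
  shows "(u, v) \<notin> (adj T)\<^sup>*"
proof
  assume "(u, v) \<in> (adj T)\<^sup>*"
  then obtain p where p: "p \<noteq> []" "p ! 0 = u" "last p = v" "distinct p"
    "\<And>i. Suc i < length p \<Longrightarrow> {p ! i, p ! Suc i} \<in> T"
    using reachable_imp_path by meson
  have "length p \<noteq> 1" using p(1-3) assms(3) by (auto simp: last_conv_nth)
  moreover have "length p \<noteq> 2"
  proof
    assume "length p = 2"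
    then have "{u, v} \<in> T" using p(5)[of 0] p(1-3) by (auto simp: last_conv_nth)
    then show False using assms(2) by simp
  qed
  moreover have "length p \<noteq> 0" using p(1) by simp
  ultimately have len: "length p \<ge> 3" by linarith
  have "{p ! i, p ! ((i + 1) mod length p)} \<in> insert {u, v} T" if "i < length p" for i
  proof (cases "Suc i < length p")
    case True
    then show ?thesis using p(5)[of i] by auto
  next
    case False
    then have "i + 1 = length p" using that by auto
    then have "i = length p - 1" "(i + 1) mod length p = 0" by auto
    then show ?thesis using p(1-3) by (auto simp: last_conv_nth insert_commute)
  qed
  then have "is_cycle (insert {u, v} T) p" using len p(4) by (auto simp: is_cycle_def)
  then show False using assms(1) by (auto simp: acyclic_edges_def)
qed

section \<open>Rank of an edge set, by counting the sets closed under its edges\<close>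

definition closed_sets :: "'a set \<Rightarrow> 'a set set \<Rightarrow> 'a set set" where
  "closed_sets V T = {S. S \<subseteq> V \<and> (\<forall>u v. {u, v} \<in> T \<longrightarrow> (u \<in> S \<longleftrightarrow> v \<in> S))}"

lemma finite_closed_sets: "finite V \<Longrightarrow> finite (closed_sets V T)"
  by (rule finite_subset[of _ "Pow V"]) (auto simp: closed_sets_def)

lemma closed_sets_sym_diff:
  "A \<in> closed_sets V T \<Longrightarrow> B \<in> closed_sets V T \<Longrightarrow> (A - B) \<union> (B - A) \<in> closed_sets V T"
  unfolding closed_sets_def by blast

lemma closed_sets_insert:
  "closed_sets V (insert {u, v} T) = {S \<in> closed_sets V T. u \<in> S \<longleftrightarrow> v \<in> S}"
  by (auto simp: closed_sets_def doubleton_eq_iff)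

lemma inj_on_sym_diff: "inj_on (\<lambda>S. (S - B) \<union> (B - S)) A"
proof (rule inj_onI)
  fix S S' assume "S - B \<union> (B - S) = S' - B \<union> (B - S')"
  then show "S = S'" by (simp add: set_eq_iff) blast
qed

text \<open>The symmetric difference with a set that separates u and v exchanges the closed sets that
  separate them with those that do not.\<close>

lemma card_closed_sets_insert_le:
  assumes "finite V"
  shows "card (closed_sets V T) \<le> 2 * card (closed_sets V (insert {u, v} T))"
proof -
  let ?P = "closed_sets V T" and ?Q = "closed_sets V (insert {u, v} T)"
  let ?D = "{S \<in> ?P. (u \<in> S) \<noteq> (v \<in> S)}"
  have fin: "finite ?P" "finite ?Q" using assms by (auto intro: finite_closed_sets)
  have "?P = ?Q \<union> ?D" "?Q \<inter> ?D = {}" by (auto simp: closed_sets_insert)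
  then have sum: "card ?P = card ?Q + card ?D"
    using fin by (metis (no_types, lifting) card_Un_disjoint finite_Un)
  have "card ?D \<le> card ?Q"
  proof (cases "?D = {}")
    case False
    then obtain B where B: "B \<in> ?D" by blast
    have "(\<lambda>S. (S - B) \<union> (B - S)) ` ?D \<subseteq> ?Q"
      using B closed_sets_sym_diff[of _ V T B] by (fastforce simp: closed_sets_insert)
    then show ?thesis using card_inj_on_le[OF inj_on_sym_diff] fin by blast
  next
    case True
    then show ?thesis by (simp only: card.empty)
  qed
  then show ?thesis using sum by simp
qed

lemma card_closed_sets_insert_ge:
  assumes "finite V" "B \<in> closed_sets V T" "(u \<in> B) \<noteq> (v \<in> B)"
  shows "2 * card (closed_sets V (insert {u, v} T)) \<le> card (closed_sets V T)"
proof -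
  let ?P = "closed_sets V T" and ?Q = "closed_sets V (insert {u, v} T)"
  let ?D = "{S \<in> ?P. (u \<in> S) \<noteq> (v \<in> S)}"
  have fin: "finite ?P" "finite ?Q" using assms by (auto intro: finite_closed_sets)
  then have finD: "finite ?D" by auto
  have "?P = ?Q \<union> ?D" "?Q \<inter> ?D = {}" by (auto simp: closed_sets_insert)
  then have sum: "card ?P = card ?Q + card ?D"
    using fin by (metis (no_types, lifting) card_Un_disjoint finite_Un)
  have "(\<lambda>S. (S - B) \<union> (B - S)) ` ?Q \<subseteq> ?D"
    using assms closed_sets_sym_diff[of _ V T B] by (fastforce simp: closed_sets_insert)
  then have "card ?Q \<le> card ?D" using card_inj_on_le[OF inj_on_sym_diff] finD by blast
  then show ?thesis using sum by simp
qed

lemma closed_sets_empty: "closed_sets V {} = Pow V"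
  by (auto simp: closed_sets_def)

text \<open>A closed set is a union of components, so their number is a power of two whose exponent
  is the number of components. Starting from all subsets of \<open>V\<close>, each edge added at
  most halves this number.\<close>

lemma card_closed_sets_ge:
  assumes "graph V T"
  shows "2 ^ card V \<le> 2 ^ card T * card (closed_sets V T)"
proof -
  have fV: "finite V" using assms by (auto simp: graph_def)
  have "finite T" using assms by (rule graph_finite_edges)
  then show ?thesis using assms
  proof (induction rule: finite_induct)
    case empty
    then show ?case using fV by (simp add: closed_sets_empty card_Pow)
  next
    case (insert e T)
    obtain u v where e: "e = {u, v}" using insert.prems graph_edgeE by (metis insertI1)
    have "2 ^ card V \<le> 2 ^ card T * card (closed_sets V T)"
      using insert graph_subset by blast
    also have "\<dots> \<le> 2 ^ card T * (2 * card (closed_sets V (insert e T)))"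
      using card_closed_sets_insert_le[OF fV] e by (intro mult_le_mono2) auto
    finally show ?case using insert by simp
  qed
qed

text \<open>Without cycles every edge joins two different components. The component \<open>B\<close>
  of one end separates the ends, so the number of closed sets is at least halved.\<close>

lemma card_closed_sets_le:
  assumes "graph V T" "acyclic_edges T"
  shows "2 ^ card T * card (closed_sets V T) \<le> 2 ^ card V"
proof -
  have fV: "finite V" using assms by (auto simp: graph_def)
  have "finite T" using assms(1) by (rule graph_finite_edges)
  then show ?thesis using assms
  proof (induction rule: finite_induct)
    case empty
    then show ?case using fV by (simp add: closed_sets_empty card_Pow)
  next
    case (insert e T)
    obtain u v where e: "e = {u, v}" "u \<in> V" "u \<noteq> v"
      using insert.prems(1) graph_edgeE by (metis insertI1)
    have gT: "graph V T" using insert.prems(1) graph_subset by blast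
    have acT: "acyclic_edges T"
      using insert.prems(2) is_cycle_mono[OF _ subset_insertI] by (fastforce simp: acyclic_edges_def)
    define B where "B = {w. (u, w) \<in> (adj T)\<^sup>*} \<inter> V"
    have "B \<in> closed_sets V T"
    proof -
      have "a \<in> B \<longleftrightarrow> b \<in> B" if ab: "{a, b} \<in> T" for a b
      proof -
        have "(a, b) \<in> adj T" "(b, a) \<in> adj T" "a \<in> V" "b \<in> V"
          using graph_edgeD[OF gT ab] ab by (auto simp: adj_def insert_commute)
        then show ?thesis unfolding B_def using rtrancl.rtrancl_into_rtrancl by fastforce
      qed
      then show ?thesis by (auto simp: closed_sets_def B_def)
    qed
    moreover have "u \<in> B" using e by (auto simp: B_def)
    moreover have "v \<notin> B"
      using acyclic_insert_separates[of u v T] insert e by (auto simp: B_def)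
    ultimately have "2 * card (closed_sets V (insert e T)) \<le> card (closed_sets V T)"
      using card_closed_sets_insert_ge[OF fV] e by blast
    then have "2 ^ card T * (2 * card (closed_sets V (insert e T))) \<le> 2 ^ card T * card (closed_sets V T)"
      by (rule mult_le_mono2)
    also have "\<dots> \<le> 2 ^ card V" using insert.IH gT acT by blast
    finally show ?case using insert by simp
  qed
qed

text \<open>The empty set and \<open>V\<close> are always closed, so fewer than
  \<open>card V\<close> halvings have taken place.\<close>

lemma acyclic_card_less:
  assumes "graph V T" "acyclic_edges T" "V \<noteq> {}"
  shows "card T < card V"
proof -
  have fV: "finite V" using assms by (auto simp: graph_def)
  have "{{}, V} \<subseteq> closed_sets V T"
    using graph_edgeD[OF assms(1)] by (auto simp: closed_sets_def)
  then have "card {{}, V} \<le> card (closed_sets V T)"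
    by (intro card_mono finite_closed_sets fV)
  then have "2 ^ card T * 2 \<le> (2::nat) ^ card T * card (closed_sets V T)"
    using assms(3) by (intro mult_le_mono2) auto
  also have "\<dots> \<le> 2 ^ card V" by (rule card_closed_sets_le[OF assms(1,2)])
  finally have "(2::nat) ^ Suc (card T) \<le> 2 ^ card V" by simp
  then show ?thesis by (subst (asm) power_increasing_iff) auto
qed

text \<open>A connected graph has no closed sets besides the empty set and \<open>V\<close>, and
  coming down to two from \<open>2 ^ card V\<close> takes at least \<open>card V - 1\<close>
  halvings.\<close>

lemma connected_card_ge:
  assumes "graph V T" "connected V T"
  shows "card V \<le> Suc (card T)"
proof -
  have "closed_sets V T \<subseteq> {{}, V}"
  proof
    fix S assume S: "S \<in> closed_sets V T"
    then have "monochromatic (\<lambda>w. w \<in> S) T" by (auto simp: closed_sets_def monochromatic_def)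
    then have "\<forall>u\<in>V. \<forall>v\<in>V. u \<in> S \<longleftrightarrow> v \<in> S"
      using assms connected_iff_monochromatic by blast
    then show "S \<in> {{}, V}" using S by (auto simp: closed_sets_def)
  qed
  then have "card (closed_sets V T) \<le> card {{}, V}" by (intro card_mono) auto
  also have "\<dots> \<le> 2" by (auto simp: card_insert_if)
  finally have "2 ^ card T * card (closed_sets V T) \<le> 2 ^ card T * 2" by (rule mult_le_mono2)
  then have "2 ^ card V \<le> (2::nat) ^ card T * 2"
    using card_closed_sets_ge[OF assms(1)] by linarith
  then have "(2::nat) ^ card V \<le> 2 ^ Suc (card T)" by simp
  then show ?thesis by (subst (asm) power_increasing_iff) auto
qed

text \<open>The colour is passed on along the remaining path of the cycle, so the deleted edge is
  monochromatic as well.\<close>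

lemma connected_delete_cycle_edge:
  assumes "graph V T" "connected V T" "is_cycle T p"
  shows "connected V (T - {{p ! 0, last p}})"
proof -
  have len: "length p \<ge> 3" and dis: "distinct p"
    and ed: "\<And>i. i < length p \<Longrightarrow> {p ! i, p ! ((i + 1) mod length p)} \<in> T"
    using assms(3) by (auto simp: is_cycle_def)
  let ?e = "{p ! 0, last p}"
  have "p \<noteq> []" using len by auto
  then have lst: "last p = p ! (length p - 1)" by (simp add: last_conv_nth)
  have "monochromatic c T" if c: "monochromatic c (T - {?e})" for c
  proof -
    have step: "c (p ! i) = c (p ! Suc i)" if "Suc i < length p" for i
    proof -
      have "{p ! i, p ! Suc i} \<in> T" using ed[of i] that by auto
      moreover have "{p ! i, p ! Suc i} \<noteq> ?e"
      proof
        assume "{p ! i, p ! Suc i} = ?e"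
        then have "p ! i = p ! 0 \<and> p ! Suc i = p ! (length p - 1) \<or> p ! i = p ! (length p - 1) \<and> p ! Suc i = p ! 0"
          unfolding lst doubleton_eq_iff .
        moreover have "i < length p" "0 < length p" "length p - 1 < length p" using that by auto
        note nth_eq_iff_index_eq[OF dis this(1,2)] nth_eq_iff_index_eq[OF dis that this(3)]
          nth_eq_iff_index_eq[OF dis that this(2)]
        ultimately have "i = 0 \<and> Suc i = length p - 1" by auto
        then show False using len by auto
      qed
      ultimately show ?thesis using c by (auto simp: monochromatic_def)
    qed
    have "i < length p \<Longrightarrow> c (p ! 0) = c (p ! i)" for i
      by (induction i) (use step in auto)
    then have "c (p ! 0) = c (last p)" using lst len by auto
    then have "c u = c v" if "{u, v} = ?e" for u v
      using that by (auto simp: doubleton_eq_iff)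
    then show ?thesis using c unfolding monochromatic_def by blast
  qed
  moreover have g: "graph V (T - {?e})" using assms(1) graph_subset by blast
  ultimately show ?thesis
    using assms(2) connected_iff_monochromatic[OF assms(1)] connected_iff_monochromatic[OF g] by blast
qed

text \<open>An edge of a cycle could be deleted without losing connectivity, which would leave fewer
  than \<open>card V - 1\<close> edges.\<close>

lemma connected_card_imp_acyclic:
  assumes "graph V T" "connected V T" "card T < card V"
  shows "acyclic_edges T"
  unfolding acyclic_edges_def
proof
  assume "\<exists>c. is_cycle T c"
  then obtain p where p: "is_cycle T p" by blast
  let ?e = "{p ! 0, last p}"
  have "?e \<in> T"
  proof -
    have "{p ! (length p - 1), p ! ((length p - 1 + 1) mod length p)} \<in> T" "length p \<ge> 3"
      using p by (auto simp: is_cycle_def)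
    moreover from this have "p \<noteq> []" "Suc (length p - 1) = length p" by auto
    ultimately show ?thesis by (simp add: last_conv_nth insert_commute)
  qed
  moreover have "card V \<le> Suc (card (T - {?e}))"
    using connected_card_ge connected_delete_cycle_edge[OF assms(1,2) p] graph_subset assms(1)
    by (metis Diff_subset)
  moreover have "finite T" using assms(1) graph_finite_edges by blast
  ultimately show False using assms(3) card_Suc_Diff1 by fastforce
qed

section \<open>Edge cuts and 3-connectivity\<close>

text \<open>Ordered pairs make the count additive in both arguments, with no case distinction for
  overlapping sets; an edge inside \<open>A\<close> is counted twice in
  \<open>ecount E A A\<close>.\<close>

definition arcs_between :: "'a set set \<Rightarrow> 'a set \<Rightarrow> 'a set \<Rightarrow> ('a \<times> 'a) set" where
  "arcs_between E A B = {(u, v). u \<in> A \<and> v \<in> B \<and> {u, v} \<in> E}"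

definition ecount :: "'a set set \<Rightarrow> 'a set \<Rightarrow> 'a set \<Rightarrow> nat" where
  "ecount E A B = card (arcs_between E A B)"

lemma arcs_between_iff: "(u, v) \<in> arcs_between E A B \<longleftrightarrow> u \<in> A \<and> v \<in> B \<and> {u, v} \<in> E"
  by (simp add: arcs_between_def)

lemma finite_arcs_between: "finite A \<Longrightarrow> finite B \<Longrightarrow> finite (arcs_between E A B)"
  by (rule finite_subset[of _ "A \<times> B"]) (auto simp: arcs_between_def)

lemma ecount_commute: "ecount E A B = ecount E B A"
proof -
  have "arcs_between E B A = prod.swap ` arcs_between E A B"
    by (auto simp: arcs_between_def image_iff insert_commute)
  then show ?thesis by (simp add: ecount_def card_image)
qed

lemma ecount_empty [simp]: "ecount E {} B = 0" "ecount E A {} = 0"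
  by (auto simp: ecount_def arcs_between_def)

lemma ecount_Un_left:
  assumes "finite A" "finite A'" "finite B" "A \<inter> A' = {}"
  shows "ecount E (A \<union> A') B = ecount E A B + ecount E A' B"
proof -
  have "arcs_between E (A \<union> A') B = arcs_between E A B \<union> arcs_between E A' B"
    by (auto simp: arcs_between_def)
  moreover have "arcs_between E A B \<inter> arcs_between E A' B = {}"
    using assms(4) by (auto simp: arcs_between_def)
  ultimately show ?thesis
    using assms by (simp add: ecount_def card_Un_disjoint finite_arcs_between)
qed

lemma ecount_Un_right:
  assumes "finite A" "finite B" "finite B'" "B \<inter> B' = {}"
  shows "ecount E A (B \<union> B') = ecount E A B + ecount E A B'"
  using ecount_Un_left[of B B' A E] assms by (simp add: ecount_commute)

lemma ecount_singletons: "ecount E {u} {v} = (if {u, v} \<in> E then 1 else 0)"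
proof -
  have "arcs_between E {u} {v} = (if {u, v} \<in> E then {(u, v)} else {})"
    by (auto simp: arcs_between_def)
  then show ?thesis by (simp add: ecount_def)
qed

lemma ecount_vertex:
  assumes "graph V E"
  shows "ecount E {v} V = deg E v"
proof -
  have "bij_betw (\<lambda>(u, w). {u, w}) (arcs_between E {v} V) {e \<in> E. v \<in> e}"
    unfolding bij_betw_def
  proof
    show "inj_on (\<lambda>(u, w). {u, w}) (arcs_between E {v} V)"
      by (auto simp: inj_on_def arcs_between_def doubleton_eq_iff)
    show "(\<lambda>(u, w). {u, w}) ` arcs_between E {v} V = {e \<in> E. v \<in> e}"
    proof
      show "{e \<in> E. v \<in> e} \<subseteq> (\<lambda>(u, w). {u, w}) ` arcs_between E {v} V"
      proof
        fix e assume "e \<in> {e \<in> E. v \<in> e}"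
        moreover from this obtain a b where "a \<in> V" "b \<in> V" "e = {a, b}"
          using assms graph_edgeE by (metis mem_Collect_eq)
        ultimately have "(v, if v = a then b else a) \<in> arcs_between E {v} V"
          "e = {v, if v = a then b else a}"
          by (auto simp: arcs_between_def insert_commute)
        then show "e \<in> (\<lambda>(u, w). {u, w}) ` arcs_between E {v} V" by force
      qed
    qed (auto simp: arcs_between_def)
  qed
  then show ?thesis by (simp add: ecount_def deg_def bij_betw_same_card)
qed

definition cut_ge_3 :: "'a set \<Rightarrow> 'a set set \<Rightarrow> bool" where
  "cut_ge_3 V E \<longleftrightarrow> (\<forall>S \<subseteq> V. S \<noteq> {} \<longrightarrow> S \<noteq> V \<longrightarrow> 3 \<le> ecount E S (V - S))"

lemma cut_ge_3D: "cut_ge_3 V E \<Longrightarrow> S \<subseteq> V \<Longrightarrow> S \<noteq> {} \<Longrightarrow> S \<noteq> V \<Longrightarrow> 3 \<le> ecount E S (V - S)"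
  by (auto simp: cut_ge_3_def)

lemma ecount_self_singleton: "graph V E \<Longrightarrow> ecount E {v} {v} = 0"
  using graph_edgeD(3)[of V E v v] by (auto simp: ecount_singletons)

lemma graph_delete:
  assumes "graph V E"
  shows "graph (V - K) {e \<in> E. e \<inter> K = {}}"
  unfolding graph_def
proof (intro conjI ballI)
  fix e assume e: "e \<in> {e \<in> E. e \<inter> K = {}}"
  then obtain u v where "u \<in> V" "v \<in> V" "u \<noteq> v" "e = {u, v}"
    using assms graph_edgeE by (metis mem_Collect_eq)
  then show "\<exists>u v. u \<in> V - K \<and> v \<in> V - K \<and> u \<noteq> v \<and> e = {u, v}" using e by auto
qed (use assms in \<open>auto simp: graph_def\<close>)

text \<open>For one or two vertices the degrees suffice. If \<open>S\<close> has at least three, the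
  ends in \<open>S\<close> of fewer than three cut edges form a separating set \<open>K\<close> that
  cannot exhaust \<open>S\<close>.\<close>

lemma three_connected_imp_cut_ge_3:
  assumes "cubic V E" "three_connected V E"
  shows "cut_ge_3 V E"
  unfolding cut_ge_3_def
proof (intro allI impI)
  fix S assume S: "S \<subseteq> V" "S \<noteq> {}" "S \<noteq> V"
  have g: "graph V E" and d: "\<And>v. v \<in> V \<Longrightarrow> deg E v = 3"
    using assms(1) by (auto simp: cubic_def)
  have fV: "finite V" using g by (auto simp: graph_def)
  then have fin: "finite S" "finite (V - S)" using S finite_subset by auto
  have deg_split: "ecount E {v} S + ecount E {v} (V - S) = 3" if "v \<in> V" for v
    using ecount_Un_right[of "{v}" S "V - S" E] fin S ecount_vertex[OF g, of v] d[OF that]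
    by (simp add: Un_absorb1)
  have "card S > 0" using S fin by (simp add: card_gt_0_iff)
  then consider "card S = 1" | "card S = 2" | "card S \<ge> 3" by linarith
  then show "3 \<le> ecount E S (V - S)"
  proof cases
    case 1
    then obtain v where v: "S = {v}" by (auto simp: card_1_singleton_iff)
    then show ?thesis using deg_split[of v] S ecount_self_singleton[OF g, of v] by auto
  next
    case 2
    then obtain a b where ab: "S = {a, b}" "a \<noteq> b" by (auto simp: card_2_iff)
    have "ecount E {a} S \<le> 1" "ecount E {b} S \<le> 1"
      using ecount_Un_right[of "{a}" "{a}" "{b}" E] ecount_Un_right[of "{b}" "{a}" "{b}" E] ab
        ecount_self_singleton[OF g]
      by (auto simp: ecount_singletons insert_commute)
    moreover have "ecount E ({a} \<union> {b}) (V - S) = ecount E {a} (V - S) + ecount E {b} (V - S)"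
      by (rule ecount_Un_left) (use ab fin in simp_all)
    moreover have "{a} \<union> {b} = S" "a \<in> V" "b \<in> V" using ab S by auto
    ultimately show ?thesis using deg_split[of a] deg_split[of b] by simp
  next
    case 3
    show ?thesis
    proof (rule ccontr)
      assume less: "\<not> 3 \<le> ecount E S (V - S)"
      define K where "K = fst ` arcs_between E S (V - S)"
      have "card K \<le> ecount E S (V - S)"
        unfolding K_def ecount_def by (intro card_image_le finite_arcs_between fin)
      then have cK: "card K < 3" using less by simp
      have KS: "K \<subseteq> S" by (auto simp: K_def arcs_between_def)
      let ?E = "{e \<in> E. e \<inter> K = {}}"
      have con: "connected (V - K) ?E"
        using assms(2) cK KS S unfolding three_connected_def by blast
      have g': "graph (V - K) ?E" using g by (rule graph_delete)
      have "monochromatic (\<lambda>v. v \<in> S) ?E"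
        unfolding monochromatic_def
      proof (intro allI impI)
        fix u v assume uv: "{u, v} \<in> ?E"
        then have "u \<in> V" "v \<in> V" using graph_edgeD[OF g, of u v] by auto
        moreover have "(u, v) \<notin> arcs_between E S (V - S)" "(v, u) \<notin> arcs_between E S (V - S)"
          using uv by (force simp: K_def)+
        ultimately show "(u \<in> S) = (v \<in> S)" using uv by (auto simp: arcs_between_iff insert_commute)
      qed
      then have "\<forall>u\<in>V - K. \<forall>v\<in>V - K. (u \<in> S) = (v \<in> S)"
        using con connected_iff_monochromatic[OF g'] by blast
      moreover obtain s where "s \<in> S - K"
      proof -
        have "S \<noteq> K" using 3 cK by auto
        then show ?thesis using KS that by blast
      qed
      moreover obtain t where "t \<in> V - S" using S by blast
      ultimately show False using KS S by blast
    qed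
  qed
qed

text \<open>The vertices of a separating set \<open>K\<close> may be put on either side of the cut
  between the two parts. With three edges at each vertex of \<open>K\<close> the resulting
  inequalities contradict each other; for two vertices they are all tight, and the contradiction is
  one of parity.\<close>

lemma cut_ge_3_imp_three_connected:
  assumes "cubic V E" "cut_ge_3 V E" "card V > 3"
  shows "three_connected V E"
  unfolding three_connected_def
proof (intro conjI allI impI)
  fix K assume K: "K \<subseteq> V" "card K < 3"
  have g: "graph V E" and d: "\<And>v. v \<in> V \<Longrightarrow> deg E v = 3"
    using assms(1) by (auto simp: cubic_def)
  have fV: "finite V" using g by (auto simp: graph_def)
  let ?E = "{e \<in> E. e \<inter> K = {}}"
  have g': "graph (V - K) ?E" using g by (rule graph_delete)
  have "\<forall>u\<in>V - K. \<forall>v\<in>V - K. c u = c v" if c: "monochromatic c ?E" for c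
  proof (rule ccontr)
    assume neg: "\<not> ?thesis"
    define P where "P = {v \<in> V - K. c v}"
    define Q where "Q = {v \<in> V - K. \<not> c v}"
    have ne: "P \<noteq> {}" "Q \<noteq> {}" using neg by (auto simp: P_def Q_def)
    have fin: "finite P" "finite Q" "finite K"
      using fV K finite_subset by (auto simp: P_def Q_def)
    have V: "V = P \<union> Q \<union> K" "P \<inter> Q = {}" "P \<inter> K = {}" "Q \<inter> K = {}"
      using K by (auto simp: P_def Q_def)
    have "arcs_between E P Q = {}"
    proof -
      have "{u, v} \<notin> E" if "u \<in> P" "v \<in> Q" for u v
        using that c by (auto simp: P_def Q_def monochromatic_def)
      then show ?thesis by (auto simp: arcs_between_def)
    qed
    then have PQ: "ecount E P Q = 0" by (simp add: ecount_def)
    note add = ecount_Un_left[where E = E] ecount_Un_right[where E = E]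
    have cut: "3 \<le> ecount E P B + ecount E A Q + ecount E A B"
      if AB: "A \<union> B = K" "A \<inter> B = {}" for A B
    proof -
      have "P \<union> A \<subseteq> V" "P \<union> A \<noteq> {}" "P \<union> A \<noteq> V" "V - (P \<union> A) = Q \<union> B"
        using AB V ne by auto
      then have "3 \<le> ecount E (P \<union> A) (Q \<union> B)" using cut_ge_3D[OF assms(2)] by metis
      also have "\<dots> = ecount E P (Q \<union> B) + ecount E A (Q \<union> B)"
        by (rule add) (use V AB fin in \<open>auto intro: finite_subset\<close>)
      also have "ecount E P (Q \<union> B) = ecount E P Q + ecount E P B"
        by (rule add) (use V AB fin in \<open>auto intro: finite_subset\<close>)
      also have "ecount E A (Q \<union> B) = ecount E A Q + ecount E A B"
        by (rule add) (use V AB fin in \<open>auto intro: finite_subset\<close>)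
      finally show ?thesis using PQ by simp
    qed
    have deg: "ecount E {v} P + ecount E {v} Q + ecount E {v} K = 3" if "v \<in> K" for v
    proof -
      have "ecount E {v} (P \<union> Q \<union> K) = ecount E {v} (P \<union> Q) + ecount E {v} K"
        by (rule add) (use V fin in auto)
      moreover have "ecount E {v} (P \<union> Q) = ecount E {v} P + ecount E {v} Q"
        by (rule add) (use V fin in auto)
      moreover have "ecount E {v} V = 3" using ecount_vertex[OF g, of v] d[of v] that K by auto
      ultimately show ?thesis using V(1) by simp
    qed
    consider "card K = 0" | "card K = 1" | "card K = 2" using K by linarith
    then show False
    proof cases
      case 1
      then have "K = {}" using fin by auto
      then show False using cut[of "{}" "{}"] PQ by auto
    next
      case 2
      then obtain k where k: "K = {k}" by (auto simp: card_1_singleton_iff)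
      then have "3 \<le> ecount E P {k}" "3 \<le> ecount E {k} Q"
        using cut[of "{}" K] cut[of K "{}"] by simp_all
      then show False using deg[of k] k by (simp add: ecount_commute)
    next
      case 3
      then obtain k l where kl: "K = {k, l}" "k \<noteq> l" by (auto simp: card_2_iff)
      have self: "ecount E {k} {k} = 0" "ecount E {l} {l} = 0"
        using ecount_self_singleton[OF g] by auto
      have K2: "ecount E A ({k} \<union> {l}) = ecount E A {k} + ecount E A {l}"
        "ecount E ({k} \<union> {l}) A = ecount E {k} A + ecount E {l} A" if "finite A" for A
        using that kl(2) by (simp_all only: add finite.intros Int_insert_left_if0
            singleton_iff Int_empty_left not_False_eq_True)
      have K: "K = {k} \<union> {l}" using kl by auto
      have 1: "3 \<le> ecount E P {k} + ecount E P {l}"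
        using cut[of "{}" K] K2[OF fin(1)] by (simp add: K)
      have 2: "3 \<le> ecount E {k} Q + ecount E {l} Q"
        using cut[of K "{}"] K2[OF fin(2)] by (simp add: K)
      have 3: "3 \<le> ecount E P {l} + ecount E {k} Q + ecount E {k} {l}"
        by (rule cut) (use K kl in auto)
      have 4: "3 \<le> ecount E P {k} + ecount E {l} Q + ecount E {l} {k}"
        by (rule cut) (use K kl in auto)
      have 5: "ecount E P {k} + ecount E {k} Q + ecount E {k} {l} = 3"
        using deg[of k] K self K2(1)[of "{k}"] ecount_commute[of E P "{k}"] by simp
      have 6: "ecount E P {l} + ecount E {l} Q + ecount E {k} {l} = 3"
        using deg[of l] K self K2(1)[of "{l}"] ecount_commute[of E P "{l}"]
          ecount_commute[of E "{k}" "{l}"] by simp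
      \<comment> \<open>The facts 1, 2, 5 and 6 leave no edge between \<open>k\<close> and
        \<open>l\<close> and make 1 and 2 equalities. Then 3 and 4 are equalities as well, so
        \<open>k\<close> and \<open>l\<close> send equally many edges to \<open>P\<close>, three in
        total.\<close>
      have "2 * ecount E P {k} = 3"
        using 1 2 3 4 5 6 ecount_commute[of E "{l}" "{k}"] by linarith
      then show False by presburger
    qed
  qed
  then show "connected (V - K) ?E" using connected_iff_monochromatic[OF g'] by blast
qed (use assms in auto)

section \<open>Pieces with prescribed outgoing edges\<close>

datatype edge_type = Tr | Cy | Ma

definition incident_types ::
  "(nat \<times> nat) list \<Rightarrow> nat list \<Rightarrow> edge_type list \<Rightarrow> edge_type list \<Rightarrow> nat \<Rightarrow> edge_type list" where
  "incident_types es ts \<sigma> \<tau> v =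
     map snd (filter (\<lambda>((a, b), _). a = v \<or> b = v) (zip es \<sigma>)) @
     map snd (filter (\<lambda>(u, _). u = v) (zip ts \<tau>))"

definition edge_class :: "'e list \<Rightarrow> edge_type list \<Rightarrow> edge_type \<Rightarrow> 'e set" where
  "edge_class L s t = {e. (e, t) \<in> set (zip L s)}"

lemma edge_class_conv:
  "edge_class L s t = set (map fst (filter (\<lambda>(e, t'). t' = t) (zip L s)))"
  by (force simp: edge_class_def)

lemma edge_class_filter_conv:
  "{e \<in> edge_class L s t. P e} = set (map fst (filter (\<lambda>(e, t'). t' = t \<and> P e) (zip L s)))"
  by (force simp: edge_class_def)

lemma distinct_map_fst_filter_zip: "distinct L \<Longrightarrow> distinct (map fst (filter P (zip L s)))"
  by (metis distinct_map_filter distinct_map map_fst_zip_take distinct_take)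

lemma length_filter_zip_snd:
  "length L = length s \<Longrightarrow> length (filter (\<lambda>(e, t'). t' = t) (zip L s)) = count_list s t"
  by (induction L s rule: list_induct2) auto

lemma card_edge_class:
  assumes "distinct L" "length L = length s"
  shows "card (edge_class L s t) = count_list s t"
  unfolding edge_class_conv distinct_card[OF distinct_map_fst_filter_zip[OF assms(1)]]
  using length_filter_zip_snd[OF assms(2)] by simp

lemma edge_class_subset: "edge_class L s t \<subseteq> set L"
  by (auto simp: edge_class_def dest: set_zip_leftD)

lemma edge_class_cover:
  assumes "length L = length s"
  shows "edge_class L s Tr \<union> edge_class L s Cy \<union> edge_class L s Ma = set L"
proof
  show "set L \<subseteq> edge_class L s Tr \<union> edge_class L s Cy \<union> edge_class L s Ma"
  proof
    fix e assume "e \<in> set L"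
    then obtain t where "(e, t) \<in> set (zip L s)"
      using assms by (metis in_set_impl_in_set_zip1)
    then show "e \<in> edge_class L s Tr \<union> edge_class L s Cy \<union> edge_class L s Ma"
      by (cases t) (auto simp: edge_class_def)
  qed
qed (simp add: edge_class_subset)

lemma edge_class_disjoint:
  assumes "distinct L" "t \<noteq> t'"
  shows "edge_class L s t \<inter> edge_class L s t' = {}"
proof -
  have "x = y" if "(e, x) \<in> set (zip L s)" "(e, y) \<in> set (zip L s)" for e x y
    using that assms(1) by (auto simp: in_set_zip nth_eq_iff_index_eq)
  then show ?thesis using assms(2) by (auto simp: edge_class_def)
qed

text \<open>The terminals ts are the vertices of degree 2 in the pattern, and \<open>out v\<close> is the end outside the
  copy of the third edge at the terminal v.\<close>

locale piece =
  fixes V :: "'a set" and E :: "'a set set" and f :: "nat \<Rightarrow> 'a"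
    and vs :: "nat list" and es :: "(nat \<times> nat) list" and ts :: "nat list"
    and out :: "nat \<Rightarrow> 'a"
  assumes cub: "cubic V E" and cut: "cut_ge_3 V E"
    and dvs: "distinct vs" and inj: "inj_on f (set vs)" and fV: "f ` set vs \<subseteq> V"
    and dts: "distinct ts" and tsvs: "set ts \<subseteq> set vs"
    and esvs: "set es \<subseteq> set vs \<times> set vs"
    and des: "distinct (map (\<lambda>(a, b). {a, b}) es)"
    and es_E: "(a, b) \<in> set es \<Longrightarrow> {f a, f b} \<in> E"
    and out_V: "v \<in> set ts \<Longrightarrow> out v \<in> V - f ` set vs"
    and out_E: "v \<in> set ts \<Longrightarrow> {f v, out v} \<in> E"
    and edges: "e \<in> E \<Longrightarrow> e \<inter> f ` set vs \<noteq> {} \<Longrightarrow>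
       (\<exists>(a, b) \<in> set es. e = {f a, f b}) \<or> (\<exists>v \<in> set ts. e = {f v, out v})"
begin

definition "X = f ` set vs"
definition "Y = V - X"
definition "EY = {e \<in> E. e \<subseteq> Y}"
definition "inner = map (\<lambda>(a, b). {f a, f b}) es"
definition "outer = map (\<lambda>v. {f v, out v}) ts"

lemma graph: "graph V E" using cub by (simp add: cubic_def)
lemma finV: "finite V" using graph by (simp add: graph_def)
lemma XV: "X \<subseteq> V" using fV by (simp add: X_def)
lemma YV: "Y \<subseteq> V" by (auto simp: Y_def)
lemma XY: "X \<inter> Y = {}" "X \<union> Y = V" using XV by (auto simp: Y_def)
lemma finY: "finite Y" using finV by (simp add: Y_def)
lemma finX: "finite X" by (simp add: X_def)
lemma cardX: "card X = length vs" using inj dvs by (simp add: X_def card_image distinct_card)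
lemma cardV: "card V = card Y + length vs"
  using XY finX finY cardX by (metis add.commute card_Un_disjoint)
lemma f_X: "v \<in> set vs \<Longrightarrow> f v \<in> X" by (simp add: X_def)
lemma out_Y: "v \<in> set ts \<Longrightarrow> out v \<in> Y" using out_V by (simp add: Y_def X_def)
lemma f_eq: "u \<in> set vs \<Longrightarrow> v \<in> set vs \<Longrightarrow> f u = f v \<longleftrightarrow> u = v" using inj by (auto simp: inj_on_def)
lemma f_not_Y: "v \<in> set vs \<Longrightarrow> f v \<notin> Y" using f_X XY by blast

lemma E_split: "E = EY \<union> set (inner @ outer)" "EY \<inter> set (inner @ outer) = {}"
proof -
  have "e \<subseteq> V" if "e \<in> E" for e using graph that by (auto elim!: graph_edgeE)
  then show "E = EY \<union> set (inner @ outer)"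
    using edges es_E out_E by (fastforce simp: EY_def inner_def outer_def Y_def X_def)
  show "EY \<inter> set (inner @ outer) = {}"
    using esvs tsvs f_not_Y by (fastforce simp: EY_def inner_def outer_def)
qed

lemma distinct_edges: "distinct (inner @ outer)"
proof -
  have "inj_on (\<lambda>(a, b). {f a, f b}) (set es)"
  proof (rule inj_onI, clarify)
    fix a b c d assume h: "(a, b) \<in> set es" "(c, d) \<in> set es" "{f a, f b} = {f c, f d}"
    then have "a \<in> set vs" "b \<in> set vs" "c \<in> set vs" "d \<in> set vs" using esvs by auto
    then have "{a, b} = {c, d}" using h(3) by (auto simp: doubleton_eq_iff f_eq)
    moreover have "inj_on (\<lambda>(a, b). {a, b}) (set es)" using des by (simp add: distinct_map)
    ultimately show "a = c \<and> b = d" using h by (auto simp: inj_on_def)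
  qed
  then have "distinct inner" using des by (simp add: inner_def distinct_map)
  moreover have "inj_on (\<lambda>v. {f v, out v}) (set ts)"
    using tsvs f_not_Y out_Y f_eq by (fastforce simp: inj_on_def doubleton_eq_iff)
  then have "distinct outer" using dts by (simp add: outer_def distinct_map)
  moreover have "set inner \<inter> set outer = {}"
    using esvs tsvs f_not_Y out_Y by (fastforce simp: inner_def outer_def doubleton_eq_iff)
  ultimately show ?thesis by simp
qed

text \<open>Degrees at vertices of the copy become numbers of occurrences in a list, so that the
  conditions at these vertices can be evaluated on the pattern alone.\<close>

lemma deg_class:
  assumes "length \<sigma> = length es" "length \<tau> = length ts" "v \<in> set vs"
  shows "deg (edge_class (inner @ outer) (\<sigma> @ \<tau>) t) (f v) =
         count_list (incident_types es ts \<sigma> \<tau> v) t"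
proof -
  have "deg (edge_class (inner @ outer) (\<sigma> @ \<tau>) t) (f v) =
      length (filter (\<lambda>(e, t'). t' = t \<and> f v \<in> e) (zip (inner @ outer) (\<sigma> @ \<tau>)))"
    unfolding deg_def edge_class_filter_conv
      distinct_card[OF distinct_map_fst_filter_zip[OF distinct_edges]] by simp
  also have "zip (inner @ outer) (\<sigma> @ \<tau>) = zip inner \<sigma> @ zip outer \<tau>"
    using assms by (simp add: inner_def)
  also have "length (filter (\<lambda>(e, t'). t' = t \<and> f v \<in> e) (zip inner \<sigma> @ zip outer \<tau>)) =
      length (filter (\<lambda>(e, t'). t' = t \<and> f v \<in> e) (zip inner \<sigma>)) +
      length (filter (\<lambda>(e, t'). t' = t \<and> f v \<in> e) (zip outer \<tau>))" by simp
  also have "length (filter (\<lambda>(e, t'). t' = t \<and> f v \<in> e) (zip inner \<sigma>)) =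
      count_list (map snd (filter (\<lambda>((a, b), _). a = v \<or> b = v) (zip es \<sigma>))) t"
    using assms(1)[symmetric] esvs unfolding inner_def
    by (induction es \<sigma> rule: list_induct2) (use assms(3) f_eq in auto)
  also have "length (filter (\<lambda>(e, t'). t' = t \<and> f v \<in> e) (zip outer \<tau>)) =
      count_list (map snd (filter (\<lambda>(u, _). u = v) (zip ts \<tau>))) t"
  proof -
    have "\<forall>u\<in>set ts. u \<in> set vs \<and> out u \<noteq> f v" using out_V tsvs assms(3) by fastforce
    with assms(2)[symmetric] show ?thesis unfolding outer_def
      by (induction ts \<tau> rule: list_induct2) (use assms(3) f_eq in auto)
  qed
  finally show ?thesis by (simp add: incident_types_def)
qed

text \<open>Vertices of the copy are controlled by the type lists (\<open>vert\<close>), those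
  outside by \<open>degC\<close> and \<open>degM\<close>. Acyclicity of the tree part comes from
  \<open>size\<close>: a connected graph with fewer edges than vertices is a tree.\<close>

lemma assemble:
  assumes len: "length \<sigma> = length es" "length \<tau> = length ts"
    and vert: "\<And>v. v \<in> set vs \<Longrightarrow> count_list (incident_types es ts \<sigma> \<tau> v) Cy \<in> {0, 2} \<and>
                 count_list (incident_types es ts \<sigma> \<tau> v) Ma \<le> 1"
    and EY: "T0 \<union> C0 \<union> M0 = EY" "T0 \<inter> C0 = {}" "T0 \<inter> M0 = {}" "C0 \<inter> M0 = {}"
    and degC: "\<And>y. y \<in> Y \<Longrightarrow> deg (C0 \<union> edge_class (inner @ outer) (\<sigma> @ \<tau>) Cy) y \<in> {0, 2}"
    and degM: "\<And>y. y \<in> Y \<Longrightarrow> deg (M0 \<union> edge_class (inner @ outer) (\<sigma> @ \<tau>) Ma) y \<le> 1"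
    and size: "card T0 + count_list (\<sigma> @ \<tau>) Tr < card V"
    and conn: "\<And>c u v. monochromatic c (T0 \<union> edge_class (inner @ outer) (\<sigma> @ \<tau>) Tr) \<Longrightarrow>
                 u \<in> V \<Longrightarrow> v \<in> V \<Longrightarrow> c u = c v"
  shows "three_decomposition V E"
proof -
  let ?cl = "edge_class (inner @ outer) (\<sigma> @ \<tau>)"
  have len': "length (inner @ outer) = length (\<sigma> @ \<tau>)"
    using len by (simp add: inner_def outer_def)
  have cover: "?cl Tr \<union> ?cl Cy \<union> ?cl Ma = set (inner @ outer)" by (rule edge_class_cover[OF len'])
  have dis: "?cl t \<inter> ?cl t' = {}" if "t \<noteq> t'" for t t'
    by (rule edge_class_disjoint[OF distinct_edges that])
  have sub: "?cl t \<subseteq> set (inner @ outer)" for t by (rule edge_class_subset)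
  have degX: "deg (K0 \<union> ?cl t) (f v) = count_list (incident_types es ts \<sigma> \<tau> v) t"
    if "v \<in> set vs" "K0 \<subseteq> EY" for v K0 t
  proof -
    have "{e \<in> K0 \<union> ?cl t. f v \<in> e} = {e \<in> ?cl t. f v \<in> e}"
      using that f_not_Y[of v] by (auto simp: EY_def)
    then show ?thesis using deg_class[OF len that(1)] by (simp add: deg_def)
  qed
  have deg0: "deg K v = 0" if "K \<subseteq> E" "v \<notin> V" for K v
  proof -
    have "{e \<in> K. v \<in> e} = {}" using that graph by (auto elim!: graph_edgeE)
    then show ?thesis unfolding deg_def by (simp only: card.empty)
  qed
  have subE: "K0 \<union> ?cl t \<subseteq> E" if "K0 \<subseteq> EY" for K0 t
    using that sub E_split(1) by blast
  have "two_regular_sub E (C0 \<union> ?cl Cy)"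
    unfolding two_regular_sub_def
  proof (intro conjI allI)
    show "C0 \<union> ?cl Cy \<subseteq> E" using subE EY by blast
    fix v
    consider "v \<in> Y" | u where "u \<in> set vs" "v = f u" | "v \<notin> V" using XY unfolding X_def by blast
    then show "deg (C0 \<union> ?cl Cy) v = 0 \<or> deg (C0 \<union> ?cl Cy) v = 2"
    proof cases
      case 1
      then show ?thesis using degC by auto
    next
      case 2
      have "C0 \<subseteq> EY" using EY by blast
      then show ?thesis using degX[OF 2(1)] vert[OF 2(1)] 2(2) by auto
    next
      case 3
      then have "deg (C0 \<union> ?cl Cy) v = 0" using deg0 subE EY by blast
      then show ?thesis by simp
    qed
  qed
  moreover have "matching E (M0 \<union> ?cl Ma)"
    unfolding matching_def
  proof (intro conjI allI)
    show "M0 \<union> ?cl Ma \<subseteq> E" using subE EY by blast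
    fix v
    consider "v \<in> Y" | u where "u \<in> set vs" "v = f u" | "v \<notin> V" using XY unfolding X_def by blast
    then show "deg (M0 \<union> ?cl Ma) v \<le> 1"
    proof cases
      case 1
      then show ?thesis using degM by auto
    next
      case 2
      have "M0 \<subseteq> EY" using EY by blast
      then show ?thesis using degX[OF 2(1)] vert[OF 2(1)] 2(2) by auto
    next
      case 3
      then have "deg (M0 \<union> ?cl Ma) v = 0" using deg0 subE EY by blast
      then show ?thesis by simp
    qed
  qed
  moreover have "spanning_tree V E (T0 \<union> ?cl Tr)"
  proof -
    have s: "T0 \<union> ?cl Tr \<subseteq> E" using subE EY by blast
    then have g: "graph V (T0 \<union> ?cl Tr)" using graph graph_subset by blast
    have con: "connected V (T0 \<union> ?cl Tr)"
      unfolding connected_iff_monochromatic[OF g] using conn by blast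
    have "card (T0 \<union> ?cl Tr) \<le> card T0 + card (?cl Tr)" by (rule card_Un_le)
    also have "card (?cl Tr) = count_list (\<sigma> @ \<tau>) Tr"
      by (rule card_edge_class[OF distinct_edges len'])
    finally have "card (T0 \<union> ?cl Tr) < card V" using size by simp
    then show ?thesis
      using s con connected_card_imp_acyclic[OF g con] by (simp add: spanning_tree_def)
  qed
  moreover have "(T0 \<union> ?cl Tr) \<union> (C0 \<union> ?cl Cy) \<union> (M0 \<union> ?cl Ma) = E"
    using cover EY(1) E_split(1) by blast
  moreover have "(T0 \<union> ?cl Tr) \<inter> (C0 \<union> ?cl Cy) = {}" "(T0 \<union> ?cl Tr) \<inter> (M0 \<union> ?cl Ma) = {}"
    "(C0 \<union> ?cl Cy) \<inter> (M0 \<union> ?cl Ma) = {}"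
    using EY dis[of Tr Cy] dis[of Tr Ma] dis[of Cy Ma] sub E_split(2) by blast+
  ultimately show ?thesis unfolding three_decomposition_def by metis
qed

end

section \<open>Deducing equal colours by merging labels\<close>

fun merge_labels :: "(nat \<times> nat) list \<Rightarrow> nat list \<Rightarrow> nat list" where
  "merge_labels [] lab = lab"
| "merge_labels ((u, v) # ls) lab =
     merge_labels ls (let a = lab ! u; b = lab ! v in map (\<lambda>l. if l = a then b else l) lab)"

text \<open>Equal labels certify equal colours; different labels claim nothing. Since labels are
  merged only along pairs of nodes known to have the same colour, merging keeps this
  property.\<close>

definition label_sound :: "(nat \<Rightarrow> bool) \<Rightarrow> nat list \<Rightarrow> bool" where
  "label_sound c lab \<longleftrightarrow> (\<forall>i < length lab. \<forall>j < length lab. lab ! i = lab ! j \<longrightarrow> c i = c j)"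

lemma label_soundD:
  "label_sound c lab \<Longrightarrow> lab ! i = lab ! j \<Longrightarrow> i < length lab \<Longrightarrow> j < length lab \<Longrightarrow> c i = c j"
  unfolding label_sound_def by blast

lemma length_merge_labels: "length (merge_labels ls lab) = length lab"
  by (induction ls lab rule: merge_labels.induct) (auto simp: Let_def)

lemma label_sound_merge_labels:
  assumes "label_sound c lab"
    and "\<And>u v. (u, v) \<in> set ls \<Longrightarrow> u < length lab \<and> v < length lab \<and> c u = c v"
  shows "label_sound c (merge_labels ls lab)"
  using assms
proof (induction ls lab rule: merge_labels.induct)
  case (2 u v ls lab)
  let ?lab = "map (\<lambda>l. if l = lab ! u then lab ! v else l) lab"
  have uv: "u < length lab" "v < length lab" "c u = c v" using "2.prems"(2)[of u v] by simp_all
  have "c i = c j" if ij: "i < length lab" "j < length lab" "?lab ! i = ?lab ! j" for i j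
  proof -
    have s: "\<And>i j. i < length lab \<Longrightarrow> j < length lab \<Longrightarrow> lab ! i = lab ! j \<Longrightarrow> c i = c j"
      using "2.prems"(1) unfolding label_sound_def by blast
    have eq: "(if lab ! i = lab ! u then lab ! v else lab ! i) =
        (if lab ! j = lab ! u then lab ! v else lab ! j)"
      using ij by simp
    show ?thesis
    proof (cases "lab ! i = lab ! u")
      case True
      then have "c i = c v" using s[OF ij(1) uv(1)] uv(3) by simp
      moreover have "c j = c v"
        using True eq s[OF ij(2) uv(1)] s[OF ij(2) uv(2)] uv(3) by (cases "lab ! j = lab ! u") simp_all
      ultimately show ?thesis by simp
    next
      case False
      show ?thesis
      proof (cases "lab ! j = lab ! u")
        case True
        then show ?thesis
          using False eq s[OF ij(1) uv(2)] s[OF ij(2) uv(1)] uv(3) by simp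
      next
        case False
        then show ?thesis using \<open>lab ! i \<noteq> lab ! u\<close> eq s[OF ij(1,2)] by simp
      qed
    qed
  qed
  then have "label_sound c ?lab" unfolding label_sound_def length_map by blast
  then have "label_sound c (merge_labels ls ?lab)"
    using "2.IH"[unfolded Let_def] "2.prems"(2)
    by (metis length_map list.set_intros(2))
  then show ?case by (simp add: Let_def)
qed simp

definition side :: "nat list \<Rightarrow> nat \<Rightarrow> nat" where
  "side va v = (if v \<in> set va then 0 else 1)"

text \<open>A new vertex takes the colour of the outer end of some tree edge at it; if
  \<open>ab\<close> holds, a tree edge of either side may serve. The result is the node
  \<open>10 + v\<close> of that end. For feasible type lists the filter is never empty, so the
  default 0 does not arise.\<close>

definition tree_rep :: "nat list \<Rightarrow> nat list \<Rightarrow> edge_type list \<Rightarrow> bool \<Rightarrow> nat \<Rightarrow> nat" where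
  "tree_rep ts va \<tau> ab s =
     (case filter (\<lambda>(v, t). t = Tr \<and> (ab \<or> side va v = s)) (zip ts \<tau>) of
        [] \<Rightarrow> 0 | (v, _) # _ \<Rightarrow> 10 + v)"

text \<open>In the labelling, the node v is a vertex of the pattern, 10 + v is the outer end of the edge
  at the terminal v, and 20 and 21 are the two vertices of the smaller graph that replace the
  piece. The argument \<open>\<tau>\<close> lists the types of the outgoing edges in the smaller graph (ab says
  whether the edge between the two new vertices is in the tree), \<open>\<sigma>\<close> and \<open>\<tau>'\<close> are the types used
  in the large graph, and Rs lists pairs of terminals whose outer ends are joined in the tree
  outside the piece.\<close>

definition extends_locally ::
  "nat list \<Rightarrow> (nat \<times> nat) list \<Rightarrow> nat list \<Rightarrow> nat list \<Rightarrow> edge_type list \<Rightarrow> bool \<Rightarrow>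
   (nat \<times> nat) list \<Rightarrow> edge_type list \<Rightarrow> edge_type list \<Rightarrow> bool" where
  "extends_locally vs es ts va \<tau> ab Rs \<sigma> \<tau>' \<longleftrightarrow>
     length \<sigma> = length es \<and> length \<tau> = length ts \<and> list_all (\<lambda>v. v < 10) vs \<and>
     list_all (\<lambda>(u, v). u \<in> set ts \<and> v \<in> set ts) Rs \<and>
     list_all2 (\<lambda>t t'. (t' = Cy \<longleftrightarrow> t = Cy) \<and> (t' = Ma \<longrightarrow> t = Ma)) \<tau> \<tau>' \<and>
     list_all (\<lambda>v. let l = incident_types es ts \<sigma> \<tau>' v in
        (count_list l Cy = 0 \<or> count_list l Cy = 2) \<and> count_list l Ma \<le> 1) vs \<and>
     count_list \<sigma> Tr + count_list \<tau>' Tr + (if ab then 1 else 2) = count_list \<tau> Tr + length vs \<and>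
     (let lab = merge_labels
            (map fst (filter (\<lambda>(_, t). t = Tr) (zip es \<sigma>)) @
             map (\<lambda>(v, _). (v, 10 + v)) (filter (\<lambda>(_, t). t = Tr) (zip ts \<tau>')) @
             map (\<lambda>(u, v). (10 + u, 10 + v)) Rs @
             [(20, tree_rep ts va \<tau> ab 0), (21, tree_rep ts va \<tau> ab 1)]) [0..<22];
          lab' = merge_labels ((20, 21) # map (\<lambda>v. (10 + v, 20)) ts) lab
      in list_all (\<lambda>(v, t). t = Tr \<longrightarrow> lab ! (10 + v) = lab ! (20 + side va v)) (zip ts \<tau>) \<and>
         (ab \<longrightarrow> lab ! 20 = lab ! 21) \<and>
         list_all (\<lambda>v. lab' ! v = lab' ! 20) vs)"

context piece
begin

text \<open>A colouring \<open>c\<close> induces colours \<open>w\<close> on the two new vertices,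
  namely those of the nodes chosen by \<open>tree_rep\<close>; merging 20 and 21 with these nodes is
  therefore sound by construction. The first two conclusions say that no tree edge at a new vertex
  of the smaller graph is bichromatic. The third uses the coarser labelling \<open>lab'\<close>:
  once the new vertices and all outer ends have one colour, the copy has it too.\<close>

lemma extends_locally_monochromatic:
  assumes ext: "extends_locally vs es ts va \<tau> ab Rs \<sigma> \<tau>'"
    and c: "monochromatic c (edge_class (inner @ outer) (\<sigma> @ \<tau>') Tr)"
    and Rs: "\<And>u v. (u, v) \<in> set Rs \<Longrightarrow> c (out u) = c (out v)"
  obtains w :: "nat \<Rightarrow> bool"
  where "\<And>v. (v, Tr) \<in> set (zip ts \<tau>) \<Longrightarrow> c (out v) = w (side va v)" "ab \<Longrightarrow> w 0 = w 1"
    "\<And>k v. w 0 = k \<Longrightarrow> w 1 = k \<Longrightarrow> (\<And>u. u \<in> set ts \<Longrightarrow> c (out u) = k) \<Longrightarrow> v \<in> set vs \<Longrightarrow> c (f v) = k"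
proof -
  define col0 where "col0 k = (if k < 10 then c (f k) else c (out (k - 10)))" for k
  define w where "w s = col0 (tree_rep ts va \<tau> ab s)" for s
  define col where "col k = (if k < 20 then col0 k else w (k - 20))" for k
  define ls where "ls = map fst (filter (\<lambda>(_, t). t = Tr) (zip es \<sigma>)) @
             map (\<lambda>(v, _). (v, 10 + v)) (filter (\<lambda>(_, t). t = Tr) (zip ts \<tau>')) @
             map (\<lambda>(u, v). (10 + u, 10 + v)) Rs @
             [(20, tree_rep ts va \<tau> ab 0), (21, tree_rep ts va \<tau> ab 1)]"
  define lab where "lab = merge_labels ls [0..<22]"
  define lab' where "lab' = merge_labels ((20, 21) # map (\<lambda>v. (10 + v, 20)) ts) lab"
  have len: "length \<sigma> = length es" "length \<tau>' = length ts"
    and lt: "\<And>v. v \<in> set vs \<Longrightarrow> v < 10"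
    and Rs_ts: "\<And>u v. (u, v) \<in> set Rs \<Longrightarrow> u \<in> set ts \<and> v \<in> set ts"
    and 1: "\<And>v. (v, Tr) \<in> set (zip ts \<tau>) \<Longrightarrow> lab ! (10 + v) = lab ! (20 + side va v)"
    and 2: "ab \<Longrightarrow> lab ! 20 = lab ! 21"
    and 3: "\<And>v. v \<in> set vs \<Longrightarrow> lab' ! v = lab' ! 20"
    using ext unfolding extends_locally_def Let_def
    by (auto simp: lab_def lab'_def ls_def list_all_iff dest!: list_all2_lengthD)
  have ts_lt: "v \<in> set ts \<Longrightarrow> v < 10" for v using lt tsvs by auto
  have rep_lt: "tree_rep ts va \<tau> ab s < 20" for s
  proof (cases "filter (\<lambda>(v, t). t = Tr \<and> (ab \<or> side va v = s)) (zip ts \<tau>)")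
    case (Cons p ps)
    then have "p \<in> set (zip ts \<tau>)" by (metis filter_is_subset list.set_intros(1) subsetD)
    then have "fst p < 10" using ts_lt by (metis prod.collapse set_zip_leftD)
    then show ?thesis using Cons by (auto simp: tree_rep_def split: prod.splits)
  qed (simp add: tree_rep_def)
  have zip_eq: "zip (inner @ outer) (\<sigma> @ \<tau>') = zip inner \<sigma> @ zip outer \<tau>'"
    using len by (simp add: inner_def)
  have "label_sound col lab"
    unfolding lab_def
  proof (rule label_sound_merge_labels)
    show "label_sound col [0..<22]" by (auto simp: label_sound_def simp del: upt.simps)
    fix u v assume "(u, v) \<in> set ls"
    then consider "((u, v), Tr) \<in> set (zip es \<sigma>)"
      | "(u, Tr) \<in> set (zip ts \<tau>')" "v = 10 + u"
      | u' v' where "(u', v') \<in> set Rs" "u = 10 + u'" "v = 10 + v'"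
      | "u = 20" "v = tree_rep ts va \<tau> ab 0" | "u = 21" "v = tree_rep ts va \<tau> ab 1"
      by (auto simp: ls_def)
    then show "u < length [0..<22] \<and> v < length [0..<22] \<and> col u = col v"
    proof cases
      case 1
      then have uv: "(u, v) \<in> set es" by (rule set_zip_leftD)
      have "({f u, f v}, Tr) \<in> set (zip inner \<sigma>)"
        using 1 by (force simp: inner_def zip_map1)
      then have "c (f u) = c (f v)"
        using c zip_eq by (auto simp: monochromatic_def edge_class_def)
      then show ?thesis using uv esvs lt by (auto simp: col_def col0_def simp del: upt.simps dest!: subsetD)
    next
      case 2
      then have u: "u \<in> set ts" by (metis set_zip_leftD)
      have "({f u, out u}, Tr) \<in> set (zip outer \<tau>')"
        using 2 by (force simp: outer_def zip_map1)
      then have "c (f u) = c (out u)"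
        using c zip_eq by (auto simp: monochromatic_def edge_class_def)
      then show ?thesis using ts_lt[OF u] 2 by (auto simp: col_def col0_def simp del: upt.simps)
    next
      case 3
      then have "u' < 10" "v' < 10" using Rs_ts ts_lt by blast+
      then show ?thesis using Rs[OF 3(1)] 3
        by (auto simp: col_def col0_def simp del: upt.simps)
    next
      case 4
      then show ?thesis using rep_lt[of 0] by (auto simp: col_def w_def simp del: upt.simps)
    next
      case 5
      then show ?thesis using rep_lt[of 1] by (auto simp: col_def w_def simp del: upt.simps)
    qed
  qed
  have len_lab: "length lab = 22" by (simp add: lab_def length_merge_labels del: upt.simps)
  have snd: "lab ! i = lab ! j \<Longrightarrow> i < 22 \<Longrightarrow> j < 22 \<Longrightarrow> col i = col j" for i j
    using label_soundD[OF \<open>label_sound col lab\<close>] unfolding len_lab .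
  show thesis
  proof
    fix v assume v: "(v, Tr) \<in> set (zip ts \<tau>)"
    then have "v < 10" using ts_lt by (metis set_zip_leftD)
    then show "c (out v) = w (side va v)"
      using snd[OF 1[OF v]] by (auto simp: col_def col0_def side_def)
  next
    assume ab
    then show "w 0 = w 1" using snd[OF 2] by (auto simp: col_def)
  next
    fix k v
    assume k: "w 0 = k" "w 1 = k" "\<And>u. u \<in> set ts \<Longrightarrow> c (out u) = k" and v: "v \<in> set vs"
    have "label_sound col lab'"
      unfolding lab'_def
      by (rule label_sound_merge_labels[OF \<open>label_sound col lab\<close>])
        (use k ts_lt len_lab in \<open>auto simp: col_def col0_def\<close>)
    moreover have "length lab' = 22" by (simp add: lab'_def length_merge_labels len_lab)
    moreover have "v < 22" using lt[OF v] by simp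
    ultimately have "col v = col 20" using label_soundD[OF _ 3[OF v]] by simp
    then show "c (f v) = k" using k lt[OF v] by (auto simp: col_def col0_def)
  qed
qed

end

section \<open>Replacing a piece by one vertex or two adjacent vertices\<close>

text \<open>\<open>va\<close> lists the terminals attached to the new vertex 0; the others belong to
  1 if there are two. Outer vertices get names from 2 on, which reserves 0 and 1; the names are
  numbers because minimality is stated for graphs on natural numbers. \<open>out_inj\<close>
  prevents parallel edges, and \<open>not_bad\<close> excludes the bridge that would give the
  smaller graph a cut of two edges.\<close>

locale reduction = piece +
  fixes va :: "nat list" and two :: bool and h :: "'a \<Rightarrow> nat"
  assumes hinj: "inj_on h Y" and h_ge: "y \<in> Y \<Longrightarrow> 2 \<le> h y"
    and one: "\<not> two \<Longrightarrow> set ts \<subseteq> set va \<and> length ts = 3"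
    and split: "two \<Longrightarrow> card {v \<in> set ts. v \<in> set va} = 2 \<and> card {v \<in> set ts. v \<notin> set va} = 2"
    and out_inj: "u \<in> set ts \<Longrightarrow> v \<in> set ts \<Longrightarrow> side va u = side va v \<Longrightarrow> out u = out v \<Longrightarrow> u = v"
    and not_bad: "two \<Longrightarrow> S \<subseteq> Y \<Longrightarrow> (\<And>v. v \<in> set ts \<Longrightarrow> out v \<in> S \<longleftrightarrow> v \<in> set va) \<Longrightarrow> 2 \<le> ecount E S (Y - S)"
begin

definition q :: "'a \<Rightarrow> nat" where
  "q u = (if u \<in> Y then h u else side va (inv_into (set vs) f u))"

definition W :: "nat set" where "W = (if two then {0, 1} else {0})"
definition VR :: "nat set" where "VR = h ` Y \<union> W"
definition ER :: "nat set set" where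
  "ER = (`) q ` (EY \<union> set outer) \<union> (if two then {{0, 1}} else {})"

lemma q_Y: "y \<in> Y \<Longrightarrow> q y = h y" by (simp add: q_def)
lemma q_f: "v \<in> set vs \<Longrightarrow> q (f v) = side va v"
  using f_not_Y[of v] inj by (simp add: q_def)

lemma h_eq: "y \<in> Y \<Longrightarrow> z \<in> Y \<Longrightarrow> h y = h z \<longleftrightarrow> y = z" using hinj by (auto simp: inj_on_def)
lemma side_lt: "side va v < 2" by (simp add: side_def)
lemma W_lt: "w \<in> W \<Longrightarrow> w < 2" by (auto simp: W_def split: if_splits)
lemma h_not_W: "y \<in> Y \<Longrightarrow> h y \<notin> W" using h_ge W_lt by fastforce
lemma h_neq: "y \<in> Y \<Longrightarrow> w < 2 \<Longrightarrow> h y \<noteq> w" using h_ge by fastforce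
lemma side_W: "v \<in> set ts \<Longrightarrow> side va v \<in> W" using one by (auto simp: W_def side_def)
lemma finW: "finite W" by (simp add: W_def)
lemma finVR: "finite VR" by (simp add: VR_def finW finY)
lemma hW_disjoint: "A \<subseteq> Y \<Longrightarrow> h ` A \<inter> W = {}" using h_not_W by blast

lemma card_VR: "card VR = card Y + (if two then 2 else 1)"
proof -
  have "card VR = card (h ` Y) + card W"
    unfolding VR_def using finY finW hW_disjoint by (intro card_Un_disjoint) auto
  then show ?thesis using card_image[OF hinj] by (simp add: W_def)
qed

lemma EY_edge: "e \<in> EY \<Longrightarrow> \<exists>y z. y \<in> Y \<and> z \<in> Y \<and> y \<noteq> z \<and> e = {y, z}"
  using graph by (auto simp: EY_def elim!: graph_edgeE)

lemma q_outer: "v \<in> set ts \<Longrightarrow> q ` {f v, out v} = {side va v, h (out v)}"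
  using q_f tsvs q_Y out_Y by auto

lemma ER_cases:
  assumes "e \<in> ER"
  obtains (inside) y z where "y \<in> Y" "z \<in> Y" "y \<noteq> z" "{y, z} \<in> E" "e = {h y, h z}"
    | (boundary) v where "v \<in> set ts" "e = {side va v, h (out v)}"
    | (middle) "two" "e = {0, 1}"
proof -
  consider e' where "e' \<in> EY" "e = q ` e'" | v where "v \<in> set ts" "e = q ` {f v, out v}"
    | "two" "e = {0, 1}"
    using assms by (auto simp: ER_def outer_def split: if_splits)
  then show thesis
  proof cases
    case 1
    then obtain y z where "y \<in> Y" "z \<in> Y" "y \<noteq> z" "e' = {y, z}" using EY_edge by blast
    then show thesis using inside 1 q_Y by (auto simp: EY_def)
  next
    case 2
    then show thesis using boundary q_outer by simp
  qed (rule middle)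
qed

lemma ER_inside: "y \<in> Y \<Longrightarrow> z \<in> Y \<Longrightarrow> {h y, h z} \<in> ER \<longleftrightarrow> {y, z} \<in> E"
proof
  assume yz: "y \<in> Y" "z \<in> Y"
  assume "{y, z} \<in> E"
  then have "{y, z} \<in> EY" using yz by (simp add: EY_def)
  then have "q ` {y, z} \<in> ER" unfolding ER_def by blast
  then show "{h y, h z} \<in> ER" using yz q_Y by simp
next
  assume yz: "y \<in> Y" "z \<in> Y"
  assume "{h y, h z} \<in> ER"
  then show "{y, z} \<in> E"
  proof (cases rule: ER_cases)
    case (inside y' z')
    then show ?thesis using yz by (auto simp: doubleton_eq_iff h_eq insert_commute)
  next
    case (boundary v)
    then show ?thesis using yz h_neq side_lt by (metis doubleton_eq_iff)
  next
    case middle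
    then show ?thesis using yz h_neq[of y 0] h_neq[of y 1] by (auto simp: doubleton_eq_iff)
  qed
qed

lemma ER_boundary:
  assumes "y \<in> Y" "w < 2"
  shows "{w, h y} \<in> ER \<longleftrightarrow> (\<exists>v\<in>set ts. side va v = w \<and> out v = y)"
proof
  assume "{w, h y} \<in> ER"
  then show "\<exists>v\<in>set ts. side va v = w \<and> out v = y"
  proof (cases rule: ER_cases)
    case (inside y' z')
    then show ?thesis using assms h_neq by (metis doubleton_eq_iff)
  next
    case (boundary v)
    have "h (out v) \<noteq> w" "h y \<noteq> side va v"
      using boundary out_Y h_neq assms side_lt by blast+
    then have "side va v = w" "h (out v) = h y"
      using boundary by (auto simp: doubleton_eq_iff)
    then show ?thesis using boundary out_Y h_eq assms by blast
  next
    case middle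
    then show ?thesis using assms h_neq[of y 0] h_neq[of y 1] by (auto simp: doubleton_eq_iff)
  qed
next
  assume "\<exists>v\<in>set ts. side va v = w \<and> out v = y"
  then obtain v where v: "v \<in> set ts" "side va v = w" "out v = y" by blast
  have "{f v, out v} \<in> set outer" using v(1) by (simp add: outer_def)
  then have "q ` {f v, out v} \<in> ER" unfolding ER_def by blast
  then show "{w, h y} \<in> ER" using q_outer[OF v(1)] unfolding v(2,3) by (simp only:)
qed

lemma middle_ER: "two \<Longrightarrow> {0, 1} \<in> ER" unfolding ER_def by simp

lemma graph_ER: "graph VR ER"
  unfolding graph_def
proof (intro conjI ballI)
  fix e assume "e \<in> ER"
  then show "\<exists>u v. u \<in> VR \<and> v \<in> VR \<and> u \<noteq> v \<and> e = {u, v}"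
  proof (cases rule: ER_cases)
    case (inside y z)
    then show ?thesis by (intro exI[of _ "h y"] exI[of _ "h z"]) (auto simp: VR_def h_eq)
  next
    case (boundary v)
    then have v: "side va v \<in> W" "out v \<in> Y" using side_W out_Y by simp_all
    then have "h (out v) \<noteq> side va v" using h_not_W by metis
    then show ?thesis using boundary(2) v
      by (intro exI[of _ "side va v"] exI[of _ "h (out v)"]) (auto simp: VR_def)
  next
    case middle
    then have "0 \<in> VR" "1 \<in> VR" unfolding VR_def W_def by simp_all
    then show ?thesis using middle(2) zero_neq_one by blast
  qed
qed (rule finVR)

definition terminals_to :: "nat \<Rightarrow> 'a set \<Rightarrow> nat" where
  "terminals_to w A = card {v \<in> set ts. side va v = w \<and> out v \<in> A}"

lemma ecount_ER_inside:
  assumes "A \<subseteq> Y" "B \<subseteq> Y"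
  shows "ecount ER (h ` A) (h ` B) = ecount E A B"
proof -
  have "arcs_between ER (h ` A) (h ` B) = map_prod h h ` arcs_between E A B"
    using assms ER_inside by (auto simp: arcs_between_def image_iff subset_iff)
  moreover have "inj_on (map_prod h h) (arcs_between E A B)"
    using assms by (auto simp: inj_on_def arcs_between_def subset_iff h_eq)
  ultimately show ?thesis by (simp add: ecount_def card_image)
qed

lemma ecount_ER_boundary:
  assumes "A \<subseteq> Y" "w < 2"
  shows "ecount ER {w} (h ` A) = terminals_to w A"
proof -
  let ?T = "{v \<in> set ts. side va v = w \<and> out v \<in> A}"
  have "arcs_between ER {w} (h ` A) = (\<lambda>v. (w, h (out v))) ` ?T"
    using assms ER_boundary by (auto simp: arcs_between_def image_iff subset_iff)
  moreover have "inj_on (\<lambda>v. (w, h (out v))) ?T"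
    using out_inj out_Y h_eq by (auto simp: inj_on_def)
  ultimately show ?thesis by (simp add: ecount_def card_image terminals_to_def)
qed

end

section \<open>Cuts and degrees outside the piece\<close>

context piece
begin

lemma ecount_X:
  assumes "A \<subseteq> Y"
  shows "ecount E X A = card {v \<in> set ts. out v \<in> A}"
proof -
  let ?T = "{v \<in> set ts. out v \<in> A}"
  have "arcs_between E X A = (\<lambda>v. (f v, out v)) ` ?T"
  proof
    show "arcs_between E X A \<subseteq> (\<lambda>v. (f v, out v)) ` ?T"
    proof
      fix p assume p: "p \<in> arcs_between E X A"
      then obtain u y where uy: "p = (u, y)" "u \<in> X" "y \<in> A" "{u, y} \<in> E"
        by (auto simp: arcs_between_def)
      have "y \<notin> X" "u \<notin> Y" using uy assms XY by blast+
      consider a b where "(a, b) \<in> set es" "{u, y} = {f a, f b}"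
        | v where "v \<in> set ts" "{u, y} = {f v, out v}"
        using edges[OF uy(4)] uy(2) unfolding X_def by blast
      then show "p \<in> (\<lambda>v. (f v, out v)) ` ?T"
      proof cases
        case 1
        then have "y \<in> X" using esvs f_X by (fastforce simp: doubleton_eq_iff)
        then show ?thesis using \<open>y \<notin> X\<close> by blast
      next
        case 2
        then have "u = f v" "y = out v"
          using \<open>u \<notin> Y\<close> out_Y by (auto simp: doubleton_eq_iff)
        then show ?thesis using 2 uy by blast
      qed
    qed
    show "(\<lambda>v. (f v, out v)) ` ?T \<subseteq> arcs_between E X A"
      using out_E f_X tsvs by (auto simp: arcs_between_def)
  qed
  moreover have "inj_on (\<lambda>v. (f v, out v)) ?T"
    using tsvs f_eq by (auto simp: inj_on_def)
  ultimately show ?thesis by (simp add: ecount_def card_image)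
qed

lemma ecount_outside_cut:
  assumes "A \<subseteq> Y" "A \<noteq> {}" "vs \<noteq> []"
  shows "3 \<le> ecount E A (Y - A) + card {v \<in> set ts. out v \<in> A}"
proof -
  have "V - A = (Y - A) \<union> X" "(Y - A) \<inter> X = {}" using assms XY by auto
  moreover have "X \<noteq> {}" using assms by (simp add: X_def)
  ultimately have "3 \<le> ecount E A ((Y - A) \<union> X)"
    using cut_ge_3D[OF cut, of A] assms YV XY by fastforce
  also have "\<dots> = ecount E A (Y - A) + ecount E A X"
    using assms finY finX XY by (intro ecount_Un_right) (auto intro: finite_subset)
  finally show ?thesis using ecount_X[OF assms(1)] ecount_commute by metis
qed

lemma deg_Y:
  assumes "y \<in> Y"
  shows "ecount E {y} Y + card {v \<in> set ts. out v = y} = 3"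
proof -
  have "ecount E {y} (Y \<union> X) = ecount E {y} Y + ecount E {y} X"
    using finY finX XY by (intro ecount_Un_right) auto
  moreover have "ecount E {y} V = 3"
    using assms YV ecount_vertex[OF graph] cub by (auto simp: cubic_def)
  moreover have "Y \<union> X = V" using XY by blast
  moreover have "ecount E X {y} = card {v \<in> set ts. out v = y}" using ecount_X[of "{y}"] assms by simp
  ultimately show ?thesis using ecount_commute[of E X "{y}"] by simp
qed

end

section \<open>The smaller graph is cubic and 3-connected\<close>

context reduction
begin

lemma ts_ne: "ts \<noteq> []" using one split by (cases two) auto
lemma vs_ne: "vs \<noteq> []" using ts_ne tsvs by auto

lemma terminals_to_Y:
  "two \<Longrightarrow> terminals_to 0 Y = 2" "two \<Longrightarrow> terminals_to 1 Y = 2" "\<not> two \<Longrightarrow> terminals_to 0 Y = 3"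
proof -
  have "{v \<in> set ts. side va v = 0 \<and> out v \<in> Y} = {v \<in> set ts. v \<in> set va}"
    "{v \<in> set ts. side va v = 1 \<and> out v \<in> Y} = {v \<in> set ts. v \<notin> set va}"
    using out_Y by (auto simp: side_def)
  moreover have "\<not> two \<Longrightarrow> {v \<in> set ts. v \<in> set va} = set ts" using one by auto
  ultimately show "two \<Longrightarrow> terminals_to 0 Y = 2" "two \<Longrightarrow> terminals_to 1 Y = 2"
    "\<not> two \<Longrightarrow> terminals_to 0 Y = 3"
    using split one distinct_card[OF dts] by (simp_all add: terminals_to_def)
qed

lemma terminals_to_sum:
  "card {v \<in> set ts. out v \<in> A} = terminals_to 0 A + terminals_to 1 A"
proof -
  have "{v \<in> set ts. out v \<in> A} =
     {v \<in> set ts. side va v = 0 \<and> out v \<in> A} \<union> {v \<in> set ts. side va v = 1 \<and> out v \<in> A}"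
    by (auto simp: side_def)
  moreover have "card (\<dots>) = terminals_to 0 A + terminals_to 1 A"
    unfolding terminals_to_def by (rule card_Un_disjoint) auto
  ultimately show ?thesis by simp
qed

lemma terminals_to_one: "\<not> two \<Longrightarrow> terminals_to 1 A = 0"
  using one by (auto simp: terminals_to_def side_def)

lemma terminals_to_compl:
  assumes "A \<subseteq> Y"
  shows "terminals_to w A + terminals_to w (Y - A) = terminals_to w Y"
proof -
  have "{v \<in> set ts. side va v = w \<and> out v \<in> Y} =
     {v \<in> set ts. side va v = w \<and> out v \<in> A} \<union> {v \<in> set ts. side va v = w \<and> out v \<in> Y - A}"
    using assms by auto
  moreover have "card (\<dots>) = terminals_to w A + terminals_to w (Y - A)"
    unfolding terminals_to_def by (rule card_Un_disjoint) auto
  ultimately show ?thesis by (simp add: terminals_to_def)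
qed

lemma ecount_ER_W:
  assumes "A \<subseteq> Y"
  shows "ecount ER W (h ` A) = card {v \<in> set ts. out v \<in> A}"
proof (cases two)
  case True
  then have "W = {0} \<union> {1}" unfolding W_def by auto
  moreover have "finite (h ` A)" using assms finY finite_subset by blast
  ultimately have "ecount ER W (h ` A) = ecount ER {0} (h ` A) + ecount ER {1} (h ` A)"
    using ecount_Un_left[of "{0}" "{1}" "h ` A" ER] by simp
  then show ?thesis using ecount_ER_boundary[OF assms] terminals_to_sum by simp
next
  case False
  then have "W = {0}" unfolding W_def by simp
  then show ?thesis
    using ecount_ER_boundary[OF assms, of 0] terminals_to_sum[of A] terminals_to_one[OF False] by simp
qed

lemma ecount_ER_cut:
  assumes "A \<subseteq> Y" "W' \<subseteq> W"
  shows "ecount ER (h ` A \<union> W') (VR - (h ` A \<union> W')) =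
     ecount E A (Y - A) + ecount ER (W - W') (h ` A) + ecount ER W' (h ` (Y - A)) + ecount ER W' (W - W')"
proof -
  have fin: "finite (h ` A)" "finite (h ` (Y - A))" "finite W'" "finite (W - W')"
    using assms finY finW finite_subset by blast+
  have VR: "VR - (h ` A \<union> W') = h ` (Y - A) \<union> (W - W')"
  proof -
    have "h ` Y - h ` A = h ` (Y - A)" using inj_on_image_set_diff[OF hinj, of Y A] assms by blast
    moreover have "h ` A \<subseteq> h ` Y" using assms by blast
    ultimately show ?thesis using assms hW_disjoint[of Y] unfolding VR_def by blast
  qed
  have d: "h ` A \<inter> W' = {}" "h ` (Y - A) \<inter> (W - W') = {}"
    using assms hW_disjoint[of Y] by blast+
  have "ecount ER (h ` A \<union> W') (h ` (Y - A) \<union> (W - W')) =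
     ecount ER (h ` A) (h ` (Y - A) \<union> (W - W')) + ecount ER W' (h ` (Y - A) \<union> (W - W'))"
    using fin d by (intro ecount_Un_left) auto
  also have "ecount ER (h ` A) (h ` (Y - A) \<union> (W - W')) =
     ecount ER (h ` A) (h ` (Y - A)) + ecount ER (h ` A) (W - W')"
    using fin d by (intro ecount_Un_right) auto
  also have "ecount ER W' (h ` (Y - A) \<union> (W - W')) =
     ecount ER W' (h ` (Y - A)) + ecount ER W' (W - W')"
    using fin d by (intro ecount_Un_right) auto
  finally show ?thesis
    using ecount_ER_inside[OF assms(1), of "Y - A"] ecount_commute[of ER "h ` A" "W - W'"] VR by simp
qed

text \<open>By taking complements \<open>S\<close> may be assumed to miss the new vertex 0. If it
  misses both new vertices, the cut has the size of a cut of the large graph. Otherwise it contains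
  1; let \<open>A\<close> be its outer part, \<open>B\<close> the rest of \<open>Y\<close>, and
  \<open>d\<close> the number of edges between them. If neither is empty, the cut conditions for
  \<open>A\<close> and \<open>B\<close> add up to \<open>2 * d + 4 \<ge> 6\<close>, so
  \<open>d \<ge> 1\<close>. The cut is then too small only if \<open>d = 1\<close>, all outgoing
  edges at 0 lead to \<open>B\<close> and all those at 1 to \<open>A\<close>, which is the bridge
  excluded by \<open>not_bad\<close>.\<close>

lemma cut_ER: "cut_ge_3 VR ER"
  unfolding cut_ge_3_def
proof (intro allI impI)
  fix S assume S: "S \<subseteq> VR" "S \<noteq> {}" "S \<noteq> VR"
  have main: "3 \<le> ecount ER S (VR - S)" if S: "S \<subseteq> VR" "S \<noteq> {}" "0 \<notin> S" for S
  proof -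
    define A where "A = {y \<in> Y. h y \<in> S}"
    have A: "A \<subseteq> Y" by (auto simp: A_def)
    have S_eq: "S = h ` A \<union> (S \<inter> W)" using S(1) by (auto simp: A_def VR_def)
    show ?thesis
    proof (cases "1 \<in> S \<and> two")
      case False
      then have SW: "S \<inter> W = {}" using S(3) unfolding W_def by auto
      then have "S = h ` A" using S_eq by blast
      then have "ecount ER S (VR - S) = ecount E A (Y - A) + card {v \<in> set ts. out v \<in> A}"
        using ecount_ER_cut[OF A, of "{}"] ecount_ER_W[OF A] by simp
      moreover have "A \<noteq> {}" using \<open>S = h ` A\<close> S(2) by blast
      ultimately show ?thesis using ecount_outside_cut[OF A _ vs_ne] by simp
    next
      case True
      then have SW: "S \<inter> W = {1}" "W - {1} = {0}" "{1} \<subseteq> W" using S(3) unfolding W_def by auto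
      let ?B = "Y - A"
      have B: "?B \<subseteq> Y" "Y - ?B = A" using A by auto
      let ?d = "ecount E A ?B"
      have "{1, 0} \<in> ER" using middle_ER True by (simp add: insert_commute)
      then have mid: "ecount ER {1} {0} = 1" by (simp add: ecount_singletons)
      have val: "ecount ER S (VR - S) = ?d + terminals_to 0 A + terminals_to 1 ?B + 1"
        using ecount_ER_cut[OF A SW(3)] S_eq SW mid
          ecount_ER_boundary[OF A, of 0] ecount_ER_boundary[OF B(1), of 1] by simp
      have sums: "terminals_to 0 A + terminals_to 0 ?B = 2" "terminals_to 1 A + terminals_to 1 ?B = 2"
        using terminals_to_compl[OF A] terminals_to_Y True by simp_all
      have cA: "A \<noteq> {} \<Longrightarrow> 3 \<le> ?d + terminals_to 0 A + terminals_to 1 A"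
        using ecount_outside_cut[OF A _ vs_ne] terminals_to_sum by simp
      have cB: "?B \<noteq> {} \<Longrightarrow> 3 \<le> ?d + terminals_to 0 ?B + terminals_to 1 ?B"
        using ecount_outside_cut[OF B(1) _ vs_ne] terminals_to_sum[of ?B] B(2)
          ecount_commute[of E A ?B] by simp
      have nb: "2 \<le> ?d" if "terminals_to 0 ?B = 2" "terminals_to 1 ?B = 0"
      proof -
        have "terminals_to 0 A = 0" using that sums by simp
        have "2 \<le> ecount E ?B (Y - ?B)"
        proof (rule not_bad)
          fix v assume v: "v \<in> set ts"
          show "out v \<in> ?B \<longleftrightarrow> v \<in> set va"
            using that(2) \<open>terminals_to 0 A = 0\<close> v out_Y[OF v]
            by (auto simp: terminals_to_def side_def split: if_splits)
        qed (use True in auto)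
        then show ?thesis using B(2) ecount_commute[of E A ?B] by simp
      qed
      have e: "terminals_to w {} = 0" for w by (simp add: terminals_to_def)
      show ?thesis
      proof (cases "A = {} \<or> ?B = {}")
        case True
        then show ?thesis
        proof
          assume "A = {}"
          then show ?thesis using val sums e by simp
        next
          assume "?B = {}"
          then have "terminals_to 0 ?B = 0" "terminals_to 1 ?B = 0" using e by metis+
          then show ?thesis using val sums by linarith
        qed
      next
        case False
        then show ?thesis using val sums cA cB nb by linarith
      qed
    qed
  qed
  show "3 \<le> ecount ER S (VR - S)"
  proof (cases "0 \<in> S")
    case False
    then show ?thesis using main S by blast
  next
    case True
    have "VR - S \<noteq> {}" "VR - (VR - S) = S" using S by auto
    then have "3 \<le> ecount ER (VR - S) S" using main[of "VR - S"] True by simp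
    then show ?thesis by (simp add: ecount_commute)
  qed
qed

lemma cubic_ER: "cubic VR ER"
  unfolding cubic_def
proof (intro conjI ballI graph_ER)
  fix x assume x: "x \<in> VR"
  have fin: "finite (h ` Y)" using finY by simp
  have d: "h ` Y \<inter> W = {}" by (rule hW_disjoint) simp
  have split: "ecount ER {x} VR = ecount ER {x} (h ` Y) + ecount ER {x} W"
    unfolding VR_def using fin finW d by (intro ecount_Un_right) auto
  show "deg ER x = 3"
  proof (cases "x \<in> W")
    case False
    then obtain y where y: "y \<in> Y" "x = h y" using x by (auto simp: VR_def)
    have "ecount ER {x} (h ` Y) = ecount E {y} Y" using ecount_ER_inside[of "{y}" Y] y by simp
    moreover have "ecount ER {x} W = card {v \<in> set ts. out v = y}"
      using ecount_ER_W[of "{y}"] y ecount_commute[of ER "{x}" W] by simp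
    ultimately show ?thesis using deg_Y[OF y(1)] split ecount_vertex[OF graph_ER] by simp
  next
    case True
    have lt: "x < 2" using W_lt[OF True] .
    have "ecount ER {x} W = (if two then 1 else 0)"
    proof (cases two)
      case two: True
      then have W: "W = {x} \<union> {1 - x}" "x \<noteq> 1 - x" 
        unfolding W_def using lt by (auto simp: less_2_cases_iff)
      have "{x, 1 - x} = {0, 1}" using lt by auto
      then have "{x, 1 - x} \<in> ER" using middle_ER two by simp
      moreover have "ecount ER {x} ({x} \<union> {1 - x}) = ecount ER {x} {x} + ecount ER {x} {1 - x}"
        using W(2) by (intro ecount_Un_right) auto
      ultimately show ?thesis
        using W(1) two ecount_self_singleton[OF graph_ER] by (simp add: ecount_singletons)
    next
      case False
      then have "W = {x}" using True unfolding W_def by auto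
      then show ?thesis using False ecount_self_singleton[OF graph_ER] by simp
    qed
    moreover have "x = 0 \<or> x = 1" "\<not> two \<Longrightarrow> x = 0" using lt True unfolding W_def by auto
    ultimately show ?thesis
      using ecount_ER_boundary[of Y x] lt terminals_to_Y split ecount_vertex[OF graph_ER, of x]
      by (cases two) auto
  qed
qed

text \<open>The outer ends of the edges at 0 are distinct. The bound gives \<open>VR\<close> more
  than three vertices, as 3-connectivity demands.\<close>

lemma card_Y_ge: "(if two then 2 else 3) \<le> card Y"
proof -
  let ?T = "{v \<in> set ts. side va v = 0 \<and> out v \<in> Y}"
  have "inj_on out ?T" using out_inj by (auto simp: inj_on_def)
  then have "card ?T \<le> card Y" using finY by (intro card_inj_on_le[of out]) auto
  then show ?thesis using terminals_to_Y unfolding terminals_to_def by (cases two) auto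
qed

lemma three_connected_ER: "three_connected VR ER"
  using cubic_ER cut_ER card_VR card_Y_ge by (intro cut_ge_3_imp_three_connected) (auto split: if_splits)

end

section \<open>Carrying a decomposition of the smaller graph back\<close>

lemma count_list_map_filter:
  "distinct xs \<Longrightarrow> count_list (map g (filter P xs)) t = card {x \<in> set xs. P x \<and> g x = t}"
proof (induction xs)
  case (Cons x xs)
  have "{y \<in> set (x # xs). P y \<and> g y = t} =
      (if P x \<and> g x = t then insert x {y \<in> set xs. P y \<and> g y = t} else {y \<in> set xs. P y \<and> g y = t})"
    by auto
  then show ?case using Cons by auto
qed simp

text \<open>The type \<open>Tr\<close> must occur because the spanning tree reaches every
  vertex.\<close>

definition valid_types :: "edge_type list \<Rightarrow> bool" where
  "valid_types l \<longleftrightarrow> (count_list l Cy = 0 \<or> count_list l Cy = 2) \<and> count_list l Ma \<le> 1 \<and> Tr \<in> set l"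

text \<open>Some outgoing edge has type \<open>Tr\<close>, as otherwise the tree would not connect
  the new vertices to the outside.\<close>

definition feasible_types :: "nat list \<Rightarrow> nat list \<Rightarrow> bool \<Rightarrow> edge_type list \<Rightarrow> edge_type \<Rightarrow> bool" where
  "feasible_types ts va two \<tau> t \<longleftrightarrow> Tr \<in> set \<tau> \<and>
     list_all (\<lambda>w. valid_types (map snd (filter (\<lambda>(v, _). side va v = w) (zip ts \<tau>)) @ (if two then [t] else [])))
       (if two then [0, 1] else [0])"

locale reduced_decomposition = reduction +
  fixes T C M :: "nat set set"
  assumes parts: "T \<union> C \<union> M = ER" "T \<inter> C = {}" "T \<inter> M = {}" "C \<inter> M = {}"
    and tree: "spanning_tree VR ER T"
    and cycles: "two_regular_sub ER C"
    and match: "matching ER M"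
begin

definition etype :: "nat set \<Rightarrow> edge_type" where
  "etype e = (if e \<in> T then Tr else if e \<in> C then Cy else Ma)"

lemma etype_iff: "e \<in> ER \<Longrightarrow> etype e = Tr \<longleftrightarrow> e \<in> T" "e \<in> ER \<Longrightarrow> etype e = Cy \<longleftrightarrow> e \<in> C"
  "e \<in> ER \<Longrightarrow> etype e = Ma \<longleftrightarrow> e \<in> M"
  using parts by (auto simp: etype_def)

definition bd :: "nat \<Rightarrow> nat set" where "bd v = {side va v, h (out v)}"
definition \<tau> :: "edge_type list" where "\<tau> = map (\<lambda>v. etype (bd v)) ts"
definition ab :: bool where "ab \<longleftrightarrow> \<not> two \<or> {0, 1} \<in> T"
definition T0 where "T0 = {e \<in> EY. q ` e \<in> T}"
definition C0 where "C0 = {e \<in> EY. q ` e \<in> C}"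
definition M0 where "M0 = {e \<in> EY. q ` e \<in> M}"

text \<open>Joined by a path of tree edges inside \<open>Y\<close>, in the language of
  colourings.\<close>

definition linked :: "'a \<Rightarrow> 'a \<Rightarrow> bool" where
  "linked y z \<longleftrightarrow> (\<forall>c. monochromatic c T0 \<longrightarrow> c y = c z)"

lemma bd_ER: "v \<in> set ts \<Longrightarrow> bd v \<in> ER"
  using ER_boundary[OF out_Y side_lt] by (auto simp: bd_def)

text \<open>\<open>c\<close> on the outer vertices and \<open>w\<close> on the new ones form a
  single colouring of the smaller graph, and its tree is connected. The statements below on linked
  vertices follow from suitable choices of \<open>c\<close> and \<open>w\<close>.\<close>

lemma T_const:
  fixes c :: "'a \<Rightarrow> bool" and w :: "nat \<Rightarrow> bool"
  assumes inside: "\<And>y z. y \<in> Y \<Longrightarrow> z \<in> Y \<Longrightarrow> {h y, h z} \<in> T \<Longrightarrow> c y = c z"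
    and boundary: "\<And>v. v \<in> set ts \<Longrightarrow> bd v \<in> T \<Longrightarrow> c (out v) = w (side va v)"
    and middle: "two \<Longrightarrow> {0, 1} \<in> T \<Longrightarrow> w 0 = w 1"
  shows "y \<in> Y \<Longrightarrow> c y = w 0" "two \<Longrightarrow> w 1 = w 0"
proof -
  define c' where "c' k = (if k < 2 then w k else c (inv_into Y h k))" for k
  have c'h: "c' (h y) = c y" if "y \<in> Y" for y
    using that h_ge[OF that] hinj by (simp add: c'_def)
  have c'w: "c' k = w k" if "k < 2" for k using that by (simp add: c'_def)
  have "\<exists>a b. {u, v} = {a, b} \<and> c' a = c' b" if "{u, v} \<in> T" for u v
  proof -
    have "{u, v} \<in> ER" using that parts by blast
    then show ?thesis
    proof (cases rule: ER_cases)
      case (inside y z)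
      then show ?thesis using assms(1)[of y z] that c'h by metis
    next
      case (boundary v')
      then have "c' (side va v') = c' (h (out v'))"
        using assms(2)[of v'] that c'h[OF out_Y] c'w[OF side_lt] by (simp add: bd_def)
      then show ?thesis using boundary by blast
    next
      case middle
      then have "w 0 = w 1" using assms(3) that by metis
      then have "c' 0 = c' 1" using c'w by simp
      then show ?thesis using middle by blast
    qed
  qed
  then have "monochromatic c' T" unfolding monochromatic_def by (metis doubleton_eq_iff)
  moreover have "graph VR T" "connected VR T"
    using tree graph_subset[OF graph_ER] by (auto simp: spanning_tree_def)
  ultimately have *: "a \<in> VR \<Longrightarrow> b \<in> VR \<Longrightarrow> c' a = c' b" for a b
    using connected_iff_monochromatic by blast
  have "0 \<in> VR" unfolding VR_def W_def by simp
  then show "c y = w 0" if "y \<in> Y"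
    using *[of "h y" 0] that c'h[OF that] c'w[of 0] by (simp add: VR_def)
  show "w 1 = w 0" if two
  proof -
    have "1 \<in> VR" unfolding VR_def W_def using that by simp
    then show ?thesis using *[of 1 0] \<open>0 \<in> VR\<close> c'w[of 0] c'w[of 1] by simp
  qed
qed

lemma T0_iff: "y \<in> Y \<Longrightarrow> z \<in> Y \<Longrightarrow> {y, z} \<in> T0 \<longleftrightarrow> {h y, h z} \<in> T"
  using ER_inside[of y z] parts q_Y by (auto simp: T0_def EY_def)

lemma linked_edge: "{h y, h z} \<in> T \<Longrightarrow> y \<in> Y \<Longrightarrow> z \<in> Y \<Longrightarrow> linked y z"
  using T0_iff by (auto simp: linked_def monochromatic_def)

lemma linked_trans: "linked x y \<Longrightarrow> linked y z \<Longrightarrow> linked x z"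
  by (auto simp: linked_def)

lemma linked_sym: "linked x y \<Longrightarrow> linked y x"
  by (auto simp: linked_def)

lemma linked_refl: "linked x x"
  by (simp add: linked_def)

text \<open>Colour an outer vertex by whether it is linked to such an end, and the new vertices by
  True. No tree edge is bichromatic, so True is the only colour.\<close>

lemma linked_terminal:
  assumes "y \<in> Y"
  shows "\<exists>v\<in>set ts. etype (bd v) = Tr \<and> linked y (out v)"
proof -
  let ?c = "\<lambda>y. \<exists>v\<in>set ts. etype (bd v) = Tr \<and> linked y (out v)"
  have "?c y = (\<lambda>_. True) 0"
  proof (rule T_const(1))
    fix y z assume "y \<in> Y" "z \<in> Y" "{h y, h z} \<in> T"
    then have "linked y z" by (simp add: linked_edge)
    then show "?c y = ?c z" using linked_trans linked_sym by blast
  next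
    fix v assume "v \<in> set ts" "bd v \<in> T"
    then show "?c (out v) = True" using linked_refl by (auto simp: etype_def)
  qed (use assms in auto)
  then show ?thesis by simp
qed

text \<open>The tree path between the two new vertices has to run through \<open>Y\<close>.
  Formally, \<open>Y\<close> is coloured by being linked to the outer end of a tree edge at 0;
  without such a pair this colouring would separate the new vertices.\<close>

lemma linked_across:
  assumes "two" "{0, 1} \<notin> T"
  shows "\<exists>u\<in>set ts. \<exists>v\<in>set ts. u \<in> set va \<and> v \<notin> set va \<and> etype (bd u) = Tr \<and> etype (bd v) = Tr \<and>
     linked (out u) (out v)"
proof (rule ccontr)
  assume neg: "\<not> ?thesis"
  let ?c = "\<lambda>y. \<exists>u\<in>set ts. u \<in> set va \<and> etype (bd u) = Tr \<and> linked (out u) y"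
  let ?w = "\<lambda>s::nat. s = 0"
  have "?w 1 = ?w 0"
  proof (rule T_const(2)[of ?c ?w])
    fix y z assume "y \<in> Y" "z \<in> Y" "{h y, h z} \<in> T"
    then have "linked y z" by (simp add: linked_edge)
    then show "?c y = ?c z" using linked_trans linked_sym by blast
  next
    fix v assume v: "v \<in> set ts" "bd v \<in> T"
    then have t: "etype (bd v) = Tr" by (simp add: etype_def)
    show "?c (out v) = ?w (side va v)"
    proof (cases "v \<in> set va")
      case True
      then show ?thesis using v t linked_refl by (auto simp: side_def)
    next
      case False
      have "\<not> ?c (out v)"
      proof
        assume "?c (out v)"
        then obtain u where "u \<in> set ts" "u \<in> set va" "etype (bd u) = Tr" "linked (out u) (out v)"
          by (elim bexE conjE)
        then show False using neg v(1) t False by (meson bexI)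
      qed
      moreover have "\<not> ?w (side va v)" using False by (simp add: side_def)
      ultimately show ?thesis by blast
    qed
  next
    assume "{0, 1} \<in> T"
    then show "?w 0 = ?w 1" using assms(2) by contradiction
  qed (rule assms(1))
  then show False by simp
qed

text \<open>A tree path between two vertices of \<open>Z\<close> could leave \<open>Z\<close> only
  over a single edge and could not return. Formally, everything outside \<open>Z\<close> gets the
  colour \<open>k\<close> of the end in \<open>Z\<close> of that edge.\<close>

lemma linked_behind_bridge:
  assumes Z: "Z \<subseteq> Y" "ecount E (Y - Z) Z \<le> 1"
    and noT: "\<And>v. v \<in> set ts \<Longrightarrow> out v \<in> Z \<Longrightarrow> etype (bd v) \<noteq> Tr"
    and yz: "y \<in> Z" "z \<in> Z"
  shows "linked y z"
  unfolding linked_def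
proof (intro allI impI)
  fix c assume c: "monochromatic c T0"
  define k where "k = (\<exists>s t. (s, t) \<in> arcs_between E (Y - Z) Z \<and> c t)"
  have k: "c t = k" if st: "(s, t) \<in> arcs_between E (Y - Z) Z" for s t
  proof -
    have "finite (arcs_between E (Y - Z) Z)"
      using Z finY by (intro finite_arcs_between) (auto intro: finite_subset)
    then have uniq: "(s', t') = (s, t)" if "(s', t') \<in> arcs_between E (Y - Z) Z" for s' t'
      using Z(2) that st unfolding ecount_def by (metis One_nat_def card_le_Suc0_iff_eq)
    show ?thesis
    proof
      assume "c t"
      then show k unfolding k_def using st by blast
    next
      assume k
      then obtain s' t' where s't': "(s', t') \<in> arcs_between E (Y - Z) Z" "c t'" unfolding k_def by blast
      then show "c t" using uniq[OF s't'(1)] by simp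
    qed
  qed
  let ?c = "\<lambda>y. if y \<in> Z then c y else k"
  have "?c x = (\<lambda>_. k) 0" if "x \<in> Y" for x
  proof (rule T_const(1))
    fix a b assume ab: "a \<in> Y" "b \<in> Y" "{h a, h b} \<in> T"
    have "{a, b} \<in> T0" using ab T0_iff by blast
    then have "c a = c b" "{a, b} \<in> E" using c by (auto simp: monochromatic_def T0_def EY_def)
    then show "?c a = ?c b"
      using k[of a b] k[of b a] ab by (auto simp: arcs_between_iff insert_commute)
  next
    fix v assume "v \<in> set ts" "bd v \<in> T"
    then have "out v \<notin> Z" using noT[of v] by (auto simp: etype_def)
    then show "?c (out v) = k" by simp
  qed (use that in auto)
  then have "c y = k" "c z = k" using yz Z by (metis subsetD)+
  then show "c y = c z" by simp
qed

lemma length_\<tau>: "length \<tau> = length ts" by (simp add: \<tau>_def)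

lemma zip_\<tau>: "(v, t) \<in> set (zip ts \<tau>) \<longleftrightarrow> v \<in> set ts \<and> t = etype (bd v)"
  by (auto simp: \<tau>_def zip_map2 zip_same_conv_map)

lemma count_side:
  assumes "w \<in> W"
  shows "count_list (map snd (filter (\<lambda>(v, _). side va v = w) (zip ts \<tau>)) @ (if two then [etype {0, 1}] else [])) t
     = card {e \<in> ER. w \<in> e \<and> etype e = t}"
proof -
  let ?T = "{v \<in> set ts. side va v = w \<and> etype (bd v) = t}"
  let ?m = "if two \<and> etype {0, 1} = t then {{0, 1}} else {} :: nat set set"
  have "map snd (filter (\<lambda>(v, _). side va v = w) (zip ts \<tau>)) = map (\<lambda>v. etype (bd v)) (filter (\<lambda>v. side va v = w) ts)"
    by (simp add: \<tau>_def zip_map2 zip_same_conv_map filter_map comp_def)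
  then have 1: "count_list (map snd (filter (\<lambda>(v, _). side va v = w) (zip ts \<tau>))) t = card ?T"
    using count_list_map_filter[OF dts] by simp
  have inj: "inj_on bd ?T"
  proof (rule inj_onI)
    fix u v assume uv: "u \<in> ?T" "v \<in> ?T" "bd u = bd v"
    then have "h (out u) \<noteq> side va v" using h_neq[OF out_Y side_lt] by blast
    then have "h (out u) = h (out v)" using uv by (auto simp: bd_def doubleton_eq_iff)
    then show "u = v" using uv h_eq out_Y out_inj by simp
  qed
  have "{e \<in> ER. w \<in> e \<and> etype e = t} = bd ` ?T \<union> ?m"
  proof
    show "{e \<in> ER. w \<in> e \<and> etype e = t} \<subseteq> bd ` ?T \<union> ?m"
    proof
      fix e assume "e \<in> {e \<in> ER. w \<in> e \<and> etype e = t}"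
      then have e: "e \<in> ER" "w \<in> e" "etype e = t" by auto
      from e(1) show "e \<in> bd ` ?T \<union> ?m"
      proof (cases rule: ER_cases)
        case (inside y z)
        then show ?thesis using e(2) h_not_W assms by auto
      next
        case (boundary v)
        then have "w = side va v" using e(2) h_not_W[OF out_Y] assms by auto
        then show ?thesis using boundary e(3) by (auto simp: bd_def)
      next
        case middle
        then show ?thesis using e(3) by simp
      qed
    qed
    have "{0, 1} \<in> ER" "w \<in> {0, 1}" if two
      using middle_ER[OF that] assms that unfolding W_def by auto
    then show "bd ` ?T \<union> ?m \<subseteq> {e \<in> ER. w \<in> e \<and> etype e = t}"
      using bd_ER by (auto simp: bd_def split: if_splits)
  qed
  moreover have "bd ` ?T \<inter> ?m = {}"
  proof -
    have "bd v \<noteq> {0, 1}" if "v \<in> set ts" for v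
      using h_neq[OF out_Y[OF that], of 0] h_neq[OF out_Y[OF that], of 1] by (auto simp: bd_def doubleton_eq_iff)
    then show ?thesis by auto
  qed
  ultimately have "card {e \<in> ER. w \<in> e \<and> etype e = t} = card (bd ` ?T) + card ?m"
    by (simp add: card_Un_disjoint)
  also have "card (bd ` ?T) = card ?T" by (rule card_image[OF inj])
  finally show ?thesis using 1 by auto
qed

text \<open>The degree conditions hold at the new vertices since these are vertices of the smaller
  graph. The tree reaches each of them: otherwise a new vertex could be coloured differently from
  everything else.\<close>

lemma feasible: "feasible_types ts va two \<tau> (etype {0, 1})"
  unfolding feasible_types_def
proof
  have Yne: "\<exists>y. y \<in> Y" using card_Y_ge by (metis card.empty equals0I not_numeral_le_zero)
  show "Tr \<in> set \<tau>"
    using linked_terminal Yne by (force simp: \<tau>_def)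
  show "list_all (\<lambda>w. valid_types (map snd (filter (\<lambda>(v, _). side va v = w) (zip ts \<tau>)) @ (if two then [etype {0, 1}] else [])))
     (if two then [0, 1] else [0])"
    unfolding list_all_iff
  proof
    fix w assume "w \<in> set (if two then [0, 1] else [0 :: nat])"
    then have w: "w \<in> W" unfolding W_def by (auto split: if_splits)
    let ?l = "map snd (filter (\<lambda>(v, _). side va v = w) (zip ts \<tau>)) @ (if two then [etype {0, 1}] else [])"
    have "count_list ?l Cy = deg C w"
      unfolding count_side[OF w] deg_def using etype_iff parts
      by (intro arg_cong[where f = card]) blast
    moreover have "count_list ?l Ma = deg M w"
      unfolding count_side[OF w] deg_def using etype_iff parts
      by (intro arg_cong[where f = card]) blast
    moreover have "Tr \<in> set ?l"
    proof (rule ccontr)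
      assume no: "Tr \<notin> set ?l"
      let ?w = "\<lambda>s::nat. s = w"
      have bdn: "side va v \<noteq> w" if "v \<in> set ts" "bd v \<in> T" for v
      proof
        assume "side va v = w"
        then have "(v, Tr) \<in> set (filter (\<lambda>(v, _). side va v = w) (zip ts \<tau>))"
          using that zip_\<tau> by (simp add: etype_def)
        then have "Tr \<in> set ?l" by force
        then show False using no by simp
      qed
      have mid: "two \<Longrightarrow> {0, 1} \<notin> T" using no by (auto simp: etype_def split: if_splits)
      note con = T_const[of "\<lambda>_. False" ?w]
      obtain y where "y \<in> Y" using Yne by blast
      then have "False = ?w 0" by (intro con(1)[of y]) (use bdn mid in auto)
      moreover have "?w 1 = ?w 0" if two by (rule con(2)) (use that bdn mid in auto)
      ultimately show False using w unfolding W_def by (auto split: if_splits)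
    qed
    ultimately show "valid_types ?l"
      using cycles match by (simp add: valid_types_def two_regular_sub_def matching_def)
  qed
qed

lemma inj_on_image_q: "inj_on ((`) q) (EY \<union> set outer)"
proof (rule inj_onI)
  fix e e' assume e: "e \<in> EY \<union> set outer" "e' \<in> EY \<union> set outer" "q ` e = q ` e'"
  have ey: "\<exists>y\<in>Y. \<exists>z\<in>Y. x = {y, z} \<and> q ` x = {h y, h z}" if "x \<in> EY" for x
    using EY_edge[OF that] q_Y by fastforce
  have eo: "\<exists>v\<in>set ts. x = {f v, out v} \<and> q ` x = bd v" if "x \<in> set outer" for x
    using that q_outer unfolding outer_def bd_def by auto
  have mixed: "{h y, h z} \<noteq> bd v" if "y \<in> Y" "z \<in> Y" for y z v
    using that h_neq[OF _ side_lt] unfolding bd_def by (metis doubleton_eq_iff)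
  consider "e \<in> EY" "e' \<in> EY" | "e \<in> EY" "e' \<in> set outer" | "e \<in> set outer" "e' \<in> EY"
    | "e \<in> set outer" "e' \<in> set outer" using e by blast
  then show "e = e'"
  proof cases
    case 1
    obtain y z where 2: "y \<in> Y" "z \<in> Y" "e = {y, z}" "q ` e = {h y, h z}" using ey[OF 1(1)] by blast
    obtain y' z' where 3: "y' \<in> Y" "z' \<in> Y" "e' = {y', z'}" "q ` e' = {h y', h z'}" using ey[OF 1(2)] by blast
    have "{h y, h z} = {h y', h z'}" using 2 3 e(3) by simp
    then show ?thesis unfolding 2(3) 3(3) using h_eq 2(1,2) 3(1,2) by (auto simp: doubleton_eq_iff)
  next
    case 2
    then show ?thesis using ey[OF 2(1)] eo[OF 2(2)] mixed e(3) by metis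
  next
    case 3
    then show ?thesis using ey[OF 3(2)] eo[OF 3(1)] mixed e(3) by metis
  next
    case 4
    obtain u where u: "u \<in> set ts" "e = {f u, out u}" "q ` e = bd u" using eo[OF 4(1)] by blast
    obtain v where v: "v \<in> set ts" "e' = {f v, out v}" "q ` e' = bd v" using eo[OF 4(2)] by blast
    have "bd u = bd v" using u v e(3) by simp
    moreover have "h (out u) \<noteq> side va v" using h_neq[OF out_Y[OF u(1)] side_lt] .
    ultimately have "side va u = side va v" "h (out u) = h (out v)"
      by (auto simp: bd_def doubleton_eq_iff)
    then show ?thesis using out_inj[OF u(1) v(1)] h_eq[OF out_Y[OF u(1)] out_Y[OF v(1)]] u v by simp
  qed
qed

lemma h_in_q: "y \<in> Y \<Longrightarrow> e \<in> EY \<union> set outer \<Longrightarrow> h y \<in> q ` e \<longleftrightarrow> y \<in> e"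
proof -
  assume y: "y \<in> Y" and "e \<in> EY \<union> set outer"
  then have "e \<in> EY \<or> (\<exists>v\<in>set ts. e = {f v, out v})" unfolding outer_def by auto
  then consider a b where "a \<in> Y" "b \<in> Y" "e = {a, b}" | v where "v \<in> set ts" "e = {f v, out v}"
    using EY_edge[of e] by blast
  then show ?thesis
  proof cases
    case 1
    then show ?thesis using y q_Y h_eq by auto
  next
    case 2
    have "h y \<noteq> side va v" using h_neq[OF y side_lt] .
    moreover have "y \<noteq> f v" using y f_not_Y tsvs 2 by blast
    ultimately show ?thesis unfolding 2(2) q_outer[OF 2(1)] using h_eq[OF y out_Y[OF 2(1)]] by auto
  qed
qed

text \<open>Contracting is injective on the edges that are not inside the copy and keeps their outer
  ends, so degrees at an outer vertex can be read off in the large graph.\<close>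

lemma deg_pullback:
  assumes "K \<subseteq> ER" "y \<in> Y"
  shows "card {e \<in> EY \<union> set outer. q ` e \<in> K \<and> y \<in> e} = deg K (h y)"
proof -
  let ?A = "{e \<in> EY \<union> set outer. q ` e \<in> K \<and> y \<in> e}"
  have "(`) q ` ?A = {e \<in> K. h y \<in> e}"
  proof
    show "(`) q ` ?A \<subseteq> {e \<in> K. h y \<in> e}" using h_in_q[OF assms(2)] by auto
    show "{e \<in> K. h y \<in> e} \<subseteq> (`) q ` ?A"
    proof
      fix e assume e: "e \<in> {e \<in> K. h y \<in> e}"
      then have "e \<in> ER" "e \<noteq> {0, 1}"
        using assms h_neq[OF assms(2), of 0] h_neq[OF assms(2), of 1] by auto
      then obtain e' where "e' \<in> EY \<union> set outer" "e = q ` e'"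
        unfolding ER_def by (auto split: if_splits)
      then show "e \<in> (`) q ` ?A" using e h_in_q[OF assms(2)] by blast
    qed
  qed
  moreover have "inj_on ((`) q) ?A" using inj_on_image_q by (rule inj_on_subset) blast
  ultimately show ?thesis unfolding deg_def using card_image by fastforce
qed

text \<open>The tree \<open>T\<close> consists of edges outside, edges from the new vertices to the
  outside, and possibly the edge between the new vertices; contracting identifies no two edges of
  the first two groups.\<close>

lemma card_T0: "card T0 + count_list \<tau> Tr + (if two \<and> {0, 1} \<in> T then 1 else 0) < card VR"
proof -
  let ?O = "{e \<in> set outer. q ` e \<in> T}"
  let ?A = "T0 \<union> ?O"
  let ?m = "if two \<and> {0, 1} \<in> T then {{0, 1}} else {} :: nat set set"
  have finE: "finite EY" using graph_finite_edges[OF graph] by (simp add: EY_def)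
  have finT: "finite T" using tree graph_finite_edges[OF graph_ER] by (auto simp: spanning_tree_def intro: finite_subset)
  have "EY \<inter> set outer = {}" using E_split by auto
  then have sum: "card ?A = card T0 + card ?O"
    using finE by (intro card_Un_disjoint) (auto simp: T0_def)
  have "card ?O = card ((\<lambda>v. {f v, out v}) ` {v \<in> set ts. etype (bd v) = Tr})"
    using q_outer bd_ER etype_iff(1) unfolding outer_def bd_def by (intro arg_cong[where f = card]) auto
  also have "\<dots> = card {v \<in> set ts. etype (bd v) = Tr}"
    using tsvs f_eq f_not_Y out_Y by (intro card_image) (fastforce simp: inj_on_def doubleton_eq_iff)
  also have "\<dots> = count_list \<tau> Tr"
    using count_list_map_filter[OF dts, of "\<lambda>v. etype (bd v)" "\<lambda>_. True" Tr] by (simp add: \<tau>_def)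
  finally have cA: "card ?A = card T0 + count_list \<tau> Tr" using sum by simp
  have "inj_on ((`) q) ?A" using inj_on_image_q by (rule inj_on_subset) (auto simp: T0_def)
  then have "card ((`) q ` ?A) = card ?A" by (rule card_image)
  moreover have "(`) q ` ?A \<inter> ?m = {}"
  proof -
    have nq: "q ` e \<noteq> {0, 1}" if e: "e \<in> EY \<union> set outer" for e
    proof
      assume a: "q ` e = {0, 1}"
      obtain y where "y \<in> Y" "y \<in> e" using e EY_edge out_Y by (fastforce simp: outer_def)
      then have "h y \<in> {0, 1}" using h_in_q e a by blast
      then show False using h_ge[OF \<open>y \<in> Y\<close>] by auto
    qed
    have "{0, 1} \<notin> (`) q ` ?A"
    proof
      assume "{0, 1} \<in> (`) q ` ?A"
      then show False
      proof (rule imageE)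
        fix e assume e: "{0, 1} = q ` e" "e \<in> ?A"
        then have "e \<in> EY \<union> set outer" unfolding T0_def by auto
        then show False using nq e(1) by metis
      qed
    qed
    then show ?thesis by simp
  qed
  moreover have "finite ?A" using finE by (simp add: T0_def)
  ultimately have "card ((`) q ` ?A \<union> ?m) = card ?A + card ?m"
    by (subst card_Un_disjoint) auto
  moreover have "(`) q ` ?A \<union> ?m \<subseteq> T" by (auto simp: T0_def)
  then have "card ((`) q ` ?A \<union> ?m) \<le> card T" using finT by (rule card_mono[rotated])
  moreover have "card T < card VR"
    using tree graph_subset[OF graph_ER] card_Y_ge card_VR
    by (intro acyclic_card_less) (auto simp: spanning_tree_def VR_def W_def)
  moreover have "card ?m = (if two \<and> {0, 1} \<in> T then 1 else 0)" by simp
  ultimately show ?thesis using cA by linarith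
qed

text \<open>Outside the copy only matching edges at the boundary change, and they become tree edges;
  so cycle degrees stay the same and matching degrees do not grow. For connectivity, a colouring of
  the large graph is turned into one of the smaller graph, which is constant by
  \<open>T_const\<close>; the constant then spreads into the copy.\<close>

lemma extend:
  assumes ext: "extends_locally vs es ts va \<tau> ab Rs \<sigma> \<tau>'"
    and Rs: "\<And>u v. (u, v) \<in> set Rs \<Longrightarrow> linked (out u) (out v)"
  shows "three_decomposition V E"
proof -
  let ?cl = "edge_class (inner @ outer) (\<sigma> @ \<tau>')"
  have len: "length \<sigma> = length es" "length \<tau>' = length ts"
    and all2: "list_all2 (\<lambda>t t'. (t' = Cy \<longleftrightarrow> t = Cy) \<and> (t' = Ma \<longrightarrow> t = Ma)) \<tau> \<tau>'"
    and vert: "\<And>v. v \<in> set vs \<Longrightarrow> count_list (incident_types es ts \<sigma> \<tau>' v) Cy \<in> {0, 2} \<and>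
                 count_list (incident_types es ts \<sigma> \<tau>' v) Ma \<le> 1"
    and cnt: "count_list \<sigma> Tr + count_list \<tau>' Tr + (if ab then 1 else 2) = count_list \<tau> Tr + length vs"
    using ext length_\<tau> unfolding extends_locally_def Let_def
    by (auto simp: list_all_iff dest!: list_all2_lengthD)
  have zip_eq: "zip (inner @ outer) (\<sigma> @ \<tau>') = zip inner \<sigma> @ zip outer \<tau>'"
    using len by (simp add: inner_def)
  have types: "(t' = Cy \<longleftrightarrow> etype (bd v) = Cy) \<and> (t' = Ma \<longrightarrow> etype (bd v) = Ma)"
    if vt: "(v, t') \<in> set (zip ts \<tau>')" for v t'
  proof -
    obtain i where "i < length ts" "ts ! i = v" "\<tau>' ! i = t'"
      using vt by (auto simp: in_set_zip)
    then show ?thesis using list_all2_nthD2[OF all2, of i] len by (simp add: \<tau>_def)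
  qed
  have outer_type: "\<exists>v t'. e = {f v, out v} \<and> v \<in> set ts \<and> (v, t') \<in> set (zip ts \<tau>') \<and> (\<forall>t. e \<in> ?cl t \<longleftrightarrow> t = t')"
    if e: "e \<in> set outer" for e
  proof -
    obtain v where v: "v \<in> set ts" "e = {f v, out v}" using e by (auto simp: outer_def)
    obtain t' where t': "(v, t') \<in> set (zip ts \<tau>')" using v(1) len by (metis in_set_impl_in_set_zip1)
    then have "(e, t') \<in> set (zip outer \<tau>')" using v by (force simp: outer_def zip_map1)
    then have "e \<in> ?cl t'" unfolding edge_class_def zip_eq by simp
    then have "\<forall>t. e \<in> ?cl t \<longleftrightarrow> t = t'" using edge_class_disjoint[OF distinct_edges] by blast
    then show ?thesis using v t' by blast
  qed
  have clY: "{e \<in> K0 \<union> ?cl t. y \<in> e} = {e \<in> K0. y \<in> e} \<union> {e \<in> set outer. e \<in> ?cl t \<and> y \<in> e}"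
    if "y \<in> Y" for K0 t y
  proof -
    have "y \<notin> e" if "e \<in> set inner" for e
      using that \<open>y \<in> Y\<close> esvs f_not_Y by (fastforce simp: inner_def)
    then show ?thesis using edge_class_subset[of "inner @ outer"] by auto
  qed
  have qouter: "q ` e \<in> ER" if "e \<in> EY \<union> set outer" for e
    using that unfolding ER_def by blast
  have cover: "T0 \<union> C0 \<union> M0 = EY"
    using qouter parts(1) by (auto simp: T0_def C0_def M0_def)
  show ?thesis
  proof (rule assemble[OF len vert, of T0 C0 M0])
    show "T0 \<union> C0 \<union> M0 = EY" by (rule cover)
    show "T0 \<inter> C0 = {}" "T0 \<inter> M0 = {}" "C0 \<inter> M0 = {}"
      using parts by (auto simp: T0_def C0_def M0_def)
  next
    fix y assume y: "y \<in> Y"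
    have "e \<in> ?cl Cy \<longleftrightarrow> q ` e \<in> C" if e: "e \<in> set outer" for e
    proof -
      obtain v t' where v: "e = {f v, out v}" "v \<in> set ts" "(v, t') \<in> set (zip ts \<tau>')" "\<forall>t. e \<in> ?cl t \<longleftrightarrow> t = t'"
        using outer_type[OF e] by blast
      have "q ` e = bd v" using q_outer v by (simp add: bd_def)
      then show ?thesis using types[OF v(3)] v(4) etype_iff(2)[OF bd_ER[OF v(2)]] by auto
    qed
    then have "{e \<in> C0 \<union> ?cl Cy. y \<in> e} = {e \<in> EY \<union> set outer. q ` e \<in> C \<and> y \<in> e}"
      unfolding clY[OF y] by (auto simp: C0_def)
    moreover have "C \<subseteq> ER" using parts by blast
    ultimately have "deg (C0 \<union> ?cl Cy) y = deg C (h y)"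
      using deg_pullback[OF _ y, of C] by (simp add: deg_def[of "C0 \<union> ?cl Cy"])
    then show "deg (C0 \<union> ?cl Cy) y \<in> {0, 2}" using cycles by (simp add: two_regular_sub_def)
  next
    fix y assume y: "y \<in> Y"
    have "q ` e \<in> M" if e: "e \<in> set outer" "e \<in> ?cl Ma" for e
    proof -
      obtain v t' where v: "e = {f v, out v}" "v \<in> set ts" "(v, t') \<in> set (zip ts \<tau>')" "\<forall>t. e \<in> ?cl t \<longleftrightarrow> t = t'"
        using outer_type[OF e(1)] by blast
      have "q ` e = bd v" using q_outer v by (simp add: bd_def)
      then show ?thesis using types[OF v(3)] v(4) etype_iff(3)[OF bd_ER[OF v(2)]] e(2) by auto
    qed
    then have sub: "{e \<in> M0 \<union> ?cl Ma. y \<in> e} \<subseteq> {e \<in> EY \<union> set outer. q ` e \<in> M \<and> y \<in> e}"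
      unfolding clY[OF y] by (auto simp: M0_def)
    have "finite (EY \<union> set outer)" using graph_finite_edges[OF graph] by (simp add: EY_def)
    then have "deg (M0 \<union> ?cl Ma) y \<le> card {e \<in> EY \<union> set outer. q ` e \<in> M \<and> y \<in> e}"
      unfolding deg_def using sub by (intro card_mono) auto
    also have "\<dots> = deg M (h y)" using deg_pullback[of M, OF _ y] parts by auto
    also have "\<dots> \<le> 1" using match by (simp add: matching_def)
    finally show "deg (M0 \<union> ?cl Ma) y \<le> 1" .
  next
    have "card T0 + count_list \<tau> Tr + (if two \<and> {0, 1} \<in> T then 1 else 0) < card Y + (if two then 2 else 1)"
      using card_T0 card_VR by simp
    then show "card T0 + count_list (\<sigma> @ \<tau>') Tr < card V"
      using cnt cardV by (auto simp: ab_def split: if_splits)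
  next
    fix c u v assume c: "monochromatic c (T0 \<union> ?cl Tr)" and uv: "u \<in> V" "v \<in> V"
    have cT0: "monochromatic c T0" and ccl: "monochromatic c (?cl Tr)"
      using c by (auto simp: monochromatic_def)
    have "c (out u) = c (out v)" if "(u, v) \<in> set Rs" for u v
      using Rs[OF that] cT0 by (simp add: linked_def)
    from extends_locally_monochromatic[OF ext ccl this] obtain w :: "nat \<Rightarrow> bool" where w:
      "\<And>v. (v, Tr) \<in> set (zip ts \<tau>) \<Longrightarrow> c (out v) = w (side va v)" "ab \<Longrightarrow> w 0 = w 1"
      "\<And>k v. w 0 = k \<Longrightarrow> w 1 = k \<Longrightarrow> (\<And>u. u \<in> set ts \<Longrightarrow> c (out u) = k) \<Longrightarrow> v \<in> set vs \<Longrightarrow> c (f v) = k"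
      by metis
    have in_T: "c y = c z" if "y \<in> Y" "z \<in> Y" "{h y, h z} \<in> T" for y z
      using T0_iff[OF that(1,2)] that(3) cT0 by (simp add: monochromatic_def)
    have bd_T: "c (out v) = w (side va v)" if "v \<in> set ts" "bd v \<in> T" for v
      using w(1)[of v] that zip_\<tau> by (simp add: etype_def)
    have mid_T: "two \<Longrightarrow> {0, 1} \<in> T \<Longrightarrow> w 0 = w 1" using w(2) unfolding ab_def by simp
    note con = T_const[of c w, OF in_T bd_T mid_T]
    have cY: "c y = w 0" if "y \<in> Y" for y using con(1) that by blast
    have "w 1 = w 0"
    proof (cases two)
      case True
      then show ?thesis using con(2) by blast
    next
      case False
      then show ?thesis using w(2) unfolding ab_def by simp
    qed
    then have cX: "c (f v) = w 0" if "v \<in> set vs" for v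
      using w(3)[OF refl _ cY[OF out_Y]] that by blast
    have "c x = w 0" if "x \<in> V" for x
    proof (cases "x \<in> Y")
      case False
      then have "x \<in> X" using that XY by auto
      then obtain v where "v \<in> set vs" "x = f v" unfolding X_def by (rule imageE)
      then show ?thesis using cX by simp
    qed (rule cY)
    from this[OF uv(1)] this[OF uv(2)] show "c u = c v" by simp
  qed
qed

end

section \<open>Decomposition tables\<close>

text \<open>Soundness and completeness of a table. Its entries keep the outgoing types and need no
  links outside the piece; the lists in \<open>special\<close> are left to separate arguments that
  use such links.\<close>

definition table_ok ::
  "nat list \<Rightarrow> (nat \<times> nat) list \<Rightarrow> nat list \<Rightarrow> nat list \<Rightarrow> bool \<Rightarrow> (edge_type list \<times> bool) list \<Rightarrow>
   (edge_type list \<times> bool \<times> edge_type list) list \<Rightarrow> bool" where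
  "table_ok vs es ts va two special tbl \<longleftrightarrow>
     list_all (\<lambda>(\<tau>, ab, \<sigma>). extends_locally vs es ts va \<tau> ab [] \<sigma> \<tau>) tbl \<and>
     list_all (\<lambda>\<tau>. list_all (\<lambda>t. feasible_types ts va two \<tau> t \<longrightarrow>
         (\<tau>, \<not> two \<or> t = Tr) \<in> set (special @ map (\<lambda>(\<tau>, ab, _). (\<tau>, ab)) tbl)) [Tr, Cy, Ma])
       (List.n_lists (length ts) [Tr, Cy, Ma])"

definition "triangle_vs = ([0, 1, 2] :: nat list)"
definition "triangle_es = ([(0, 1), (1, 2), (2, 0)] :: (nat \<times> nat) list)"
definition "triangle_ts = ([0, 1, 2] :: nat list)"

text \<open>An entry gives the outgoing types in the order of the terminals, the flag
  \<open>ab\<close>, and the inner types in the order of the pattern edges. Any other completion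
  accepted by \<open>table_ok\<close> would serve as well.\<close>

definition triangle_table :: "(edge_type list \<times> bool \<times> edge_type list) list" where
  "triangle_table =
    [([Tr, Tr, Tr], True, [Tr, Tr, Ma]), ([Tr, Tr, Ma], True, [Ma, Tr, Tr]),
     ([Tr, Cy, Cy], True, [Tr, Cy, Tr]), ([Tr, Ma, Tr], True, [Tr, Tr, Ma]),
     ([Cy, Tr, Cy], True, [Tr, Tr, Cy]), ([Cy, Cy, Tr], True, [Cy, Tr, Tr]),
     ([Ma, Tr, Tr], True, [Tr, Ma, Tr])]"

lemma triangle_table_ok:
  "table_ok triangle_vs triangle_es triangle_ts [0, 1, 2] False
     [] triangle_table"
  by code_simp

definition "K23_vs = ([0, 1, 2, 3, 4] :: nat list)"
definition "K23_es = ([(0, 2), (0, 3), (0, 4), (1, 2), (1, 3), (1, 4)] :: (nat \<times> nat) list)"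
definition "K23_ts = ([2, 3, 4] :: nat list)"

definition K23_table :: "(edge_type list \<times> bool \<times> edge_type list) list" where
  "K23_table =
    [([Tr, Tr, Tr], True, [Tr, Tr, Ma, Tr, Ma, Tr]), ([Tr, Tr, Ma], True, [Tr, Ma, Tr, Ma, Tr, Tr]),
     ([Tr, Cy, Cy], True, [Tr, Tr, Tr, Tr, Cy, Cy]), ([Tr, Ma, Tr], True, [Tr, Tr, Ma, Ma, Tr, Tr]),
     ([Cy, Tr, Cy], True, [Tr, Tr, Tr, Cy, Tr, Cy]), ([Cy, Cy, Tr], True, [Tr, Tr, Tr, Cy, Cy, Tr]),
     ([Ma, Tr, Tr], True, [Tr, Tr, Ma, Tr, Ma, Tr])]"

lemma K23_table_ok:
  "table_ok K23_vs K23_es K23_ts [2, 3, 4] False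
     [] K23_table"
  by code_simp

definition "petersen_minus_vs = ([1, 2, 3, 4, 5, 6, 7, 8, 9] :: nat list)"
definition "petersen_minus_es = ([(1, 2), (2, 3), (3, 4), (1, 6), (2, 7), (3, 8), (4, 9), (5, 7), (7, 9), (9, 6), (6, 8), (8, 5)] :: (nat \<times> nat) list)"
definition "petersen_minus_ts = ([1, 4, 5] :: nat list)"

definition petersen_minus_table :: "(edge_type list \<times> bool \<times> edge_type list) list" where
  "petersen_minus_table =
    [([Tr, Tr, Tr], True, [Tr, Tr, Tr, Ma, Tr, Ma, Ma, Ma, Tr, Tr, Tr, Tr]),
     ([Tr, Cy, Cy], True, [Tr, Tr, Tr, Tr, Tr, Tr, Cy, Tr, Tr, Cy, Cy, Cy]),
     ([Cy, Tr, Cy], True, [Tr, Tr, Tr, Cy, Tr, Tr, Tr, Tr, Ma, Tr, Cy, Cy]),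
     ([Cy, Cy, Tr], True, [Tr, Tr, Tr, Cy, Tr, Tr, Cy, Tr, Tr, Cy, Tr, Ma])]"

lemma petersen_minus_table_ok:
  "table_ok petersen_minus_vs petersen_minus_es petersen_minus_ts [1, 4, 5] False
     [([Tr, Tr, Ma], True), ([Tr, Ma, Tr], True), ([Ma, Tr, Tr], True)] petersen_minus_table"
  by code_simp

definition "claw_square_vs = ([0, 1, 2, 3, 4, 5, 6, 7] :: nat list)"
definition "claw_square_es = ([(0, 1), (1, 2), (2, 3), (3, 0), (7, 4), (7, 5), (7, 6), (4, 0), (5, 1), (6, 2)] :: (nat \<times> nat) list)"
definition "claw_square_ts = ([3, 4, 5, 6] :: nat list)"

definition claw_square1_table :: "(edge_type list \<times> bool \<times> edge_type list) list" where
  "claw_square1_table =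
    [([Tr, Tr, Tr, Tr], True, [Tr, Tr, Tr, Ma, Tr, Tr, Tr, Tr, Ma, Ma]),
     ([Tr, Tr, Tr, Tr], False, [Tr, Tr, Tr, Ma, Ma, Tr, Tr, Tr, Ma, Ma]),
     ([Tr, Tr, Tr, Ma], True, [Tr, Tr, Tr, Ma, Ma, Tr, Tr, Tr, Ma, Tr]),
     ([Tr, Tr, Cy, Cy], True, [Tr, Tr, Tr, Ma, Tr, Cy, Cy, Tr, Tr, Tr]),
     ([Tr, Tr, Ma, Tr], True, [Tr, Tr, Tr, Ma, Ma, Tr, Tr, Tr, Tr, Ma]),
     ([Tr, Cy, Tr, Cy], False, [Tr, Tr, Tr, Ma, Cy, Tr, Cy, Tr, Ma, Tr]),
     ([Tr, Cy, Cy, Tr], False, [Tr, Tr, Tr, Ma, Cy, Cy, Tr, Tr, Tr, Ma]),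
     ([Tr, Ma, Tr, Tr], True, [Tr, Tr, Tr, Ma, Tr, Tr, Tr, Tr, Ma, Ma]),
     ([Tr, Ma, Tr, Ma], True, [Tr, Ma, Tr, Ma, Tr, Ma, Tr, Tr, Tr, Tr]),
     ([Tr, Ma, Cy, Cy], True, [Tr, Tr, Tr, Ma, Tr, Cy, Cy, Tr, Tr, Tr]),
     ([Tr, Ma, Ma, Tr], True, [Ma, Tr, Ma, Tr, Tr, Tr, Ma, Tr, Tr, Tr]),
     ([Cy, Tr, Tr, Cy], False, [Tr, Tr, Tr, Cy, Cy, Tr, Cy, Cy, Tr, Tr]),
     ([Cy, Tr, Cy, Tr], False, [Tr, Tr, Tr, Cy, Cy, Cy, Tr, Cy, Tr, Tr]),
     ([Cy, Cy, Tr, Tr], True, [Tr, Tr, Tr, Cy, Tr, Tr, Tr, Cy, Tr, Ma]),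
     ([Cy, Cy, Tr, Ma], True, [Tr, Tr, Tr, Cy, Tr, Tr, Tr, Cy, Ma, Tr]),
     ([Cy, Cy, Ma, Tr], True, [Tr, Tr, Tr, Cy, Tr, Tr, Tr, Cy, Tr, Ma]),
     ([Ma, Tr, Tr, Tr], True, [Tr, Ma, Tr, Tr, Tr, Tr, Ma, Ma, Tr, Tr]),
     ([Ma, Tr, Tr, Ma], True, [Tr, Ma, Tr, Tr, Tr, Ma, Tr, Ma, Tr, Tr]),
     ([Ma, Tr, Cy, Cy], True, [Tr, Cy, Tr, Tr, Tr, Tr, Tr, Tr, Cy, Cy]),
     ([Ma, Tr, Ma, Tr], True, [Tr, Ma, Tr, Tr, Tr, Tr, Ma, Ma, Tr, Tr])]"

lemma claw_square1_table_ok: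
  "table_ok claw_square_vs claw_square_es claw_square_ts [3, 4] True
     [] claw_square1_table"
  by code_simp

text \<open>The second pairing is the mirror image of the first under the symmetry of the
  claw-square that exchanges 4 with 6 and 0 with 2.\<close>

definition claw_square2_table :: "(edge_type list \<times> bool \<times> edge_type list) list" where
  "claw_square2_table =
    [([Tr, Tr, Tr, Tr], True, [Tr, Tr, Tr, Ma, Tr, Tr, Tr, Tr, Ma, Ma]),
     ([Tr, Tr, Tr, Tr], False, [Tr, Tr, Ma, Tr, Tr, Tr, Ma, Ma, Ma, Tr]),
     ([Tr, Tr, Tr, Ma], True, [Tr, Tr, Tr, Ma, Ma, Tr, Tr, Tr, Ma, Tr]),
     ([Tr, Tr, Cy, Cy], False, [Tr, Tr, Ma, Tr, Tr, Cy, Cy, Ma, Tr, Tr]),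
     ([Tr, Tr, Ma, Tr], True, [Tr, Tr, Tr, Ma, Ma, Tr, Tr, Tr, Tr, Ma]),
     ([Tr, Tr, Ma, Ma], True, [Tr, Ma, Tr, Ma, Ma, Tr, Tr, Tr, Tr, Tr]),
     ([Tr, Cy, Tr, Cy], False, [Tr, Tr, Tr, Ma, Cy, Tr, Cy, Tr, Ma, Tr]),
     ([Tr, Cy, Cy, Tr], True, [Tr, Tr, Tr, Ma, Cy, Cy, Tr, Tr, Tr, Tr]),
     ([Tr, Cy, Cy, Ma], True, [Tr, Tr, Tr, Ma, Cy, Cy, Tr, Tr, Tr, Tr]),
     ([Tr, Ma, Tr, Tr], True, [Tr, Tr, Tr, Ma, Tr, Tr, Tr, Tr, Ma, Ma]),
     ([Tr, Ma, Tr, Ma], True, [Tr, Ma, Tr, Ma, Tr, Ma, Tr, Tr, Tr, Tr]),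
     ([Cy, Tr, Tr, Cy], True, [Tr, Tr, Cy, Tr, Tr, Tr, Tr, Tr, Ma, Cy]),
     ([Cy, Tr, Cy, Tr], False, [Tr, Tr, Tr, Cy, Cy, Cy, Tr, Cy, Tr, Tr]),
     ([Cy, Tr, Ma, Cy], True, [Tr, Tr, Cy, Tr, Tr, Tr, Tr, Ma, Tr, Cy]),
     ([Cy, Cy, Tr, Tr], False, [Tr, Tr, Tr, Cy, Tr, Tr, Ma, Cy, Ma, Tr]),
     ([Cy, Ma, Tr, Cy], True, [Tr, Tr, Cy, Tr, Tr, Tr, Tr, Tr, Ma, Cy]),
     ([Ma, Tr, Tr, Tr], True, [Tr, Ma, Tr, Tr, Tr, Tr, Ma, Ma, Tr, Tr]),
     ([Ma, Tr, Ma, Tr], True, [Tr, Ma, Tr, Tr, Tr, Tr, Ma, Ma, Tr, Tr]),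
     ([Ma, Cy, Cy, Tr], True, [Tr, Ma, Tr, Tr, Cy, Cy, Tr, Tr, Tr, Tr]),
     ([Ma, Ma, Tr, Tr], True, [Ma, Tr, Tr, Tr, Tr, Ma, Tr, Tr, Tr, Ma])]"

lemma claw_square2_table_ok:
  "table_ok claw_square_vs claw_square_es claw_square_ts [3, 6] True
     [] claw_square2_table"
  by code_simp

definition "twin_house_vs = ([1, 2, 3, 4, 5, 6] :: nat list)"
definition "twin_house_es = ([(1, 2), (1, 5), (2, 6), (5, 3), (5, 4), (6, 3), (6, 4)] :: (nat \<times> nat) list)"
definition "twin_house_ts = ([1, 2, 3, 4] :: nat list)"

definition twin_house1_table :: "(edge_type list \<times> bool \<times> edge_type list) list" where
  "twin_house1_table =
    [([Tr, Tr, Tr, Tr], True, [Tr, Tr, Tr, Tr, Ma, Ma, Tr]),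
     ([Tr, Tr, Tr, Ma], True, [Tr, Tr, Ma, Ma, Tr, Tr, Tr]),
     ([Tr, Tr, Cy, Cy], True, [Tr, Tr, Tr, Tr, Tr, Cy, Cy]),
     ([Tr, Tr, Ma, Tr], True, [Tr, Tr, Ma, Tr, Ma, Tr, Tr]),
     ([Tr, Cy, Tr, Cy], False, [Tr, Tr, Cy, Ma, Tr, Tr, Cy]),
     ([Tr, Cy, Cy, Tr], False, [Tr, Tr, Cy, Tr, Ma, Cy, Tr]),
     ([Tr, Ma, Tr, Tr], True, [Tr, Tr, Tr, Tr, Ma, Ma, Tr]),
     ([Tr, Ma, Tr, Ma], True, [Tr, Ma, Tr, Tr, Tr, Ma, Tr]),
     ([Tr, Ma, Cy, Cy], True, [Tr, Tr, Tr, Tr, Tr, Cy, Cy]),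
     ([Tr, Ma, Ma, Tr], True, [Tr, Ma, Tr, Tr, Tr, Tr, Ma]),
     ([Cy, Tr, Tr, Cy], False, [Tr, Cy, Tr, Tr, Cy, Ma, Tr]),
     ([Cy, Tr, Cy, Tr], False, [Tr, Cy, Tr, Cy, Tr, Tr, Ma]),
     ([Cy, Cy, Tr, Tr], True, [Cy, Tr, Tr, Tr, Tr, Tr, Ma]),
     ([Cy, Cy, Tr, Ma], True, [Cy, Tr, Tr, Tr, Tr, Ma, Tr]),
     ([Cy, Cy, Ma, Tr], True, [Cy, Tr, Tr, Tr, Tr, Tr, Ma]),
     ([Ma, Tr, Tr, Tr], True, [Tr, Tr, Tr, Tr, Ma, Ma, Tr]),
     ([Ma, Tr, Tr, Ma], True, [Tr, Tr, Ma, Ma, Tr, Tr, Tr]),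
     ([Ma, Tr, Cy, Cy], True, [Tr, Tr, Tr, Tr, Tr, Cy, Cy]),
     ([Ma, Tr, Ma, Tr], True, [Tr, Tr, Ma, Tr, Ma, Tr, Tr])]"

lemma twin_house1_table_ok:
  "table_ok twin_house_vs twin_house_es twin_house_ts [1, 2] True
     [([Tr, Tr, Tr, Tr], False)] twin_house1_table"
  by code_simp

definition twin_house2_table :: "(edge_type list \<times> bool \<times> edge_type list) list" where
  "twin_house2_table =
    [([Tr, Tr, Tr, Tr], True, [Tr, Tr, Tr, Tr, Ma, Ma, Tr]),
     ([Tr, Tr, Tr, Tr], False, [Ma, Tr, Tr, Tr, Ma, Ma, Tr]),
     ([Tr, Tr, Tr, Ma], True, [Tr, Tr, Ma, Ma, Tr, Tr, Tr]),
     ([Tr, Tr, Cy, Cy], False, [Ma, Tr, Tr, Tr, Tr, Cy, Cy]),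
     ([Tr, Tr, Ma, Tr], True, [Tr, Tr, Ma, Tr, Ma, Tr, Tr]),
     ([Tr, Cy, Tr, Cy], True, [Tr, Tr, Cy, Tr, Tr, Tr, Cy]),
     ([Tr, Cy, Cy, Tr], False, [Tr, Tr, Cy, Tr, Ma, Cy, Tr]),
     ([Tr, Cy, Ma, Cy], True, [Tr, Tr, Cy, Tr, Tr, Tr, Cy]),
     ([Tr, Ma, Tr, Tr], True, [Tr, Tr, Tr, Tr, Ma, Ma, Tr]),
     ([Tr, Ma, Ma, Tr], True, [Tr, Ma, Tr, Tr, Tr, Tr, Ma]),
     ([Cy, Tr, Tr, Cy], False, [Tr, Cy, Tr, Tr, Cy, Ma, Tr]),
     ([Cy, Tr, Cy, Tr], True, [Tr, Cy, Tr, Cy, Tr, Tr, Tr]),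
     ([Cy, Tr, Cy, Ma], True, [Tr, Cy, Tr, Cy, Tr, Tr, Tr]),
     ([Cy, Cy, Tr, Tr], False, [Cy, Tr, Tr, Tr, Ma, Ma, Tr]),
     ([Cy, Ma, Cy, Tr], True, [Tr, Cy, Tr, Cy, Tr, Tr, Tr]),
     ([Ma, Tr, Tr, Tr], True, [Tr, Tr, Tr, Tr, Ma, Ma, Tr]),
     ([Ma, Tr, Tr, Ma], True, [Tr, Tr, Ma, Ma, Tr, Tr, Tr]),
     ([Ma, Cy, Tr, Cy], True, [Tr, Tr, Cy, Tr, Tr, Tr, Cy]),
     ([Ma, Ma, Tr, Tr], True, [Tr, Tr, Tr, Tr, Ma, Ma, Tr])]"

lemma twin_house2_table_ok:
  "table_ok twin_house_vs twin_house_es twin_house_ts [1, 3] True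
     [([Tr, Tr, Ma, Ma], True)] twin_house2_table"
  by code_simp

definition "domino_vs = ([0, 1, 2, 3, 4, 5] :: nat list)"
definition "domino_es = ([(0, 1), (1, 2), (3, 4), (4, 5), (0, 3), (1, 4), (2, 5)] :: (nat \<times> nat) list)"
definition "domino_ts = ([0, 2, 3, 5] :: nat list)"

definition domino1_table :: "(edge_type list \<times> bool \<times> edge_type list) list" where
  "domino1_table =
    [([Tr, Tr, Tr, Tr], True, [Tr, Tr, Tr, Tr, Tr, Ma, Ma]),
     ([Tr, Tr, Tr, Tr], False, [Tr, Tr, Tr, Tr, Ma, Ma, Ma]),
     ([Tr, Tr, Tr, Ma], True, [Tr, Tr, Tr, Tr, Ma, Ma, Tr]),
     ([Tr, Tr, Cy, Cy], True, [Tr, Tr, Cy, Cy, Tr, Tr, Tr]),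
     ([Tr, Tr, Ma, Tr], True, [Tr, Tr, Tr, Tr, Tr, Ma, Ma]),
     ([Tr, Cy, Tr, Cy], False, [Tr, Tr, Tr, Tr, Ma, Ma, Cy]),
     ([Tr, Cy, Cy, Tr], False, [Tr, Tr, Cy, Cy, Tr, Tr, Cy]),
     ([Tr, Ma, Tr, Tr], True, [Tr, Tr, Tr, Tr, Ma, Ma, Tr]),
     ([Tr, Ma, Tr, Ma], True, [Tr, Tr, Tr, Tr, Ma, Ma, Tr]),
     ([Tr, Ma, Cy, Cy], True, [Tr, Tr, Cy, Cy, Tr, Tr, Tr]),
     ([Tr, Ma, Ma, Tr], True, [Ma, Tr, Tr, Ma, Tr, Tr, Tr]),
     ([Cy, Tr, Tr, Cy], False, [Tr, Tr, Cy, Cy, Cy, Tr, Tr]),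
     ([Cy, Tr, Cy, Tr], False, [Tr, Tr, Tr, Tr, Cy, Ma, Ma]),
     ([Cy, Cy, Tr, Tr], True, [Cy, Cy, Tr, Tr, Tr, Tr, Tr]),
     ([Cy, Cy, Tr, Ma], True, [Cy, Cy, Tr, Tr, Tr, Tr, Tr]),
     ([Cy, Cy, Ma, Tr], True, [Cy, Cy, Tr, Tr, Tr, Tr, Tr]),
     ([Ma, Tr, Tr, Tr], True, [Tr, Tr, Tr, Tr, Tr, Ma, Ma]),
     ([Ma, Tr, Tr, Ma], True, [Tr, Ma, Ma, Tr, Tr, Tr, Tr]),
     ([Ma, Tr, Cy, Cy], True, [Tr, Tr, Cy, Cy, Tr, Tr, Tr]),
     ([Ma, Tr, Ma, Tr], True, [Tr, Tr, Tr, Tr, Tr, Ma, Ma])]"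

lemma domino1_table_ok:
  "table_ok domino_vs domino_es domino_ts [0, 2] True
     [] domino1_table"
  by code_simp

definition domino2_table :: "(edge_type list \<times> bool \<times> edge_type list) list" where
  "domino2_table =
    [([Tr, Tr, Tr, Tr], True, [Tr, Tr, Tr, Tr, Tr, Ma, Ma]),
     ([Tr, Tr, Tr, Tr], False, [Tr, Ma, Tr, Ma, Ma, Tr, Tr]),
     ([Tr, Tr, Tr, Ma], True, [Tr, Tr, Tr, Tr, Ma, Ma, Tr]),
     ([Tr, Tr, Cy, Cy], False, [Tr, Ma, Cy, Cy, Tr, Tr, Tr]),
     ([Tr, Tr, Ma, Tr], True, [Tr, Tr, Tr, Tr, Tr, Ma, Ma]),
     ([Tr, Cy, Tr, Cy], True, [Tr, Tr, Tr, Tr, Tr, Ma, Cy]),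
     ([Tr, Cy, Cy, Tr], False, [Tr, Tr, Cy, Cy, Tr, Tr, Cy]),
     ([Tr, Cy, Ma, Cy], True, [Tr, Tr, Tr, Tr, Tr, Ma, Cy]),
     ([Tr, Ma, Tr, Tr], True, [Tr, Tr, Tr, Tr, Ma, Ma, Tr]),
     ([Tr, Ma, Ma, Tr], True, [Ma, Tr, Tr, Ma, Tr, Tr, Tr]),
     ([Cy, Tr, Tr, Cy], False, [Tr, Tr, Cy, Cy, Cy, Tr, Tr]),
     ([Cy, Tr, Cy, Tr], True, [Tr, Tr, Tr, Tr, Cy, Tr, Ma]),
     ([Cy, Tr, Cy, Ma], True, [Tr, Tr, Tr, Tr, Cy, Ma, Tr]),
     ([Cy, Cy, Tr, Tr], False, [Cy, Cy, Tr, Ma, Tr, Tr, Tr]),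
     ([Cy, Ma, Cy, Tr], True, [Tr, Tr, Tr, Tr, Cy, Ma, Tr]),
     ([Ma, Tr, Tr, Tr], True, [Tr, Tr, Tr, Tr, Tr, Ma, Ma]),
     ([Ma, Tr, Tr, Ma], True, [Tr, Ma, Ma, Tr, Tr, Tr, Tr]),
     ([Ma, Cy, Tr, Cy], True, [Tr, Tr, Tr, Tr, Tr, Ma, Cy])]"

lemma domino2_table_ok:
  "table_ok domino_vs domino_es domino_ts [0, 3] True
     [([Tr, Tr, Ma, Ma], True), ([Ma, Ma, Tr, Tr], True)] domino2_table"
  by code_simp

section \<open>Copies of a pattern\<close>

definition pattern_ok :: "nat list \<Rightarrow> (nat \<times> nat) list \<Rightarrow> nat list \<Rightarrow> bool" where
  "pattern_ok vs es ts \<longleftrightarrow> distinct vs \<and> distinct ts \<and> list_all (\<lambda>v. v \<in> set vs) ts \<and>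
     list_all (\<lambda>(a, b). a \<in> set vs \<and> b \<in> set vs) es \<and> distinct (map (\<lambda>(a, b). {a, b}) es) \<and>
     list_all (\<lambda>v. length (filter (\<lambda>(a, b). a = v \<or> b = v) es) = (if v \<in> set ts then 2 else 3)) vs"

text \<open>In contrast to \<open>piece\<close>, the third edge at a terminal may lead back into the
  copy, since the subgraph need not be induced. By \<open>out_new\<close> such a chord is never the
  image of a pattern edge.\<close>

locale pattern_copy =
  fixes V :: "'a set" and E :: "'a set set" and f :: "nat \<Rightarrow> 'a"
    and vs :: "nat list" and es :: "(nat \<times> nat) list" and ts :: "nat list"
    and out :: "nat \<Rightarrow> 'a"
  assumes cubic: "cubic V E" and cut_ge_3: "cut_ge_3 V E"
    and pattern: "pattern_ok vs es ts"
    and inj_f: "inj_on f (set vs)" and f_V: "f ` set vs \<subseteq> V"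
    and es_E: "(a, b) \<in> set es \<Longrightarrow> {f a, f b} \<in> E"
    and out_E: "v \<in> set ts \<Longrightarrow> {f v, out v} \<in> E"
    and out_new: "v \<in> set ts \<Longrightarrow> (a, b) \<in> set es \<Longrightarrow> {f v, out v} \<noteq> {f a, f b}"
    and edges_at: "v \<in> set vs \<Longrightarrow> e \<in> E \<Longrightarrow> f v \<in> e \<Longrightarrow>
       (\<exists>(a, b) \<in> set es. e = {f a, f b}) \<or> (v \<in> set ts \<and> e = {f v, out v})"
begin

lemma pattern_facts:
  "distinct vs" "distinct ts" "set ts \<subseteq> set vs" "set es \<subseteq> set vs \<times> set vs"
  "distinct (map (\<lambda>(a, b). {a, b}) es)"
  using pattern by (auto simp: pattern_ok_def list_all_iff)

lemma graph: "graph V E" using cubic by (simp add: cubic_def)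

lemma out_V: "v \<in> set ts \<Longrightarrow> out v \<in> V"
  using graph_edgeD[OF graph out_E] by blast

text \<open>The third edge at \<open>v\<close> is not the image of a pattern edge, so it has to be
  the third edge at its other end too.\<close>

lemma chord_sym:
  assumes "v \<in> set ts" "u \<in> set vs" "out v = f u"
  shows "u \<in> set ts" "out u = f v" "u \<noteq> v"
proof -
  have e: "{f v, f u} \<in> E" using out_E[OF assms(1)] assms(3) by simp
  have "\<not> (\<exists>(a, b) \<in> set es. {f v, f u} = {f a, f b})" using out_new[OF assms(1)] assms(3) by auto
  then have *: "u \<in> set ts" "{f v, f u} = {f u, out u}" using edges_at[OF assms(2) e] by auto
  have "f u \<noteq> f v" using graph_edgeD(3)[OF graph e] by simp
  with * show "u \<in> set ts" "out u = f v" "u \<noteq> v" by (auto simp: doubleton_eq_iff)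
qed

lemma piece:
  assumes "\<And>v. v \<in> set ts \<Longrightarrow> out v \<notin> f ` set vs"
  shows "piece V E f vs es ts out"
proof
  fix e assume e: "e \<in> E" "e \<inter> f ` set vs \<noteq> {}"
  then obtain v where "v \<in> set vs" "f v \<in> e" by blast
  then show "(\<exists>(a, b) \<in> set es. e = {f a, f b}) \<or> (\<exists>v \<in> set ts. e = {f v, out v})"
    using edges_at e(1) by blast
qed (use cubic cut_ge_3 pattern_facts inj_f f_V es_E out_E out_V assms in auto)

lemma arcs_out:
  "arcs_between E (f ` set vs) (V - f ` set vs) \<subseteq> (\<lambda>v. (f v, out v)) ` {v \<in> set ts. out v \<notin> f ` set vs}"
proof
  fix p assume "p \<in> arcs_between E (f ` set vs) (V - f ` set vs)"
  then obtain v y where v: "p = (f v, y)" "v \<in> set vs" "y \<notin> f ` set vs" "{f v, y} \<in> E"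
    by (auto simp: arcs_between_def)
  have "{f v, y} \<noteq> {f a, f b}" if "(a, b) \<in> set es" for a b
  proof
    assume "{f v, y} = {f a, f b}"
    then have "y \<in> {f a, f b}" by blast
    then show False using that pattern_facts(4) v(3) by auto
  qed
  then have "v \<in> set ts" "{f v, y} = {f v, out v}" using edges_at[OF v(2,4)] by auto
  then show "p \<in> (\<lambda>v. (f v, out v)) ` {v \<in> set ts. out v \<notin> f ` set vs}"
    using v by (auto simp: doubleton_eq_iff)
qed

text \<open>A chord leaves at most two edges going out of the copy, so the copy is the whole graph.\<close>

lemma chord_imp_all_inside:
  assumes len: "length ts \<le> 4" and v: "v \<in> set ts" "out v \<in> f ` set vs" and w: "w \<in> set ts"
  shows "out w \<in> f ` set vs"
proof (rule ccontr)
  assume w_out: "out w \<notin> f ` set vs"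
  obtain u where u: "u \<in> set vs" "out v = f u" using v(2) by blast
  note uv = chord_sym[OF v(1) u]
  let ?O = "{v \<in> set ts. out v \<notin> f ` set vs}"
  have "?O \<subseteq> set ts - {u, v}" using u v uv pattern_facts(3) by auto
  then have "card ?O \<le> card (set ts - {u, v})" by (intro card_mono) auto
  also have "\<dots> = length ts - 2"
    using v(1) uv pattern_facts(2) by (subst card_Diff_subset) (auto simp: distinct_card)
  finally have cO: "card ?O \<le> 2" using len by simp
  have "ecount E (f ` set vs) (V - f ` set vs) \<le> card ((\<lambda>v. (f v, out v)) ` ?O)"
    unfolding ecount_def using arcs_out by (intro card_mono) auto
  also have "\<dots> \<le> card ?O" by (intro card_image_le) simp
  finally have "ecount E (f ` set vs) (V - f ` set vs) \<le> 2" using cO by simp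
  moreover have "f ` set vs \<noteq> V" using w_out out_V[OF w] by blast
  moreover have "f ` set vs \<noteq> {}" using u(1) by auto
  ultimately show False using cut_ge_3D[OF cut_ge_3 f_V] by fastforce
qed

text \<open>A chord uses up two of the three terminals. The edge at the last one cannot be the only
  edge leaving the copy, and it cannot be a chord because no terminal is left for its other
  end.\<close>

lemma three_terminals_piece:
  assumes "length ts = 3"
  shows "piece V E f vs es ts out"
proof (rule piece)
  fix v assume v: "v \<in> set ts"
  show "out v \<notin> f ` set vs"
  proof
    assume "out v \<in> f ` set vs"
    then obtain u where u: "u \<in> set vs" "out v = f u" by blast
    note uv = chord_sym[OF v u]
    have "card (set ts - {u, v}) = 1"
      using v uv pattern_facts(2) assms by (subst card_Diff_subset) (auto simp: distinct_card)
    then obtain w where w: "set ts - {u, v} = {w}" by (auto simp: card_1_singleton_iff)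
    then have wts: "w \<in> set ts" "w \<noteq> u" "w \<noteq> v" by blast+
    have "out w \<in> f ` set vs"
      using chord_imp_all_inside[OF _ v \<open>out v \<in> f ` set vs\<close> wts(1)] assms by simp
    then obtain z where z: "z \<in> set vs" "out w = f z" by blast
    note zw = chord_sym[OF wts(1) z]
    have "z = u \<or> z = v" using w zw by blast
    then have "f w = f u \<or> f w = f v" using zw uv u by auto
    then show False using wts pattern_facts(3) uv(1) v inj_onD[OF inj_f] by blast
  qed
qed

end

text \<open>Pattern edges account for two of the three edges at a terminal and for all three
  elsewhere; \<open>out\<close> is read off from the edge that remains.\<close>

lemma pattern_copy_exists:
  assumes cubic: "cubic V E" and cut: "cut_ge_3 V E" and pat: "pattern_ok vs es ts"
    and inj: "inj_on f (set vs)" and fV: "f ` set vs \<subseteq> V"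
    and es_E: "\<And>a b. (a, b) \<in> set es \<Longrightarrow> {f a, f b} \<in> E"
  obtains out where "pattern_copy V E f vs es ts out"
proof -
  have g: "graph V E" using cubic by (simp add: cubic_def)
  have esvs: "set es \<subseteq> set vs \<times> set vs" and tsvs: "set ts \<subseteq> set vs"
    using pat by (auto simp: pattern_ok_def list_all_iff)
  define P where "P v = (\<lambda>(a, b). {f a, f b}) ` set (filter (\<lambda>(a, b). a = v \<or> b = v) es)" for v
  define D where "D v = {e \<in> E. f v \<in> e}" for v
  have PD: "P v \<subseteq> D v" for v using es_E by (auto simp: P_def D_def)
  have finD: "finite (D v)" for v using graph_finite_edges[OF g] by (simp add: D_def)
  have cD: "card (D v) = 3" if "v \<in> set vs" for v
    using that cubic fV by (auto simp: D_def cubic_def deg_def)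
  have cP: "card (P v) = (if v \<in> set ts then 2 else 3)" if "v \<in> set vs" for v
  proof -
    have inj2: "inj_on (\<lambda>(a, b). {a, b}) (set es)" and des: "distinct es"
      using pat by (auto simp: pattern_ok_def distinct_map)
    have "inj_on (\<lambda>(a, b). {f a, f b}) (set es)"
    proof (rule inj_onI, clarify)
      fix a b c d assume h: "(a, b) \<in> set es" "(c, d) \<in> set es" "{f a, f b} = {f c, f d}"
      then have "a \<in> set vs" "b \<in> set vs" "c \<in> set vs" "d \<in> set vs" using esvs by auto
      then have "{a, b} = {c, d}" using h(3) inj by (auto simp: doubleton_eq_iff inj_on_def)
      then show "a = c \<and> b = d" using h inj2 by (auto simp: inj_on_def)
    qed
    then have "inj_on (\<lambda>(a, b). {f a, f b}) (set (filter (\<lambda>(a, b). a = v \<or> b = v) es))"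
      by (rule inj_on_subset) auto
    then have "card (P v) = card (set (filter (\<lambda>(a, b). a = v \<or> b = v) es))"
      unfolding P_def by (rule card_image)
    also have "\<dots> = length (filter (\<lambda>(a, b). a = v \<or> b = v) es)"
      using des by (intro distinct_card) simp
    finally show ?thesis using pat that by (simp add: pattern_ok_def list_all_iff)
  qed
  have ex: "\<exists>x. D v = insert {f v, x} (P v) \<and> {f v, x} \<notin> P v" if v: "v \<in> set ts" for v
  proof -
    have vv: "v \<in> set vs" using v tsvs by blast
    have "card (D v - P v) = 1"
      using cD[OF vv] cP[OF vv] v PD finD by (simp add: card_Diff_subset finite_subset[OF PD finD])
    then obtain e where e: "D v - P v = {e}" by (auto simp: card_1_singleton_iff)
    then have eE: "e \<in> E" "f v \<in> e" by (auto simp: D_def)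
    obtain a b where "e = {a, b}" using graph_edgeE[OF g eE(1)] by blast
    then have x: "{f v, if a = f v then b else a} = e" using eE(2) by auto
    have "D v = insert e (P v)" "e \<notin> P v" using e PD[of v] by auto
    then show ?thesis unfolding x[symmetric] by blast
  qed
  define out where "out v = (SOME x. D v = insert {f v, x} (P v) \<and> {f v, x} \<notin> P v)" for v
  have out: "D v = insert {f v, out v} (P v)" "{f v, out v} \<notin> P v" if "v \<in> set ts" for v
    using someI_ex[OF ex[OF that]] by (simp_all add: out_def)
  have full: "D v = P v" if "v \<in> set vs" "v \<notin> set ts" for v
    using cD[OF that(1)] cP[OF that(1)] that(2) PD finD by (metis card_subset_eq)
  have "pattern_copy V E f vs es ts out"
  proof
    fix v assume v: "v \<in> set ts"
    show "{f v, out v} \<in> E" using out(1)[OF v] by (auto simp: D_def)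
    fix a b assume ab: "(a, b) \<in> set es"
    show "{f v, out v} \<noteq> {f a, f b}"
    proof
      assume eq: "{f v, out v} = {f a, f b}"
      then have "f v = f a \<or> f v = f b" by blast
      then have "v = a \<or> v = b" using inj ab esvs v tsvs by (auto simp: inj_on_def)
      then have "{f a, f b} \<in> P v" using ab by (force simp: P_def)
      then show False using out(2)[OF v] eq by simp
    qed
  next
    fix v e assume v: "v \<in> set vs" and e: "e \<in> E" "f v \<in> e"
    then have "e \<in> D v" by (simp add: D_def)
    then have "e \<in> P v \<or> (v \<in> set ts \<and> e = {f v, out v})" using full[OF v] out(1)[of v] by blast
    then show "(\<exists>(a, b) \<in> set es. e = {f a, f b}) \<or> (v \<in> set ts \<and> e = {f v, out v})"
      by (auto simp: P_def)
  qed (use assms in auto)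
  then show thesis by (rule that)
qed

section \<open>Coinciding outer ends and bridges of the outside graph\<close>

context piece
begin

text \<open>No set of at most one edge separates the outer ends of the terminals in
  \<open>va\<close> from the others; this supplies \<open>not_bad\<close> in a reduction.\<close>

definition unsplit :: "nat list \<Rightarrow> bool" where
  "unsplit va \<longleftrightarrow> (\<forall>S \<subseteq> Y. (\<forall>v\<in>set ts. out v \<in> S \<longleftrightarrow> v \<in> set va) \<longrightarrow> 2 \<le> ecount E S (Y - S))"

lemma ecount_mono_left: "finite B \<Longrightarrow> A' \<subseteq> A \<Longrightarrow> finite A \<Longrightarrow> ecount E A' B \<le> ecount E A B"
  unfolding ecount_def by (intro card_mono finite_arcs_between) (auto simp: arcs_between_def)

text \<open>If three outgoing edges met in \<open>y\<close>, it would have no neighbour in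
  \<open>Y\<close>, and the fourth outgoing edge would be a cut on its own.\<close>

lemma terminals_at_le:
  assumes "vs \<noteq> []" "length ts = 4" "y \<in> Y"
  shows "card {v \<in> set ts. out v = y} \<le> 2"
proof (rule ccontr)
  assume "\<not> ?thesis"
  then have n: "card {v \<in> set ts. out v = y} = 3" "ecount E {y} Y = 0" using deg_Y[OF assms(3)] by auto
  let ?A = "Y - {y}"
  have "{v \<in> set ts. out v = y} \<union> {v \<in> set ts. out v \<in> ?A} = set ts" using out_Y by auto
  moreover have "card ({v \<in> set ts. out v = y} \<union> {v \<in> set ts. out v \<in> ?A}) =
      card {v \<in> set ts. out v = y} + card {v \<in> set ts. out v \<in> ?A}"
    by (rule card_Un_disjoint) auto
  ultimately have one: "card {v \<in> set ts. out v \<in> ?A} = 1"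
    using n(1) assms(2) dts by (simp add: distinct_card)
  have "?A \<noteq> {}"
  proof
    assume "?A = {}"
    then have "{v \<in> set ts. out v \<in> ?A} = {}" by blast
    then show False using one by (metis card.empty zero_neq_one)
  qed
  then have "3 \<le> ecount E ?A (Y - ?A) + card {v \<in> set ts. out v \<in> ?A}"
    using ecount_outside_cut[of ?A] assms(1) by blast
  moreover have "Y - ?A = {y}" using assms(3) by blast
  moreover have "ecount E ?A {y} \<le> ecount E Y {y}" using finY by (intro ecount_mono_left) auto
  ultimately show False using one n(2) ecount_commute[of E Y "{y}"] by simp
qed

text \<open>An outer vertex shared by two terminals of one side meets no other terminal, so it has
  one further edge, and this edge would separate the two pairs.\<close>

lemma unsplit_imp_inj:
  assumes len: "vs \<noteq> []" "length ts = 4" and uns: "unsplit va"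
    and two: "card {v \<in> set ts. v \<in> set va} = 2" "card {v \<in> set ts. v \<notin> set va} = 2"
    and uv: "u \<in> set ts" "v \<in> set ts" "side va u = side va v" "out u = out v"
  shows "u = v"
proof (rule ccontr)
  assume ne: "u \<noteq> v"
  define y where "y = out u"
  have y: "y \<in> Y" using out_Y uv by (simp add: y_def)
  let ?N = "{v \<in> set ts. out v = y}"
  have "{u, v} \<subseteq> ?N" using uv by (auto simp: y_def)
  moreover have "card ?N \<le> card {u, v}" using terminals_at_le[OF len y] ne by simp
  ultimately have N: "?N = {u, v}" using card_seteq[of ?N "{u, v}"] by simp
  have "ecount E {y} (Y - {y}) \<le> ecount E {y} Y"
    using ecount_mono_left[of "{y}" "Y - {y}" Y] finY ecount_commute[of E "{y}"] by (metis Diff_subset finite.emptyI finite.insertI)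
  moreover have "ecount E {y} Y = 1" using deg_Y[OF y] N ne by simp
  ultimately have small: "ecount E {y} (Y - {y}) \<le> 1" by simp
  show False
  proof (cases "u \<in> set va")
    case True
    then have va: "v \<in> set va" using uv(3) by (auto simp: side_def split: if_splits)
    have "{u, v} = {v \<in> set ts. v \<in> set va}"
      using True va uv ne two by (intro card_seteq) auto
    then have "\<forall>w\<in>set ts. out w \<in> {y} \<longleftrightarrow> w \<in> set va"
      using N by blast
    then have "2 \<le> ecount E {y} (Y - {y})"
      using uns y unfolding unsplit_def by blast
    then show False using small by simp
  next
    case False
    then have va: "v \<notin> set va" using uv(3) by (auto simp: side_def split: if_splits)
    have "{u, v} = {v \<in> set ts. v \<notin> set va}"
      using False va uv ne two by (intro card_seteq) auto
    then have "\<forall>w\<in>set ts. out w \<in> Y - {y} \<longleftrightarrow> w \<in> set va"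
      using N out_Y by blast
    then have "2 \<le> ecount E (Y - {y}) (Y - (Y - {y}))"
      using uns unfolding unsplit_def by blast
    moreover have "Y - (Y - {y}) = {y}" using y by blast
    ultimately show False using small ecount_commute[of E "Y - {y}"] by simp
  qed
qed

text \<open>If two pairings of the four terminals were both separated by a bridge of the outside graph,
  the four corners would need at least four edges between them, but only two are available.\<close>

lemma two_splits:
  assumes vs: "vs \<noteq> []" and ts: "set ts = {a, b, c, d}" "distinct [a, b, c, d]"
    and S: "S \<subseteq> Y" "out a \<in> S" "out b \<in> S" "out c \<notin> S" "out d \<notin> S"
    and S': "S' \<subseteq> Y" "out a \<in> S'" "out b \<notin> S'" "out c \<in> S'" "out d \<notin> S'"
    and le: "ecount E S (Y - S) \<le> 1" "ecount E S' (Y - S') \<le> 1"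
  shows False
proof -
  define P where "P = S \<inter> S'"
  define Q where "Q = S - S'"
  define R where "R = S' - S"
  define U where "U = Y - S - S'"
  have fin: "finite P" "finite Q" "finite R" "finite U"
    using finite_subset[OF S(1) finY] finite_subset[OF S'(1) finY] finY
    by (auto simp: P_def Q_def R_def U_def)
  have Y: "Y = P \<union> Q \<union> R \<union> U" using S(1) S'(1) by (auto simp: P_def Q_def R_def U_def)
  have dis: "P \<inter> Q = {}" "P \<inter> R = {}" "P \<inter> U = {}" "Q \<inter> R = {}" "Q \<inter> U = {}" "R \<inter> U = {}"
    by (auto simp: P_def Q_def R_def U_def)
  have dY: "out d \<in> Y" using out_Y ts by simp
  have t: "{v \<in> set ts. out v \<in> P} = {a}" "{v \<in> set ts. out v \<in> Q} = {b}"
    "{v \<in> set ts. out v \<in> R} = {c}" "{v \<in> set ts. out v \<in> U} = {d}"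
    using S S' dY ts by (auto simp: P_def Q_def R_def U_def)
  have ge: "2 \<le> ecount E A (Y - A)" if "A \<subseteq> Y" "{v \<in> set ts. out v \<in> A} = {x}" for A x
  proof -
    have "A \<noteq> {}" using that(2) by auto
    then show ?thesis using ecount_outside_cut[OF that(1) _ vs] that(2) by simp
  qed
  have sub: "P \<subseteq> Y" "Q \<subseteq> Y" "R \<subseteq> Y" "U \<subseteq> Y" using Y by auto
  have three: "ecount E A (B \<union> C \<union> D) = ecount E A B + ecount E A C + ecount E A D"
    if "finite A" "finite B" "finite C" "finite D" "B \<inter> C = {}" "B \<inter> D = {}" "C \<inter> D = {}" for A B C D
    using that ecount_Un_right[of A "B \<union> C" D E] ecount_Un_right[of A B C E] by (simp add: Int_Un_distrib2)
  have "Y - P = Q \<union> R \<union> U" "Y - Q = P \<union> R \<union> U" "Y - R = P \<union> Q \<union> U" "Y - U = P \<union> Q \<union> R"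
    using Y dis by auto
  then have cut: "2 \<le> ecount E P Q + ecount E P R + ecount E P U" "2 \<le> ecount E Q P + ecount E Q R + ecount E Q U"
    "2 \<le> ecount E R P + ecount E R Q + ecount E R U" "2 \<le> ecount E U P + ecount E U Q + ecount E U R"
    using ge[OF sub(1) t(1)] ge[OF sub(2) t(2)] ge[OF sub(3) t(3)] ge[OF sub(4) t(4)]
      three[OF fin(1,2,3,4)] three[OF fin(2,1,3,4)] three[OF fin(3,1,2,4)] three[OF fin(4,1,2,3)]
      dis by (simp_all add: Int_commute)
  have four: "ecount E (A \<union> B) (C \<union> D) = ecount E A C + ecount E A D + ecount E B C + ecount E B D"
    if "finite A" "finite B" "finite C" "finite D" "A \<inter> B = {}" "C \<inter> D = {}" for A B C D
    using that ecount_Un_left[of A B "C \<union> D" E] ecount_Un_right[of A C D E] ecount_Un_right[of B C D E]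
    by simp
  have "S = P \<union> Q" "Y - S = R \<union> U" "S' = P \<union> R" "Y - S' = Q \<union> U"
    using S(1) S'(1) by (auto simp: P_def Q_def R_def U_def)
  then have "ecount E P R + ecount E P U + ecount E Q R + ecount E Q U \<le> 1"
    "ecount E P Q + ecount E P U + ecount E R Q + ecount E R U \<le> 1"
    using le four[OF fin(1,2,3,4)] four[OF fin(1,3,2,4)] dis by simp_all
  then show False
    using cut ecount_commute[of E Q P] ecount_commute[of E R P] ecount_commute[of E U P]
      ecount_commute[of E R Q] ecount_commute[of E U Q] ecount_commute[of E U R] by linarith
qed

text \<open>If two outgoing edges meet in \<open>y\<close>, the rest of \<open>Y\<close> is attached
  by at most the third edge at \<open>y\<close> and the third outgoing edge. These are too few for a
  cut, so the rest is empty.\<close>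

lemma three_terminals_cases:
  assumes vs: "vs \<noteq> []" and len: "length ts = 3" and ni: "\<not> inj_on out (set ts)"
  obtains y where "Y = {y}" "\<And>v. v \<in> set ts \<Longrightarrow> out v = y"
proof -
  obtain u v where uv: "u \<in> set ts" "v \<in> set ts" "out u = out v" "u \<noteq> v"
    using ni by (auto simp: inj_on_def)
  define y where "y = out u"
  have y: "y \<in> Y" using out_Y uv by (simp add: y_def)
  let ?N = "{v \<in> set ts. out v = y}" and ?A = "Y - {y}"
  let ?M = "{v \<in> set ts. out v \<in> ?A}"
  have "card {u, v} \<le> card ?N" using uv by (intro card_mono) (auto simp: y_def)
  then have N: "2 \<le> card ?N" using uv by simp
  have "?N \<union> ?M = set ts" using out_Y by auto
  moreover have "card (?N \<union> ?M) = card ?N + card ?M" by (rule card_Un_disjoint) auto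
  ultimately have sum: "card ?N + card ?M = 3" using len dts by (simp add: distinct_card)
  have "Y - ?A = {y}" using y by blast
  moreover have "ecount E ?A {y} \<le> ecount E Y {y}" using finY by (intro ecount_mono_left) auto
  moreover have "ecount E Y {y} + card ?N = 3" using deg_Y[OF y] ecount_commute[of E Y] by simp
  ultimately have "?A = {}" using ecount_outside_cut[of ?A] vs sum N by fastforce
  then have Y: "Y = {y}" using y by blast
  then show thesis using that out_Y by blast
qed

lemma deg_class_Y:
  assumes "length \<sigma> = length es" "length \<tau> = length ts" "\<And>v. v \<in> set ts \<Longrightarrow> out v = y" "ts \<noteq> []"
  shows "deg (edge_class (inner @ outer) (\<sigma> @ \<tau>) t) y = count_list \<tau> t"
proof -
  have y: "y \<in> Y" using assms(3)[of "hd ts"] out_Y[of "hd ts"] assms(4) by simp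
  have "deg (edge_class (inner @ outer) (\<sigma> @ \<tau>) t) y =
      length (filter (\<lambda>(e, t'). t' = t \<and> y \<in> e) (zip (inner @ outer) (\<sigma> @ \<tau>)))"
    unfolding deg_def edge_class_filter_conv
      distinct_card[OF distinct_map_fst_filter_zip[OF distinct_edges]] by simp
  also have "zip (inner @ outer) (\<sigma> @ \<tau>) = zip inner \<sigma> @ zip outer \<tau>"
    using assms by (simp add: inner_def)
  also have "filter (\<lambda>(e, t'). t' = t \<and> y \<in> e) (zip inner \<sigma> @ zip outer \<tau>) =
      filter (\<lambda>(e, t'). t' = t \<and> y \<in> e) (zip outer \<tau>)"
  proof -
    have "y \<notin> e" if "(e, t') \<in> set (zip inner \<sigma>)" for e t'
    proof -
      have "e \<in> set inner" using that by (rule set_zip_leftD)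
      then show ?thesis using esvs f_not_Y y by (fastforce simp: inner_def)
    qed
    then show ?thesis by (auto simp: filter_empty_conv)
  qed
  also have "\<dots> = filter (\<lambda>(e, t'). t' = t) (zip outer \<tau>)"
  proof (rule filter_cong[OF refl])
    fix p assume "p \<in> set (zip outer \<tau>)"
    then have "fst p \<in> set outer" by (metis prod.collapse set_zip_leftD)
    then have "y \<in> fst p" using assms(3) by (auto simp: outer_def)
    then show "(case p of (e, t') \<Rightarrow> t' = t \<and> y \<in> e) = (case p of (e, t') \<Rightarrow> t' = t)"
      by (auto split: prod.splits)
  qed
  also have "length \<dots> = count_list \<tau> t"
    using assms by (intro length_filter_zip_snd) (simp add: outer_def)
  finally show ?thesis .
qed

text \<open>If all three outgoing edges end in the same vertex, then contracting the piece gives a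
  triple edge, which decomposes into a tree edge and a double edge as cycle.\<close>

lemma single_outer_vertex:
  assumes len: "length ts = 3" and Y: "Y = {y}"
    and ext: "extends_locally vs es ts va [Tr, Cy, Cy] True [] \<sigma> [Tr, Cy, Cy]"
  shows "three_decomposition V E"
proof -
  let ?\<tau> = "[Tr, Cy, Cy]"
  let ?cl = "edge_class (inner @ outer) (\<sigma> @ ?\<tau>)"
  have l: "length \<sigma> = length es" "length ?\<tau> = length ts"
    and vert: "\<And>v. v \<in> set vs \<Longrightarrow> count_list (incident_types es ts \<sigma> ?\<tau> v) Cy \<in> {0, 2} \<and>
                 count_list (incident_types es ts \<sigma> ?\<tau> v) Ma \<le> 1"
    and cnt: "count_list \<sigma> Tr + count_list ?\<tau> Tr + 1 = count_list ?\<tau> Tr + length vs"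
    using ext len unfolding extends_locally_def Let_def by (auto simp: list_all_iff)
  have out: "out v = y" if "v \<in> set ts" for v using out_Y[OF that] Y by simp
  have ne: "ts \<noteq> []" using len by auto
  have EY: "EY = {}"
  proof -
    have "e \<notin> EY" for e
    proof
      assume e: "e \<in> EY"
      then have "e \<in> E" "e \<subseteq> {y}" using Y by (auto simp: EY_def)
      then show False using graph by (auto elim!: graph_edgeE)
    qed
    then show ?thesis by blast
  qed
  show ?thesis
  proof (rule assemble[OF l vert, of "{}" "{}" "{}"])
    fix z assume "z \<in> Y"
    then have z: "z = y" using Y by simp
    show "deg ({} \<union> ?cl Cy) z \<in> {0, 2}" "deg ({} \<union> ?cl Ma) z \<le> 1"
      unfolding z using deg_class_Y[OF l out ne] by simp_all
  next
    show "card {} + count_list (\<sigma> @ ?\<tau>) Tr < card V" using cnt cardV Y by simp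
  next
    fix c u v assume c: "monochromatic c ({} \<union> ?cl Tr)" and uv: "u \<in> V" "v \<in> V"
    then have c': "monochromatic c (?cl Tr)" by simp
    have "c (out u) = c (out v)" if "(u, v) \<in> set []" for u v using that by simp
    from extends_locally_monochromatic[OF ext c' this] obtain w :: "nat \<Rightarrow> bool" where w:
      "\<And>v. (v, Tr) \<in> set (zip ts ?\<tau>) \<Longrightarrow> c (out v) = w (side va v)" "True \<Longrightarrow> w 0 = w 1"
      "\<And>k v. w 0 = k \<Longrightarrow> w 1 = k \<Longrightarrow> (\<And>u. u \<in> set ts \<Longrightarrow> c (out u) = k) \<Longrightarrow> v \<in> set vs \<Longrightarrow> c (f v) = k"
      by metis
    obtain t1 t2 where "ts = t1 # t2" using ne by (cases ts) auto
    then have t1: "t1 \<in> set ts" "(t1, Tr) \<in> set (zip ts ?\<tau>)" by auto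
    have "c y = w (side va t1)" using w(1)[OF t1(2)] out[OF t1(1)] by simp
    then have k: "w 0 = c y" "w 1 = c y" using w(2) by (auto simp: side_def split: if_splits)
    have cf: "c (f v) = c y" if "v \<in> set vs" for v
      using w(3)[OF k _ that] out by simp
    have "c x = c y" if "x \<in> V" for x
    proof (cases "x \<in> Y")
      case False
      then have "x \<in> X" using that XY by auto
      then obtain v where "v \<in> set vs" "x = f v" unfolding X_def by (rule imageE)
      then show ?thesis using cf by simp
    qed (simp add: Y)
    from this[OF uv(1)] this[OF uv(2)] show "c u = c v" by simp
  qed (auto simp: EY)
qed

end

text \<open>Everything inside except a 5-cycle becomes tree, and so does the outgoing matching edge.
  This gives the right number of tree edges, and the pair in brackets names the link outside that
  completes the connection.\<close>

lemma petersen_minus_special: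
  "extends_locally petersen_minus_vs petersen_minus_es petersen_minus_ts [1, 4, 5] [Tr, Tr, Ma] True [(5, 1)]
     [Tr, Tr, Tr, Tr, Tr, Tr, Tr, Cy, Cy, Cy, Cy, Cy] [Tr, Tr, Tr]"
  "extends_locally petersen_minus_vs petersen_minus_es petersen_minus_ts [1, 4, 5] [Tr, Tr, Ma] True [(5, 4)]
     [Tr, Tr, Tr, Tr, Tr, Tr, Tr, Cy, Cy, Cy, Cy, Cy] [Tr, Tr, Tr]"
  "extends_locally petersen_minus_vs petersen_minus_es petersen_minus_ts [1, 4, 5] [Tr, Ma, Tr] True [(4, 1)]
     [Tr, Tr, Cy, Tr, Tr, Cy, Cy, Tr, Tr, Cy, Cy, Tr] [Tr, Tr, Tr]"
  "extends_locally petersen_minus_vs petersen_minus_es petersen_minus_ts [1, 4, 5] [Tr, Ma, Tr] True [(4, 5)]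
     [Tr, Tr, Tr, Tr, Tr, Tr, Tr, Cy, Cy, Cy, Cy, Cy] [Tr, Tr, Tr]"
  "extends_locally petersen_minus_vs petersen_minus_es petersen_minus_ts [1, 4, 5] [Ma, Tr, Tr] True [(1, 4)]
     [Tr, Tr, Cy, Tr, Tr, Cy, Cy, Tr, Tr, Cy, Cy, Tr] [Tr, Tr, Tr]"
  "extends_locally petersen_minus_vs petersen_minus_es petersen_minus_ts [1, 4, 5] [Ma, Tr, Tr] True [(1, 5)]
     [Tr, Tr, Tr, Tr, Tr, Tr, Tr, Cy, Cy, Cy, Cy, Cy] [Tr, Tr, Tr]"
  by code_simp+

text \<open>The inner tree edges form two paths, each from a terminal of one pair to a terminal of
  the other. The outer tree already links one such pair of ends, so the paths are chosen crosswise
  to that link: joining the same two terminals again would close a cycle.\<close>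

lemma twin_house1_special:
  "extends_locally twin_house_vs twin_house_es twin_house_ts [1, 2] [Tr, Tr, Tr, Tr] False [(1, 3)]
     [Ma, Tr, Tr, Ma, Tr, Tr, Ma] [Tr, Tr, Tr, Tr]"
  "extends_locally twin_house_vs twin_house_es twin_house_ts [1, 2] [Tr, Tr, Tr, Tr] False [(1, 4)]
     [Ma, Tr, Tr, Tr, Ma, Ma, Tr] [Tr, Tr, Tr, Tr]"
  "extends_locally twin_house_vs twin_house_es twin_house_ts [1, 2] [Tr, Tr, Tr, Tr] False [(2, 3)]
     [Ma, Tr, Tr, Tr, Ma, Ma, Tr] [Tr, Tr, Tr, Tr]"
  "extends_locally twin_house_vs twin_house_es twin_house_ts [1, 2] [Tr, Tr, Tr, Tr] False [(2, 4)]
     [Ma, Tr, Tr, Ma, Tr, Tr, Ma] [Tr, Tr, Tr, Tr]"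
  by code_simp+

text \<open>The 4-cycle on 3, 4, 5, 6 becomes the cycle part, and the path 5, 1, 2, 6 stays in the
  tree. The vertices 3 and 4 hang on their outgoing edges, whose outer ends are linked to those of 1
  or 2; the inner types are the same in all four cases.\<close>

lemma twin_house2_special:
  "extends_locally twin_house_vs twin_house_es twin_house_ts [1, 3] [Tr, Tr, Ma, Ma] True [(3, 1), (4, 1)]
     [Tr, Tr, Tr, Cy, Cy, Cy, Cy] [Tr, Tr, Tr, Tr]"
  "extends_locally twin_house_vs twin_house_es twin_house_ts [1, 3] [Tr, Tr, Ma, Ma] True [(3, 1), (4, 2)]
     [Tr, Tr, Tr, Cy, Cy, Cy, Cy] [Tr, Tr, Tr, Tr]"
  "extends_locally twin_house_vs twin_house_es twin_house_ts [1, 3] [Tr, Tr, Ma, Ma] True [(3, 2), (4, 1)]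
     [Tr, Tr, Tr, Cy, Cy, Cy, Cy] [Tr, Tr, Tr, Tr]"
  "extends_locally twin_house_vs twin_house_es twin_house_ts [1, 3] [Tr, Tr, Ma, Ma] True [(3, 2), (4, 2)]
     [Tr, Tr, Tr, Cy, Cy, Cy, Cy] [Tr, Tr, Tr, Tr]"
  by code_simp+

text \<open>One square becomes a cycle and all four outgoing edges go into the tree. The square is
  the one through the terminal, with tree type before, whose outer end is linked to the ends of the
  former matching edges. Its two terminals hang on their outgoing edges, and the other former
  matching edge connects them to the three tree edges inside.\<close>

lemma domino2_special:
  "extends_locally domino_vs domino_es domino_ts [0, 3] [Tr, Tr, Ma, Ma] True [(3, 0), (3, 5)]
     [Cy, Tr, Cy, Tr, Cy, Cy, Tr] [Tr, Tr, Tr, Tr]"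
  "extends_locally domino_vs domino_es domino_ts [0, 3] [Tr, Tr, Ma, Ma] True [(3, 2), (3, 5)]
     [Tr, Cy, Tr, Cy, Tr, Cy, Cy] [Tr, Tr, Tr, Tr]"
  "extends_locally domino_vs domino_es domino_ts [0, 3] [Ma, Ma, Tr, Tr] True [(0, 3), (0, 2)]
     [Cy, Tr, Cy, Tr, Cy, Cy, Tr] [Tr, Tr, Tr, Tr]"
  "extends_locally domino_vs domino_es domino_ts [0, 3] [Ma, Ma, Tr, Tr] True [(0, 5), (0, 2)]
     [Tr, Cy, Tr, Cy, Tr, Cy, Cy] [Tr, Tr, Tr, Tr]"
  by code_simp+

lemma (in reduced_decomposition) by_table:
  assumes "table_ok vs es ts va two special tbl"
  shows "three_decomposition V E \<or> (\<tau>, ab) \<in> set special"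
proof -
  have "\<tau> \<in> set (List.n_lists (length ts) [Tr, Cy, Ma])"
    using edge_type.exhaust by (auto simp: set_n_lists length_\<tau>)
  moreover have "etype {0, 1} \<in> set [Tr, Cy, Ma]" by (auto intro: edge_type.exhaust[of "etype {0, 1}"])
  ultimately have "(\<tau>, \<not> two \<or> etype {0, 1} = Tr) \<in> set (special @ map (\<lambda>(\<tau>, ab, _). (\<tau>, ab)) tbl)"
    using assms feasible unfolding table_ok_def list_all_iff by blast
  moreover have "(\<not> two \<or> etype {0, 1} = Tr) = ab"
    using etype_iff(1)[OF middle_ER] unfolding ab_def by blast
  ultimately consider "(\<tau>, ab) \<in> set special" | \<sigma> where "(\<tau>, ab, \<sigma>) \<in> set tbl" by auto
  then show ?thesis
  proof cases
    case 2
    then have "extends_locally vs es ts va \<tau> ab [] \<sigma> \<tau>"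
      using assms unfolding table_ok_def list_all_iff by blast
    then show ?thesis using extend[of "[]"] by simp
  qed simp
qed

lemma (in reduced_decomposition) etype_nth:
  "i < length ts \<Longrightarrow> etype (bd (ts ! i)) = \<tau> ! i"
  by (simp add: \<tau>_def)

section \<open>A smallest counterexample contains no reducible piece\<close>

locale minimal_counterexample =
  fixes V :: "'a set" and E :: "'a set set"
  assumes cub: "cubic V E" and cut: "cut_ge_3 V E" and nodec: "\<not> three_decomposition V E"
    and smaller: "\<And>(V' :: nat set) E'. cubic V' E' \<Longrightarrow> three_connected V' E' \<Longrightarrow> card V' < card V \<Longrightarrow>
      three_decomposition V' E'"
begin

lemma graph: "graph V E" using cub by (simp add: cubic_def)

lemma reduction_impossible:
  assumes "reduction V E f vs es ts out va two h" "2 < length vs"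
    and dec: "\<And>T C M. reduced_decomposition V E f vs es ts out va two h T C M \<Longrightarrow> three_decomposition V E"
  shows False
proof -
  interpret reduction V E f vs es ts out va two h by fact
  have "card VR < card V" using card_VR cardV assms(2) by simp
  then have "three_decomposition VR ER" by (rule smaller[OF cubic_ER three_connected_ER])
  then obtain T C M where "T \<union> C \<union> M = ER" "T \<inter> C = {}" "T \<inter> M = {}" "C \<inter> M = {}"
    "spanning_tree VR ER T" "two_regular_sub ER C" "matching ER M"
    unfolding three_decomposition_def by blast
  then have "reduced_decomposition V E f vs es ts out va two h T C M"
    by unfold_locales
  then show False using dec nodec by blast
qed

lemma naming_exists:
  assumes "finite A"
  obtains h :: "'b \<Rightarrow> nat" where "inj_on h A" "\<And>y. y \<in> A \<Longrightarrow> 2 \<le> h y"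
proof -
  obtain g :: "'b \<Rightarrow> nat" where "inj_on g A" using assms finite_imp_inj_to_nat_seg by metis
  then have "inj_on (\<lambda>x. g x + 2) A" by (auto simp: inj_on_def)
  then show thesis by (rule that) simp
qed

lemma three_terminals_impossible:
  assumes copy: "pattern_copy V E f vs es ts out" and len: "length ts = 3" "2 < length vs"
    and va: "set ts \<subseteq> set va"
    and base: "extends_locally vs es ts va [Tr, Cy, Cy] True [] \<sigma> [Tr, Cy, Cy]"
    and dec: "\<And>h T C M. reduced_decomposition V E f vs es ts out va False h T C M \<Longrightarrow> three_decomposition V E"
  shows False
proof -
  interpret P: pattern_copy V E f vs es ts out by fact
  interpret piece V E f vs es ts out using len(1) by (rule P.three_terminals_piece)
  have vs: "vs \<noteq> []" using len by auto
  show False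
  proof (cases "inj_on out (set ts)")
    case False
    then obtain y where "Y = {y}" using three_terminals_cases[OF vs len(1)] by metis
    then show False using single_outer_vertex[OF len(1) _ base] nodec by blast
  next
    case True
    obtain h :: "'a \<Rightarrow> nat" where h: "inj_on h Y" "\<And>y. y \<in> Y \<Longrightarrow> 2 \<le> h y"
      using naming_exists[OF finY] by blast
    have "reduction V E f vs es ts out va False h"
      by unfold_locales (use h va len True in \<open>auto simp: inj_on_def\<close>)
    then show False using reduction_impossible[OF _ len(2)] dec by blast
  qed
qed

text \<open>One of the two pairings is admissible by \<open>two_splits\<close>. \<open>dec2\<close>
  may use the failure of the first pairing, because the domino needs the bridge behind it.\<close>

lemma four_terminals_impossible:
  assumes "piece V E f vs es ts out" and len: "length ts = 4" "2 < length vs"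
    and ts: "set ts = {a, b, c, d}" "distinct [a, b, c, d]"
    and dec1: "\<And>h T C M. reduced_decomposition V E f vs es ts out [a, b] True h T C M \<Longrightarrow> three_decomposition V E"
    and dec2: "\<And>h T C M. reduced_decomposition V E f vs es ts out [a, c] True h T C M \<Longrightarrow>
       \<not> piece.unsplit V E f vs ts out [a, b] \<Longrightarrow> three_decomposition V E"
  shows False
proof -
  interpret piece V E f vs es ts out by fact
  have vs: "vs \<noteq> []" using len by auto
  obtain h :: "'a \<Rightarrow> nat" where h: "inj_on h Y" "\<And>y. y \<in> Y \<Longrightarrow> 2 \<le> h y"
    using naming_exists[OF finY] by blast
  have red: "reduction V E f vs es ts out va True h"
    if uns: "unsplit va" and va: "card {v \<in> set ts. v \<in> set va} = 2" "card {v \<in> set ts. v \<notin> set va} = 2" for va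
  proof unfold_locales
    fix S assume "S \<subseteq> Y" "\<And>v. v \<in> set ts \<Longrightarrow> (out v \<in> S) = (v \<in> set va)"
    then show "2 \<le> ecount E S (Y - S)" using uns unfolding unsplit_def by blast
  next
    fix u v assume "u \<in> set ts" "v \<in> set ts" "side va u = side va v" "out u = out v"
    then show "u = v" using unsplit_imp_inj[OF vs len(1) uns va] by blast
  qed (use h va in auto)
  have "{v \<in> set ts. v \<in> set [a, b]} = {a, b}" "{v \<in> set ts. v \<notin> set [a, b]} = {c, d}"
    "{v \<in> set ts. v \<in> set [a, c]} = {a, c}" "{v \<in> set ts. v \<notin> set [a, c]} = {b, d}"
    using ts by auto
  then have cards: "card {v \<in> set ts. v \<in> set [a, b]} = 2" "card {v \<in> set ts. v \<notin> set [a, b]} = 2"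
    "card {v \<in> set ts. v \<in> set [a, c]} = 2" "card {v \<in> set ts. v \<notin> set [a, c]} = 2"
    using ts(2) by simp_all
  show False
  proof (cases "unsplit [a, b]")
    case True
    then show False using reduction_impossible[OF red[OF _ cards(1,2)] len(2)] dec1 by blast
  next
    case False
    show False
    proof (cases "unsplit [a, c]")
      case True
      then show False using reduction_impossible[OF red[OF _ cards(3,4)] len(2)] dec2 False by blast
    next
      case f2: False
      obtain S where S: "S \<subseteq> Y" "\<And>v. v \<in> set ts \<Longrightarrow> out v \<in> S \<longleftrightarrow> v \<in> set [a, b]" "\<not> 2 \<le> ecount E S (Y - S)"
        using False unfolding unsplit_def by blast
      obtain S' where S': "S' \<subseteq> Y" "\<And>v. v \<in> set ts \<Longrightarrow> out v \<in> S' \<longleftrightarrow> v \<in> set [a, c]" "\<not> 2 \<le> ecount E S' (Y - S')"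
        using f2 unfolding unsplit_def by blast
      show False
        by (rule two_splits[OF vs ts S(1) _ _ _ _ S'(1)]) (use S S' ts in auto)
    qed
  qed
qed

lemma copy_of_subgraph:
  assumes "contains_subgraph V E VH (edges_of es)" "VH = set vs" "pattern_ok vs es ts"
  obtains f out where "pattern_copy V E f vs es ts out"
proof -
  obtain f where f: "inj_on f VH" "f ` VH \<subseteq> V" "\<And>e. e \<in> edges_of es \<Longrightarrow> f ` e \<in> E"
    using assms(1) unfolding contains_subgraph_def by blast
  have "{f a, f b} \<in> E" if "(a, b) \<in> set es" for a b
    using f(3)[of "{a, b}"] that by (force simp: edges_of_def)
  then show thesis
    using pattern_copy_exists[OF cub cut assms(3), of f] f(1,2) assms(2) that by metis
qed

end

section \<open>The excluded subgraphs\<close>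

lemma (in reduced_decomposition) extend_special:
  assumes "extends_locally vs es ts va t b Rs \<sigma> \<tau>'" "\<tau> = t" "ab = b"
    and "\<And>u v. (u, v) \<in> set Rs \<Longrightarrow> linked (out u) (out v)"
  shows "three_decomposition V E"
  using assms extend by blast

text \<open>The offset \<open>k\<close> is the smallest vertex name of the pattern, which is 0 or 1
  in the applications.\<close>

lemma contains_subgraph_listI:
  assumes "distinct xs" "set xs \<subseteq> V" "VH = {k..<k + length xs}"
    and "list_all (\<lambda>(a, b). {xs ! (a - k), xs ! (b - k)} \<in> E) es"
  shows "contains_subgraph V E VH (edges_of es)"
  unfolding contains_subgraph_def
proof (intro exI[of _ "\<lambda>i. xs ! (i - k)"] conjI ballI)
  show "inj_on (\<lambda>i. xs ! (i - k)) VH"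
    using assms(1) by (auto simp: assms(3) inj_on_def nth_eq_iff_index_eq)
  show "(\<lambda>i. xs ! (i - k)) ` VH \<subseteq> V" by (auto simp: assms(3) intro!: subsetD[OF assms(2)] nth_mem)
  fix e assume "e \<in> edges_of es"
  then show "(\<lambda>i. xs ! (i - k)) ` e \<in> E" using assms(4) by (auto simp: edges_of_def list_all_iff)
qed

lemma (in piece) not_unsplitE:
  assumes "\<not> unsplit va"
  obtains S where "S \<subseteq> Y" "\<forall>v\<in>set ts. out v \<in> S \<longleftrightarrow> v \<in> set va" "\<not> 2 \<le> ecount E S (Y - S)"
  using assms unfolding unsplit_def by blast

context minimal_counterexample
begin

lemma no_triangle_subgraph: "\<not> contains_subgraph V E triangle_V triangle_E"
proof
  assume "contains_subgraph V E triangle_V triangle_E"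
  then have "contains_subgraph V E triangle_V (edges_of triangle_es)"
    by (simp add: triangle_E_def triangle_es_def)
  moreover have "triangle_V = set triangle_vs" by (simp add: triangle_V_def triangle_vs_def)
  moreover have "pattern_ok triangle_vs triangle_es triangle_ts" by code_simp
  ultimately obtain f out where copy: "pattern_copy V E f triangle_vs triangle_es triangle_ts out"
    by (rule copy_of_subgraph)
  show False
  proof (rule three_terminals_impossible[OF copy])
    show "extends_locally triangle_vs triangle_es triangle_ts [0, 1, 2] [Tr, Cy, Cy] True [] [Tr, Cy, Tr] [Tr, Cy, Cy]"
      by code_simp
    fix h T C M
    assume "reduced_decomposition V E f triangle_vs triangle_es triangle_ts out [0, 1, 2] False h T C M"
    then show "three_decomposition V E"
      using reduced_decomposition.by_table[OF _ triangle_table_ok] by fastforce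
  qed (simp_all add: triangle_ts_def triangle_vs_def)
qed

lemma no_K23_subgraph: "\<not> contains_subgraph V E K23_V K23_E"
proof
  assume "contains_subgraph V E K23_V K23_E"
  then have "contains_subgraph V E K23_V (edges_of K23_es)" by (simp add: K23_E_def K23_es_def)
  moreover have "K23_V = set K23_vs" by (auto simp: K23_V_def K23_vs_def)
  moreover have "pattern_ok K23_vs K23_es K23_ts" by code_simp
  ultimately obtain f out where copy: "pattern_copy V E f K23_vs K23_es K23_ts out"
    by (rule copy_of_subgraph)
  show False
  proof (rule three_terminals_impossible[OF copy])
    show "extends_locally K23_vs K23_es K23_ts [2, 3, 4] [Tr, Cy, Cy] True [] [Tr, Tr, Tr, Tr, Cy, Cy] [Tr, Cy, Cy]"
      by code_simp
    fix h T C M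
    assume "reduced_decomposition V E f K23_vs K23_es K23_ts out [2, 3, 4] False h T C M"
    then show "three_decomposition V E"
      using reduced_decomposition.by_table[OF _ K23_table_ok] by fastforce
  qed (simp_all add: K23_ts_def K23_vs_def)
qed

text \<open>If one outgoing edge of the reduced Petersen graph is in the matching, then this edge is
  added to the tree. Its outer end is already joined to the outer end of another outgoing edge.\<close>

lemma no_petersen_minus_subgraph: "\<not> contains_subgraph V E petersen_minus_V petersen_minus_E"
proof
  assume "contains_subgraph V E petersen_minus_V petersen_minus_E"
  then have "contains_subgraph V E petersen_minus_V (edges_of petersen_minus_es)"
    by (simp add: petersen_minus_E_def petersen_minus_es_def)
  moreover have "petersen_minus_V = set petersen_minus_vs"
    by (auto simp: petersen_minus_V_def petersen_minus_vs_def)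
  moreover have "pattern_ok petersen_minus_vs petersen_minus_es petersen_minus_ts" by code_simp
  ultimately obtain f out
    where copy: "pattern_copy V E f petersen_minus_vs petersen_minus_es petersen_minus_ts out"
    by (rule copy_of_subgraph)
  show False
  proof (rule three_terminals_impossible[OF copy])
    show "extends_locally petersen_minus_vs petersen_minus_es petersen_minus_ts [1, 4, 5] [Tr, Cy, Cy] True []
      [Tr, Tr, Tr, Tr, Tr, Tr, Cy, Tr, Tr, Cy, Cy, Cy] [Tr, Cy, Cy]"
      by code_simp
    fix h T C M
    assume "reduced_decomposition V E f petersen_minus_vs petersen_minus_es petersen_minus_ts out
      [1, 4, 5] False h T C M"
    then interpret reduced_decomposition V E f petersen_minus_vs petersen_minus_es petersen_minus_ts out
      "[1, 4, 5]" False h T C M .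
    have et: "etype (bd 1) = \<tau> ! 0" "etype (bd 4) = \<tau> ! 1" "etype (bd 5) = \<tau> ! 2"
      using etype_nth[of 0] etype_nth[of 1] etype_nth[of 2] by (simp_all add: petersen_minus_ts_def)
    have lt: "\<exists>u\<in>{1, 4, 5}. etype (bd u) = Tr \<and> linked (out v) (out u)" if "v \<in> {1, 4, 5}" for v
      using linked_terminal[OF out_Y, of v] that by (simp add: petersen_minus_ts_def)
    consider "three_decomposition V E" | "\<tau> = [Tr, Tr, Ma]" "ab" | "\<tau> = [Tr, Ma, Tr]" "ab"
      | "\<tau> = [Ma, Tr, Tr]" "ab"
      using by_table[OF petersen_minus_table_ok] by auto
    then show "three_decomposition V E"
    proof cases
      case 2
      then have "linked (out 5) (out 1) \<or> linked (out 5) (out 4)" using lt[of 5] et by auto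
      then show ?thesis
        using extend_special[OF petersen_minus_special(1)] extend_special[OF petersen_minus_special(2)] 2
        by auto
    next
      case 3
      then have "linked (out 4) (out 1) \<or> linked (out 4) (out 5)" using lt[of 4] et by auto
      then show ?thesis
        using extend_special[OF petersen_minus_special(3)] extend_special[OF petersen_minus_special(4)] 3
        by auto
    next
      case 4
      then have "linked (out 1) (out 4) \<or> linked (out 1) (out 5)" using lt[of 1] et by auto
      then show ?thesis
        using extend_special[OF petersen_minus_special(5)] extend_special[OF petersen_minus_special(6)] 4
        by auto
    qed
  qed (simp_all add: petersen_minus_ts_def petersen_minus_vs_def)
qed

definition nb :: "'a \<Rightarrow> 'a \<Rightarrow> bool" where "nb u v \<longleftrightarrow> {u, v} \<in> E"

lemma nb_sym: "nb u v \<longleftrightarrow> nb v u" by (simp add: nb_def insert_commute)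
lemma nb_irrefl: "\<not> nb u u" using graph_edgeD(3)[OF graph, of u u] by (auto simp: nb_def)
lemma nb_V: "nb u v \<Longrightarrow> u \<in> V \<and> v \<in> V" using graph_edgeD[OF graph] by (auto simp: nb_def)

lemma no_triangle: "nb a b \<Longrightarrow> nb b c \<Longrightarrow> nb a c \<Longrightarrow> False"
proof -
  assume e: "nb a b" "nb b c" "nb a c"
  have "distinct [a, b, c]" using e nb_irrefl by auto
  moreover have "set [a, b, c] \<subseteq> V" using e nb_V by auto
  moreover have "triangle_V = {0..<0 + length [a, b, c]}" by (auto simp: triangle_V_def)
  ultimately have "contains_subgraph V E triangle_V triangle_E"
    unfolding triangle_E_def
    by (rule contains_subgraph_listI) (simp add: e[unfolded nb_def] insert_commute[of c a])
  then show False using no_triangle_subgraph by blast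
qed

lemma no_K23:
  assumes "a \<noteq> b" "x \<noteq> y" "x \<noteq> z" "y \<noteq> z"
    and "nb a x" "nb a y" "nb a z" "nb b x" "nb b y" "nb b z"
  shows False
proof -
  have "distinct [a, b, x, y, z]" using assms nb_irrefl by auto
  moreover have "set [a, b, x, y, z] \<subseteq> V" using assms nb_V by auto
  moreover have "K23_V = {0..<0 + length [a, b, x, y, z]}" by (auto simp: K23_V_def)
  ultimately have "contains_subgraph V E K23_V K23_E"
    unfolding K23_E_def
    by (rule contains_subgraph_listI) (simp add: assms(5-10)[unfolded nb_def])
  then show False using no_K23_subgraph by blast
qed

end

context pattern_copy
begin

lemma four_terminals_piece:
  assumes "length ts = 4" "s \<in> set ts" "out s \<notin> f ` set vs"
  shows "piece V E f vs es ts out"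
proof (rule piece)
  fix v assume v: "v \<in> set ts"
  show "out v \<notin> f ` set vs"
    using chord_imp_all_inside[OF _ v _ assms(2)] assms(1,3) by linarith
qed

end

context minimal_counterexample
begin

lemma no_claw_square_subgraph: "\<not> contains_subgraph V E claw_square_V claw_square_E"
proof
  assume "contains_subgraph V E claw_square_V claw_square_E"
  then have "contains_subgraph V E claw_square_V (edges_of claw_square_es)"
    by (simp add: claw_square_E_def claw_square_es_def)
  moreover have "claw_square_V = set claw_square_vs"
    by (auto simp: claw_square_V_def claw_square_vs_def)
  moreover have "pattern_ok claw_square_vs claw_square_es claw_square_ts" by code_simp
  ultimately obtain f out
    where copy: "pattern_copy V E f claw_square_vs claw_square_es claw_square_ts out"
    by (rule copy_of_subgraph)
  interpret P: pattern_copy V E f claw_square_vs claw_square_es claw_square_ts out by (rule copy)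
  have e: "nb (f 3) (f 0)" "nb (f 4) (f 0)" "nb (f 7) (f 4)" "nb (f 7) (f 5)" "nb (f 7) (f 6)"
    using P.es_E by (simp_all add: nb_def claw_square_es_def)
  have "piece V E f claw_square_vs claw_square_es claw_square_ts out"
  proof (rule P.four_terminals_piece)
    \<comment> \<open>An edge from 4 to 3, 5 or 6 would close a triangle with 0 or 7. One third edge
      that leaves the copy already excludes all chords.\<close>
    show "out 4 \<notin> f ` set claw_square_vs"
    proof
      assume "out 4 \<in> f ` set claw_square_vs"
      then obtain u where u: "u \<in> set claw_square_vs" "out 4 = f u" by blast
      have m4: "4 \<in> set claw_square_ts" by (simp add: claw_square_ts_def)
      have "u \<in> {3, 5, 6}" "nb (f 4) (f u)"
        using P.chord_sym[OF m4 u] P.out_E[OF m4] u by (auto simp: claw_square_ts_def nb_def)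
      then show False using no_triangle e nb_sym by blast
    qed
  qed (simp_all add: claw_square_ts_def)
  then show False
  proof (rule four_terminals_impossible[of _ _ _ _ _ 3 4 6 5])
    fix h T C M
    assume "reduced_decomposition V E f claw_square_vs claw_square_es claw_square_ts out [3, 4] True h T C M"
    then show "three_decomposition V E"
      using reduced_decomposition.by_table[OF _ claw_square1_table_ok] by fastforce
  next
    fix h T C M
    assume "reduced_decomposition V E f claw_square_vs claw_square_es claw_square_ts out [3, 6] True h T C M"
    then show "three_decomposition V E"
      using reduced_decomposition.by_table[OF _ claw_square2_table_ok] by fastforce
  qed (auto simp: claw_square_ts_def claw_square_vs_def)
qed

lemma no_twin_house_subgraph: "\<not> contains_subgraph V E twin_house_V twin_house_E"
proof
  assume "contains_subgraph V E twin_house_V twin_house_E"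
  then have "contains_subgraph V E twin_house_V (edges_of twin_house_es)"
    by (simp add: twin_house_E_def twin_house_es_def)
  moreover have "twin_house_V = set twin_house_vs"
    by (auto simp: twin_house_V_def twin_house_vs_def)
  moreover have "pattern_ok twin_house_vs twin_house_es twin_house_ts" by code_simp
  ultimately obtain f out
    where copy: "pattern_copy V E f twin_house_vs twin_house_es twin_house_ts out"
    by (rule copy_of_subgraph)
  interpret P: pattern_copy V E f twin_house_vs twin_house_es twin_house_ts out by (rule copy)
  have e: "nb (f 1) (f 5)" "nb (f 2) (f 6)" "nb (f 5) (f 3)" "nb (f 5) (f 4)" "nb (f 6) (f 3)"
    using P.es_E by (simp_all add: nb_def twin_house_es_def)
  have "piece V E f twin_house_vs twin_house_es twin_house_ts out"
  proof (rule P.four_terminals_piece)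
    \<comment> \<open>A chord at 3 would close a triangle with 5 or 6.\<close>
    show "out 3 \<notin> f ` set twin_house_vs"
    proof
      assume "out 3 \<in> f ` set twin_house_vs"
      then obtain u where u: "u \<in> set twin_house_vs" "out 3 = f u" by blast
      have m3: "3 \<in> set twin_house_ts" by (simp add: twin_house_ts_def)
      have "u \<in> {1, 2, 4}" "nb (f 3) (f u)"
        using P.chord_sym[OF m3 u] P.out_E[OF m3] u by (auto simp: twin_house_ts_def nb_def)
      then show False using no_triangle e nb_sym by blast
    qed
  qed (simp_all add: twin_house_ts_def)
  then show False
  proof (rule four_terminals_impossible[of _ _ _ _ _ 1 2 3 4])
    fix h T C M
    assume "reduced_decomposition V E f twin_house_vs twin_house_es twin_house_ts out [1, 2] True h T C M"
    then interpret reduced_decomposition V E f twin_house_vs twin_house_es twin_house_ts out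
      "[1, 2]" True h T C M .
    consider "three_decomposition V E" | "\<tau> = [Tr, Tr, Tr, Tr]" "\<not> ab"
      using by_table[OF twin_house1_table_ok] by auto
    then show "three_decomposition V E"
    proof cases
      case 2
      then have "{0, 1} \<notin> T" by (simp add: ab_def)
      then have "linked (out 1) (out 3) \<or> linked (out 1) (out 4) \<or> linked (out 2) (out 3) \<or> linked (out 2) (out 4)"
        using linked_across by (auto simp: twin_house_ts_def)
      then show ?thesis
        using extend_special[OF twin_house1_special(1)] extend_special[OF twin_house1_special(2)]
          extend_special[OF twin_house1_special(3)] extend_special[OF twin_house1_special(4)] 2
        by auto
    qed
  next
    fix h T C M
    assume "reduced_decomposition V E f twin_house_vs twin_house_es twin_house_ts out [1, 3] True h T C M"
    then interpret reduced_decomposition V E f twin_house_vs twin_house_es twin_house_ts out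
      "[1, 3]" True h T C M .
    have et: "etype (bd 3) = \<tau> ! 2" "etype (bd 4) = \<tau> ! 3"
      using etype_nth[of 2] etype_nth[of 3] by (simp_all add: twin_house_ts_def)
    have lt: "\<exists>u\<in>{1, 2, 3, 4}. etype (bd u) = Tr \<and> linked (out v) (out u)" if "v \<in> {1, 2, 3, 4}" for v
      using linked_terminal[OF out_Y, of v] that by (simp add: twin_house_ts_def)
    consider "three_decomposition V E" | "\<tau> = [Tr, Tr, Ma, Ma]" "ab"
      using by_table[OF twin_house2_table_ok] by auto
    then show "three_decomposition V E"
    proof cases
      case 2
      have "linked (out 3) (out 1) \<or> linked (out 3) (out 2)" using lt[of 3] et 2 by auto
      moreover have "linked (out 4) (out 1) \<or> linked (out 4) (out 2)" using lt[of 4] et 2 by auto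
      ultimately show ?thesis
        using extend_special[OF twin_house2_special(1)] extend_special[OF twin_house2_special(2)]
          extend_special[OF twin_house2_special(3)] extend_special[OF twin_house2_special(4)] 2
        by auto
    qed
  qed (auto simp: twin_house_ts_def twin_house_vs_def)
qed

text \<open>If the pairing of the two long sides fails, then a bridge separates them outside, so in the
  other pairing the outer ends on the side without tree edges are joined beyond the bridge.\<close>

lemma no_domino_subgraph: "\<not> contains_subgraph V E domino_V domino_E"
proof
  assume "contains_subgraph V E domino_V domino_E"
  then have "contains_subgraph V E domino_V (edges_of domino_es)"
    by (simp add: domino_E_def domino_es_def)
  moreover have "domino_V = set domino_vs"
    by (auto simp: domino_V_def domino_vs_def)
  moreover have "pattern_ok domino_vs domino_es domino_ts" by code_simp
  ultimately obtain f out
    where copy: "pattern_copy V E f domino_vs domino_es domino_ts out"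
    by (rule copy_of_subgraph)
  interpret P: pattern_copy V E f domino_vs domino_es domino_ts out by (rule copy)
  have e: "nb (f 0) (f 1)" "nb (f 1) (f 2)" "nb (f 3) (f 4)" "nb (f 4) (f 5)" "nb (f 0) (f 3)"
    "nb (f 1) (f 4)"
    using P.es_E by (simp_all add: nb_def domino_es_def)
  have "f i \<noteq> f j" if "i < 6" "j < 6" "i \<noteq> j" for i j
    using that P.inj_f by (auto simp: inj_on_def domino_vs_def numeral_eq_Suc less_Suc_eq)
  then have ne: "f 0 \<noteq> f 4" "f 1 \<noteq> f 3" "f 1 \<noteq> f 5" "f 3 \<noteq> f 5" by simp_all
  have "piece V E f domino_vs domino_es domino_ts out"
  proof (rule P.four_terminals_piece)
    \<comment> \<open>A chord from 0 to 2 closes a triangle with 1; one from 0 to 5 gives a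
      \<open>K23\<close> with parts 0, 4 and 1, 3, 5.\<close>
    show "out 0 \<notin> f ` set domino_vs"
    proof
      assume "out 0 \<in> f ` set domino_vs"
      then obtain u where u: "u \<in> set domino_vs" "out 0 = f u" by blast
      have m0: "0 \<in> set domino_ts" by (simp add: domino_ts_def)
      have "u \<in> {2, 3, 5}" "nb (f 0) (f u)"
        using P.chord_sym[OF m0 u] P.out_E[OF m0] u by (auto simp: domino_ts_def nb_def)
      moreover have "u \<noteq> 3"
        using P.out_new[OF m0, of 0 3] u by (auto simp: domino_es_def)
      ultimately consider "nb (f 0) (f 2)" | "nb (f 0) (f 5)" by auto
      then show False
      proof cases
        case 1
        then show False using no_triangle e by blast
      next
        case 2
        have "nb (f 4) (f 3)" "nb (f 4) (f 1)" using e nb_sym by blast+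
        then show False using no_K23[OF ne e(1) e(5) 2] e(4) by blast
      qed
    qed
  qed (simp_all add: domino_ts_def)
  then show False
  proof (rule four_terminals_impossible[of _ _ _ _ _ 0 2 3 5])
    fix h T C M
    assume "reduced_decomposition V E f domino_vs domino_es domino_ts out [0, 2] True h T C M"
    then show "three_decomposition V E"
      using reduced_decomposition.by_table[OF _ domino1_table_ok] by fastforce
  next
    fix h T C M
    assume "reduced_decomposition V E f domino_vs domino_es domino_ts out [0, 3] True h T C M"
      and nsplit: "\<not> piece.unsplit V E f domino_vs domino_ts out [0, 2]"
    then interpret reduced_decomposition V E f domino_vs domino_es domino_ts out
      "[0, 3]" True h T C M by simp
    obtain S where S: "S \<subseteq> Y" "\<forall>v\<in>set domino_ts. out v \<in> S \<longleftrightarrow> v \<in> set [0, 2]"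
      "\<not> 2 \<le> ecount E S (Y - S)"
      using not_unsplitE[OF nsplit] by metis
    have inS: "out 0 \<in> S" "out 2 \<in> S" "out 3 \<in> Y - S" "out 5 \<in> Y - S"
      using S(2) out_Y by (simp_all add: domino_ts_def)
    have et: "etype (bd 0) = \<tau> ! 0" "etype (bd 2) = \<tau> ! 1" "etype (bd 3) = \<tau> ! 2" "etype (bd 5) = \<tau> ! 3"
      using etype_nth[of 0] etype_nth[of 1] etype_nth[of 2] etype_nth[of 3] by (simp_all add: domino_ts_def)
    have lt: "\<exists>u\<in>{0, 2, 3, 5}. etype (bd u) = Tr \<and> linked (out v) (out u)" if "v \<in> {0, 2, 3, 5}" for v
      using linked_terminal[OF out_Y, of v] that by (simp add: domino_ts_def)
    consider "three_decomposition V E" | "\<tau> = [Tr, Tr, Ma, Ma]" "ab" | "\<tau> = [Ma, Ma, Tr, Tr]" "ab"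
      using by_table[OF domino2_table_ok] by auto
    then show "three_decomposition V E"
    proof cases
      case 2
      \<comment> \<open>Of the outgoing edges only those at 3 and 5 end in \<open>Y - S\<close>, and
        both are in the matching, so the outer tree joins their ends behind the bridge.\<close>
      have "Y - (Y - S) = S" using S(1) by blast
      then have "linked (out 3) (out 5)"
        using S et 2 inS by (intro linked_behind_bridge[of "Y - S"]) (auto simp: domino_ts_def)
      moreover have "linked (out 3) (out 0) \<or> linked (out 3) (out 2)" using lt[of 3] et 2 by auto
      ultimately show ?thesis
        using extend_special[OF domino2_special(1)] extend_special[OF domino2_special(2)] 2 by auto
    next
      case 3
      have "linked (out 0) (out 2)"
        using S et 3 inS ecount_commute[of E S]
        by (intro linked_behind_bridge[of S]) (auto simp: domino_ts_def)
      moreover have "linked (out 0) (out 3) \<or> linked (out 0) (out 5)" using lt[of 0] et 3 by auto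
      ultimately show ?thesis
        using extend_special[OF domino2_special(3)] extend_special[OF domino2_special(4)] 3 by auto
    qed
  qed (auto simp: domino_ts_def domino_vs_def)
qed

end

section \<open>Short cycles and induced paths\<close>

lemma length_4E: "length c = 4 \<Longrightarrow> \<exists>v0 v1 v2 v3. c = [v0, v1, v2, v3]"
  by (auto simp: numeral_eq_Suc length_Suc_conv)
lemma length_5E: "length c = 5 \<Longrightarrow> \<exists>v0 v1 v2 v3 v4. c = [v0, v1, v2, v3, v4]"
  by (auto simp: numeral_eq_Suc length_Suc_conv)
lemma length_6E: "length c = 6 \<Longrightarrow> \<exists>v0 v1 v2 v3 v4 v5. c = [v0, v1, v2, v3, v4, v5]"
  by (auto simp: numeral_eq_Suc length_Suc_conv)

lemma cycle_edge_in:
  "i < length c \<Longrightarrow> {c ! i, c ! ((i + 1) mod length c)} \<in> cycle_edges c"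
  by (auto simp: cycle_edges_def)

context minimal_counterexample
begin

lemma no_domino:
  assumes "distinct [v0, v1, v2, v3, v4, v5]"
    and "nb v0 v1" "nb v1 v2" "nb v3 v4" "nb v4 v5" "nb v0 v3" "nb v1 v4" "nb v2 v5"
  shows False
proof -
  have "set [v0, v1, v2, v3, v4, v5] \<subseteq> V" using assms(2-8) nb_V by auto
  moreover have "domino_V = {0..<0 + length [v0, v1, v2, v3, v4, v5]}" by (auto simp: domino_V_def)
  ultimately have "contains_subgraph V E domino_V domino_E"
    unfolding domino_E_def
    by (rule contains_subgraph_listI[OF assms(1)]) (simp add: assms(2-8)[unfolded nb_def])
  then show False using no_domino_subgraph by blast
qed

lemma no_twin_house:
  assumes "distinct [p1, p2, p3, p4, p5, p6]"
    and "nb p1 p2" "nb p1 p5" "nb p2 p6" "nb p5 p3" "nb p5 p4" "nb p6 p3" "nb p6 p4"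
  shows False
proof -
  have "set [p1, p2, p3, p4, p5, p6] \<subseteq> V" using assms(2-8) nb_V by auto
  moreover have "twin_house_V = {1..<1 + length [p1, p2, p3, p4, p5, p6]}" by (auto simp: twin_house_V_def)
  ultimately have "contains_subgraph V E twin_house_V twin_house_E"
    unfolding twin_house_E_def
    by (rule contains_subgraph_listI[OF assms(1)]) (simp add: assms(2-8)[unfolded nb_def])
  then show False using no_twin_house_subgraph by blast
qed

lemma no_claw_square:
  assumes "distinct [a1, a2, a3, a4, b1, b2, b3, c]"
    and "nb a1 a2" "nb a2 a3" "nb a3 a4" "nb a4 a1" "nb c b1" "nb c b2" "nb c b3"
      "nb b1 a1" "nb b2 a2" "nb b3 a3"
  shows False
proof -
  have "set [a1, a2, a3, a4, b1, b2, b3, c] \<subseteq> V" using assms(2-11) nb_V by auto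
  moreover have "claw_square_V = {0..<0 + length [a1, a2, a3, a4, b1, b2, b3, c]}"
    by (auto simp: claw_square_V_def)
  ultimately have "contains_subgraph V E claw_square_V claw_square_E"
    unfolding claw_square_E_def
    by (rule contains_subgraph_listI[OF assms(1)]) (simp add: assms(2-11)[unfolded nb_def])
  then show False using no_claw_square_subgraph by blast
qed

lemma no_petersen_minus:
  assumes "distinct [v1, v2, v3, v4, v5, v6, v7, v8, v9]"
    and "nb v1 v2" "nb v2 v3" "nb v3 v4" "nb v1 v6" "nb v2 v7" "nb v3 v8" "nb v4 v9"
      "nb v5 v7" "nb v7 v9" "nb v9 v6" "nb v6 v8" "nb v8 v5"
  shows False
proof -
  have "set [v1, v2, v3, v4, v5, v6, v7, v8, v9] \<subseteq> V" using assms(2-13) nb_V by auto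
  moreover have "petersen_minus_V = {1..<1 + length [v1, v2, v3, v4, v5, v6, v7, v8, v9]}"
    by (auto simp: petersen_minus_V_def)
  ultimately have "contains_subgraph V E petersen_minus_V petersen_minus_E"
    unfolding petersen_minus_E_def
    by (rule contains_subgraph_listI[OF assms(1)]) (simp add: assms(2-13)[unfolded nb_def])
  then show False using no_petersen_minus_subgraph by blast
qed

lemma no_chord: "nb a b \<Longrightarrow> nb b c \<Longrightarrow> \<not> nb a c \<and> \<not> nb c a"
  using no_triangle nb_sym by blast

lemma cycle_length_ge_4:
  assumes "is_cycle E c"
  shows "4 \<le> length c"
proof (rule ccontr)
  assume "\<not> ?thesis"
  then have len: "length c = 3" using assms by (simp add: is_cycle_def)
  have e: "i < 3 \<Longrightarrow> nb (c ! i) (c ! ((i + 1) mod 3))" for i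
    using assms len by (simp add: is_cycle_def nb_def)
  have "nb (c ! 0) (c ! 1)" "nb (c ! 1) (c ! 2)" "nb (c ! 2) (c ! 0)"
    using e[of 0] e[of 1] e[of 2] by (simp_all add: numeral_2_eq_2)
  then show False using no_triangle nb_sym by blast
qed

text \<open>A chord between vertices at distance two on the cycle closes a triangle, and a chord
  between opposite vertices of a 6-cycle gives a domino.\<close>

lemma short_cycle_induced:
  assumes c: "is_cycle E c" and len: "length c \<in> {4, 5, 6}"
  shows "induced_cycle E c"
proof -
  have cyc: "distinct c" "\<And>i. i < length c \<Longrightarrow> nb (c ! i) (c ! ((i + 1) mod length c))"
    using c by (auto simp: is_cycle_def nb_def)
  define K where "K = cycle_edges c"
  have "{u, v} \<in> K" if uv: "u \<in> set c" "v \<in> set c" "nb u v" for u v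
  proof -
    consider "length c = 4" | "length c = 5" | "length c = 6" using len by auto
    then show ?thesis
    proof cases
      case 1
      then obtain v0 v1 v2 v3 where cn: "c = [v0, v1, v2, v3]" using length_4E by blast
      have e: "nb v0 v1" "nb v1 v2" "nb v2 v3" "nb v3 v0"
        using cyc(2)[of 0]
          cyc(2)[of 1]
          cyc(2)[of 2]
          cyc(2)[of 3]
        by (simp_all add: cn)
      have K: "{v0, v1} \<in> K" "{v1, v2} \<in> K" "{v2, v3} \<in> K" "{v3, v0} \<in> K" "{v1, v0} \<in> K" "{v2, v1} \<in> K" "{v3, v2} \<in> K" "{v0, v3} \<in> K"
        using cycle_edge_in[of 0 c]
          cycle_edge_in[of 1 c]
          cycle_edge_in[of 2 c]
          cycle_edge_in[of 3 c]
        by (simp_all add: cn K_def insert_commute)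
      have "list_all (\<lambda>u. list_all (\<lambda>v. nb u v \<longrightarrow> {u, v} \<in> K) [v0, v1, v2, v3]) [v0, v1, v2, v3]"
        using no_chord[OF e(1) e(2)]
          no_chord[OF e(2) e(3)]
          no_chord[OF e(3) e(4)]
          no_chord[OF e(4) e(1)]
        by (simp add: K nb_irrefl)
      then show ?thesis using uv unfolding list_all_iff cn[symmetric] by blast
    next
      case 2
      then obtain v0 v1 v2 v3 v4 where cn: "c = [v0, v1, v2, v3, v4]" using length_5E by blast
      have e: "nb v0 v1" "nb v1 v2" "nb v2 v3" "nb v3 v4" "nb v4 v0"
        using cyc(2)[of 0]
          cyc(2)[of 1]
          cyc(2)[of 2]
          cyc(2)[of 3]
          cyc(2)[of 4]
        by (simp_all add: cn)
      have K: "{v0, v1} \<in> K" "{v1, v2} \<in> K" "{v2, v3} \<in> K" "{v3, v4} \<in> K" "{v4, v0} \<in> K" "{v1, v0} \<in> K" "{v2, v1} \<in> K" "{v3, v2} \<in> K" "{v4, v3} \<in> K" "{v0, v4} \<in> K"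
        using cycle_edge_in[of 0 c]
          cycle_edge_in[of 1 c]
          cycle_edge_in[of 2 c]
          cycle_edge_in[of 3 c]
          cycle_edge_in[of 4 c]
        by (simp_all add: cn K_def insert_commute)
      have "list_all (\<lambda>u. list_all (\<lambda>v. nb u v \<longrightarrow> {u, v} \<in> K) [v0, v1, v2, v3, v4]) [v0, v1, v2, v3, v4]"
        using no_chord[OF e(1) e(2)]
          no_chord[OF e(2) e(3)]
          no_chord[OF e(3) e(4)]
          no_chord[OF e(4) e(5)]
          no_chord[OF e(5) e(1)]
        by (simp add: K nb_irrefl)
      then show ?thesis using uv unfolding list_all_iff cn[symmetric] by blast
    next
      case 3
      then obtain v0 v1 v2 v3 v4 v5 where cn: "c = [v0, v1, v2, v3, v4, v5]" using length_6E by blast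
      have e: "nb v0 v1" "nb v1 v2" "nb v2 v3" "nb v3 v4" "nb v4 v5" "nb v5 v0"
        using cyc(2)[of 0]
          cyc(2)[of 1]
          cyc(2)[of 2]
          cyc(2)[of 3]
          cyc(2)[of 4]
          cyc(2)[of 5]
        by (simp_all add: cn)
      have d: "distinct [v0, v1, v2, v3, v4, v5]" using cyc(1) cn by simp
      have rev: "nb v1 v0" "nb v2 v1" "nb v3 v2" "nb v4 v3" "nb v5 v4" "nb v0 v5"
        using e nb_sym by blast+
      have long: "\<not> nb v0 v3" "\<not> nb v1 v4" "\<not> nb v2 v5"
        using no_domino[OF _ rev(1) rev(6) e(3) e(4) e(2) _ rev(5)]
          no_domino[OF _ rev(2) rev(1) e(4) e(5) e(3) _ rev(6)]
          no_domino[OF _ rev(3) rev(2) e(5) e(6) e(4) _ rev(1)] d by auto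
      then have long': "\<not> nb v3 v0" "\<not> nb v4 v1" "\<not> nb v5 v2" using nb_sym by blast+
      have K: "{v0, v1} \<in> K" "{v1, v2} \<in> K" "{v2, v3} \<in> K" "{v3, v4} \<in> K" "{v4, v5} \<in> K" "{v5, v0} \<in> K" "{v1, v0} \<in> K" "{v2, v1} \<in> K" "{v3, v2} \<in> K" "{v4, v3} \<in> K" "{v5, v4} \<in> K" "{v0, v5} \<in> K"
        using cycle_edge_in[of 0 c]
          cycle_edge_in[of 1 c]
          cycle_edge_in[of 2 c]
          cycle_edge_in[of 3 c]
          cycle_edge_in[of 4 c]
          cycle_edge_in[of 5 c]
        by (simp_all add: cn K_def insert_commute)
      have "list_all (\<lambda>u. list_all (\<lambda>v. nb u v \<longrightarrow> {u, v} \<in> K) [v0, v1, v2, v3, v4, v5]) [v0, v1, v2, v3, v4, v5]"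
        using no_chord[OF e(1) e(2)]
          no_chord[OF e(2) e(3)]
          no_chord[OF e(3) e(4)]
          no_chord[OF e(4) e(5)]
          no_chord[OF e(5) e(6)]
          no_chord[OF e(6) e(1)]
        by (simp add: K nb_irrefl long long')
      then show ?thesis using uv unfolding list_all_iff cn[symmetric] by blast
    qed
  qed
  then show ?thesis using c by (simp add: induced_cycle_def nb_def K_def)
qed

end

section \<open>Induced paths around a given edge\<close>

lemma card_3E:
  assumes "card A = 3" "x \<in> A"
  obtains a b where "A = {x, a, b}" "x \<noteq> a" "x \<noteq> b" "a \<noteq> b"
proof -
  have "finite A" using assms(1) card.infinite by fastforce
  then have "card (A - {x}) = 2" using assms by simp
  then obtain a b where "A - {x} = {a, b}" "a \<noteq> b" by (auto simp: card_2_iff)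
  then show thesis using assms(2) by (intro that[of a b]) blast+
qed

context minimal_counterexample
begin

lemma neighbours:
  assumes "nb v x"
  obtains a b where "\<And>u. nb v u \<longleftrightarrow> u = x \<or> u = a \<or> u = b" "x \<noteq> a" "x \<noteq> b" "a \<noteq> b"
proof -
  have v: "v \<in> V" using nb_V assms by blast
  have "{u. nb v u} = snd ` arcs_between E {v} V"
    using nb_V by (force simp: arcs_between_def nb_def)
  moreover have "inj_on snd (arcs_between E {v} V)" by (auto simp: inj_on_def arcs_between_def)
  ultimately have "card {u. nb v u} = ecount E {v} V" by (simp add: ecount_def card_image)
  also have "\<dots> = 3" using ecount_vertex[OF graph] cub v by (simp add: cubic_def)
  finally have "card {u. nb v u} = 3" .
  moreover have "x \<in> {u. nb v u}" using assms by simp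
  ultimately obtain a b where ab: "{u. nb v u} = {x, a, b}" "x \<noteq> a" "x \<noteq> b" "a \<noteq> b" by (rule card_3E)
  show thesis
  proof (rule that[OF _ ab(2-4)])
    fix u show "nb v u \<longleftrightarrow> u = x \<or> u = a \<or> u = b" using ab(1) by auto
  qed
qed

lemma neighbour_cases:
  assumes "nb z p" "nb z q" "nb z r" "p \<noteq> q" "p \<noteq> r" "q \<noteq> r" "nb z v"
  shows "v = p \<or> v = q \<or> v = r"
proof -
  obtain a b where ab: "\<And>u. nb z u \<longleftrightarrow> u = p \<or> u = a \<or> u = b" using neighbours[OF assms(1)] by metis
  have "q = a \<or> q = b" "r = a \<or> r = b" "v = p \<or> v = a \<or> v = b"
    using assms ab[of q] ab[of r] ab[of v] by auto
  then show ?thesis using assms(6) by auto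
qed

definition central :: "'a \<Rightarrow> 'a \<Rightarrow> bool" where
  "central w x \<longleftrightarrow> (\<exists>p. length p = 6 \<and> set p \<subseteq> V \<and> induced_path E p \<and> {p ! 2, p ! 3} = {w, x})"

text \<open>Without triangles, vertices at distance two on the path are never adjacent, so six pairs
  remain to be excluded. Distinctness has to be assumed only for the four pairs at distance two;
  elsewhere it follows from the adjacencies.\<close>

lemma centralI:
  assumes e: "nb v1 v2" "nb v2 w" "nb w x" "nb x v5" "nb v5 v6" and ne: "v1 \<noteq> w" "v2 \<noteq> x" "v5 \<noteq> w" "v6 \<noteq> x"
    and n: "\<not> nb v1 x" "\<not> nb v1 v5" "\<not> nb v1 v6" "\<not> nb v2 v5" "\<not> nb v2 v6" "\<not> nb w v6"
  shows "central w x"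
proof -
  let ?p = "[v1, v2, w, x, v5, v6]"
  note tri = no_chord[OF e(1) e(2)] no_chord[OF e(2) e(3)] no_chord[OF e(3) e(4)] no_chord[OF e(4) e(5)]
  have rev: "nb v2 v1" "nb w v2" "nb x w" "nb v5 x" "nb v6 v5" using e nb_sym by blast+
  have n': "\<not> nb x v1" "\<not> nb v5 v1" "\<not> nb v6 v1" "\<not> nb v5 v2" "\<not> nb v6 v2" "\<not> nb v6 w"
    using n nb_sym by blast+
  have "v1 \<noteq> v2" "v2 \<noteq> w" "w \<noteq> x" "x \<noteq> v5" "v5 \<noteq> v6" using e nb_irrefl by blast+
  moreover have "v1 \<noteq> x" "v1 \<noteq> v5" "v1 \<noteq> v6" "v2 \<noteq> v5" "v2 \<noteq> v6" "w \<noteq> v6"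
    using e n n' rev tri by metis+
  ultimately have d: "distinct ?p" using ne by simp
  have "\<forall>i \<in> {..<6}. \<forall>j \<in> {..<6}. nb (?p ! i) (?p ! j) \<longleftrightarrow> (j = i + 1 \<or> i = j + 1)"
    using tri by (simp add: lessThan_Suc numeral_eq_Suc e rev n n' nb_irrefl)
  then have "induced_path E ?p"
    unfolding induced_path_def nb_def using d by auto
  moreover have "set ?p \<subseteq> V" using e nb_V by auto
  ultimately show ?thesis unfolding central_def by (intro exI[of _ ?p]) auto
qed

lemma central_sym: "central w x \<longleftrightarrow> central x w"
  by (simp add: central_def insert_commute)

text \<open>Without a common neighbour of y and z there would be a \<open>K\<^sub>2\<^sub>,\<^sub>3\<close>, with two of them a twin-house.\<close>

lemma blocked_pair:
  assumes wx: "nb w x" "\<not> central w x"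
    and y: "nb y w" "\<not> nb y x" "y \<noteq> x" and z: "nb z x" "\<not> nb z w" "z \<noteq> w" and yz: "\<not> nb y z"
    and yx: "\<And>v. nb y v \<Longrightarrow> v \<noteq> w \<Longrightarrow> \<not> nb v x" and zw: "\<And>v. nb z v \<Longrightarrow> v \<noteq> x \<Longrightarrow> \<not> nb v w"
  obtains c a b where "\<And>u. nb y u \<longleftrightarrow> u = w \<or> u = c \<or> u = a" "w \<noteq> c" "w \<noteq> a" "c \<noteq> a"
    "\<And>u. nb z u \<longleftrightarrow> u = x \<or> u = c \<or> u = b" "x \<noteq> c" "x \<noteq> b" "c \<noteq> b" "nb a b" "\<not> nb a z" "\<not> nb b y"
proof -
  obtain s s' where s: "\<And>u. nb y u \<longleftrightarrow> u = w \<or> u = s \<or> u = s'" "w \<noteq> s" "w \<noteq> s'" "s \<noteq> s'"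
    using neighbours[OF y(1)] by metis
  obtain t t' where t: "\<And>u. nb z u \<longleftrightarrow> u = x \<or> u = t \<or> u = t'" "x \<noteq> t" "x \<noteq> t'" "t \<noteq> t'"
    using neighbours[OF z(1)] by metis
  \<comment> \<open>Each further neighbour \<open>p\<close> of \<open>y\<close> and \<open>r\<close>
    of \<open>z\<close> gives a candidate path \<open>p, y, w, x, z, r\<close>. As the edge is not
    central, one of the three chords left open by the hypotheses is present.\<close>
  have block: "nb p z \<or> nb p r \<or> nb y r" if "nb y p" "p \<noteq> w" "nb z r" "r \<noteq> x" for p r
    using centralI[of p y w x z r] that wx y z yz yx[of p] zw[of r] nb_sym by blast
  have yz_ne: "y \<noteq> z" using y z by blast
  have xy: "nb s y" "nb s' y" "nb t z" "nb t' z" using s(1) t(1) nb_sym by blast+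
  have ys: "s \<noteq> x" "s' \<noteq> x" "t \<noteq> w" "t' \<noteq> w" using s(1) t(1) y z by blast+
  have not_both: "\<not> (nb z s \<and> nb z s')"
  proof
    assume both: "nb z s \<and> nb z s'"
    have "distinct [w, x, s, s', y, z]"
      using s(2-4) ys y z yz_ne xy wx nb_irrefl both by auto
    moreover have "nb w y" "nb x z" using y z nb_sym by blast+
    ultimately show False using no_twin_house[of w x s s' y z] wx(1) s(1) both by blast
  qed
  have not_none: "nb z s \<or> nb z s'"
  proof (rule ccontr)
    assume none: "\<not> ?thesis"
    have "\<not> nb y t" "\<not> nb y t'" using none s(1) t(1) ys t(2,3) by metis+
    then have "nb s t" "nb s t'" "nb s' t" "nb s' t'"
      using block[of s t] block[of s t'] block[of s' t] block[of s' t'] none s t nb_sym by metis+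
    moreover have "y \<noteq> t" "y \<noteq> t'" using yz t(1) nb_sym by metis+
    ultimately show False using no_K23[of s s' y t t'] s(4) t(4) xy by blast
  qed
  note result = that
  have main: thesis if c: "nb z c" "\<not> nb z a" and ya: "\<And>u. nb y u \<longleftrightarrow> u = w \<or> u = c \<or> u = a"
    and d: "w \<noteq> c" "w \<noteq> a" "c \<noteq> a" for c a
  proof -
    have cx: "c \<noteq> x" using ya y by blast
    obtain b where b: "\<And>u. nb z u \<longleftrightarrow> u = x \<or> u = c \<or> u = b" "x \<noteq> b" "c \<noteq> b"
    proof (cases "c = t")
      case True
      then show thesis using t that[of t'] by metis
    next
      case False
      then have "c = t'" using c(1) t(1) cx by metis
      then show thesis using t that[of t] by metis
    qed
    have "b \<noteq> w" using b(1) z by blast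
    moreover have "b \<noteq> a" using b(1) c by blast
    ultimately have yb: "\<not> nb y b" using ya b(3) by metis
    have "\<not> nb a z" using c(2) nb_sym by blast
    \<comment> \<open>On the candidate path through the private neighbours \<open>a\<close> and
      \<open>b\<close> the only chord still possible joins its ends.\<close>
    then have "nb a b" using block[of a b] ya b d yb by metis
    then show thesis using result[OF ya d b(1) _ b(2,3)] cx yb \<open>\<not> nb a z\<close> nb_sym by metis
  qed
  show thesis
  proof (cases "nb z s")
    case True
    then show thesis using main[of s s'] not_both s by metis
  next
    case False
    then show thesis using main[of s' s] not_none s by metis
  qed
qed

text \<open>Every way of blocking all paths around a square at the edge leads to a domino or a claw-square.\<close>

lemma central_square:
  assumes w: "\<And>u. nb w u \<longleftrightarrow> u = x \<or> u = w1 \<or> u = w2" "x \<noteq> w1" "x \<noteq> w2" "w1 \<noteq> w2"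
    and x: "\<And>u. nb x u \<longleftrightarrow> u = w \<or> u = x1 \<or> u = x2" "w \<noteq> x1" "w \<noteq> x2" "x1 \<noteq> x2"
    and sq: "nb w1 x1"
  shows "central w x"
proof (rule ccontr)
  assume nc: "\<not> central w x"
  have e: "nb w x" "nb x w" "nb w w1" "nb w1 w" "nb w w2" "nb w2 w" "nb x x1" "nb x1 x" "nb x x2" "nb x2 x" "nb x1 w1"
    using w(1) x(1) sq nb_sym by blast+
  have t: "\<not> nb w1 w2" "\<not> nb w2 w1" "\<not> nb x1 x2" "\<not> nb x2 x1" "\<not> nb w1 x" "\<not> nb w2 x" "\<not> nb x1 w" "\<not> nb x2 w"
    using no_chord e by blast+
  have ne: "w \<noteq> x" "w1 \<noteq> x1" "w1 \<noteq> x2" "w2 \<noteq> x1" "w2 \<noteq> x2" "w \<noteq> w1" "w \<noteq> w2" "x \<noteq> x1" "x \<noteq> x2"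
    using e t nb_irrefl by blast+
  \<comment> \<open>Of the other three possible edges between the neighbours of \<open>w\<close> and
    \<open>x\<close>, two would give a \<open>K23\<close> and the third a domino. So
    \<open>blocked_pair\<close> applies to \<open>w2\<close> and \<open>x2\<close>.\<close>
  have n12: "\<not> nb w1 x2" using no_K23[of w1 x x1 x2 w] w(2) x(2-4) sq e by blast
  have n21: "\<not> nb w2 x1" using no_K23[of w x1 w1 w2 x] w(2-4) x(2) e nb_sym by metis
  have n22: "\<not> nb w2 x2" using no_domino[of w1 w w2 x1 x x2] ne w(2-4) x(2-4) sq e by auto
  have n': "\<not> nb x2 w1" "\<not> nb x1 w2" "\<not> nb x2 w2" using n12 n21 n22 nb_sym by blast+
  have h1: "\<not> nb v x" if "nb w2 v" "v \<noteq> w" for v using that x(1) nb_sym n21 n22 by metis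
  have h2: "\<not> nb v w" if "nb x2 v" "v \<noteq> x" for v using that w(1) nb_sym n' by metis
  obtain s b d where
    w2: "\<And>u. nb w2 u \<longleftrightarrow> u = w \<or> u = s \<or> u = b" "w \<noteq> s" "w \<noteq> b" "s \<noteq> b" and
    x2: "\<And>u. nb x2 u \<longleftrightarrow> u = x \<or> u = s \<or> u = d" "x \<noteq> s" "x \<noteq> d" "s \<noteq> d" and
    bd: "nb b d" "\<not> nb b x2" "\<not> nb d w2"
    by (rule blocked_pair[OF e(1) nc e(6) t(6) w(3)[symmetric] e(10) t(8) x(3)[symmetric] n22])
      (use h1 h2 in blast)+
  obtain a where a: "\<And>u. nb w1 u \<longleftrightarrow> u = w \<or> u = x1 \<or> u = a" "a \<noteq> w" "a \<noteq> x1"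
  proof -
    obtain p r where "\<And>u. nb w1 u \<longleftrightarrow> u = w \<or> u = p \<or> u = r" "w \<noteq> p" "w \<noteq> r" "p \<noteq> r"
      using neighbours[OF e(4)] by metis
    then show thesis using that[of p] that[of r] sq x(2) by metis
  qed
  obtain c where c: "\<And>u. nb x1 u \<longleftrightarrow> u = x \<or> u = w1 \<or> u = c" "c \<noteq> x" "c \<noteq> w1"
  proof -
    obtain p r where "\<And>u. nb x1 u \<longleftrightarrow> u = x \<or> u = p \<or> u = r" "x \<noteq> p" "x \<noteq> r" "p \<noteq> r"
      using neighbours[OF e(8)] by metis
    then show thesis using that[of p] that[of r] e(11) w(2) by metis
  qed
  have f0: "nb w1 a" "nb x1 c" "nb w2 s" "nb w2 b" "nb x2 s" "nb x2 d"
    by (simp_all add: a(1) c(1) w2(1) x2(1))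
  note f = f0 bd(1) f0[THEN nb_sym[THEN iffD1]] bd(1)[THEN nb_sym[THEN iffD1]]
  have a_ne: "a \<noteq> x" "a \<noteq> w2" "a \<noteq> x2" "a \<noteq> c" "a \<noteq> w1"
    using f t e n12 nb_irrefl no_chord[OF e(11) f(1)] by blast+
  have c_ne: "c \<noteq> w" "c \<noteq> w2" "c \<noteq> x2" "c \<noteq> x1"
    using f t e n' n21 nb_irrefl by blast+
  have ac: "\<not> nb w1 c" "\<not> nb x1 a" using no_chord f e sq by blast+
  have s_ne: "s \<noteq> w1" "s \<noteq> x1" "s \<noteq> w2" "s \<noteq> x2" using f t n' nb_irrefl n12 n21 by blast+
  have b_ne: "b \<noteq> w1" "b \<noteq> x1" "b \<noteq> w2" "b \<noteq> x2" "b \<noteq> d" "b \<noteq> x" using f t n' nb_irrefl n21 n22 bd by blast+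
  have d_ne: "d \<noteq> w1" "d \<noteq> x1" "d \<noteq> w2" "d \<noteq> x2" "d \<noteq> w" using f t n' nb_irrefl n12 bd by blast+
  have as: "a \<noteq> s"
  proof
    assume "a = s"
    then show False using no_domino[of s w1 x1 w2 w x] f e sq s_ne ne w2(2) x2(2) w(2-4) x(2) by auto
  qed
  have cs: "c \<noteq> s"
  proof
    assume "c = s"
    then show False using no_domino[of s x1 w1 x2 x w] f e s_ne ne w2(2) x2(2) w(2) x(2-4) by auto
  qed
  \<comment> \<open>The paths \<open>a, w1, w, x, x2, v\<close> for the two neighbours
    \<open>v\<close> of \<open>x2\<close> other than \<open>x\<close> must both have a chord. The
    statement for \<open>c\<close> below is the mirror image.\<close>
  have "nb a x2 \<or> (nb a s \<and> nb a d)"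
  proof (rule ccontr)
    assume neg: "\<not> ?thesis"
    then obtain v where v: "nb x2 v" "v \<noteq> x" "\<not> nb a v" "\<not> nb a x2" using x2 by metis
    have "\<not> nb a x" using x(1) nb_sym a_ne a(2,3) by metis
    moreover have "\<not> nb w1 v" using v a(1) nb_sym n' t(8) t(4) by metis
    moreover have "\<not> nb w v" using v w(1) nb_sym n' by metis
    ultimately have "central w x"
      using centralI[of a w1 w x x2 v] f e v n12 a(2) ne w(2) x(3) nb_sym by metis
    then show False using nc by blast
  qed
  then have A: "a = d \<or> (nb a s \<and> nb a d)" using x2(1) nb_sym a_ne as by metis
  have "nb c w2 \<or> (nb c s \<and> nb c b)"
  proof (rule ccontr)
    assume neg: "\<not> ?thesis"
    then obtain v where v: "nb w2 v" "v \<noteq> w" "\<not> nb c v" "\<not> nb c w2" using w2 by metis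
    have "\<not> nb c w" using w(1) nb_sym c_ne c(2,3) by metis
    moreover have "\<not> nb x1 v" using v c(1) nb_sym t by metis
    moreover have "\<not> nb x v" using v x(1) nb_sym n21 n22 by metis
    ultimately have "central x w"
      using centralI[of c x1 x w w2 v] f e v n21 c(2) ne w(3) x(2) nb_sym by metis
    then show False using nc central_sym by blast
  qed
  then have C: "c = b \<or> (nb c s \<and> nb c b)" using w2(1) nb_sym c_ne cs by metis
  show False
  proof (cases "a = d")
    case ad: True
    show False
    proof (cases "c = b")
      case True
      then show False
        using no_domino[of w w1 d x x1 b] ad f e sq ne a_ne b_ne d_ne w(2) x(2) w2(3) x2(3) bd by auto
    next
      case False
      \<comment> \<open>This gives a claw-square with square \<open>w2, s, c, b\<close> and centre
        \<open>x\<close> of the claw.\<close>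
      then have "nb c s" "nb c b" using C by blast+
      moreover have "distinct [w2, s, c, b, w, x2, x1, x]"
        using False f ne s_ne b_ne c_ne c(2) cs w(2-4) x(2-4) w2(2-4) x2(2-4) by auto
      ultimately show False
        using no_claw_square[of w2 s c b w x2 x1 x] f e nb_sym by metis
    qed
  next
    case False
    then have as': "nb a s" "nb a d" using A by blast+
    show False
    proof (cases "c = b")
      case True
      \<comment> \<open>The mirror image of the previous claw-square, with square
        \<open>x2, s, a, d\<close> and centre \<open>w\<close>.\<close>
      have "distinct [x2, s, a, d, x, w2, w1, w]"
        using False f ne s_ne d_ne a_ne a(2) as w(2-4) x(2-4) w2(2-4) x2(2-4) by auto
      then show False
        using no_claw_square[of x2 s a d x w2 w1 w] as' f e nb_sym by metis
    next
      case False
      \<comment> \<open>Now \<open>s\<close> would have the four neighbours \<open>w2\<close>,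
        \<open>x2\<close>, \<open>a\<close> and \<open>c\<close>.\<close>
      then have "nb s c" using C nb_sym by blast
      moreover have "nb s a" using as' nb_sym by blast
      ultimately have "c = w2 \<or> c = x2 \<or> c = a"
        using neighbour_cases[OF f(10,12), of a c] ne(5) a_ne(2,3) by metis
      then show False using c_ne a_ne by blast
    qed
  qed
qed

text \<open>If no square contains the edge, then blocking all four pairs of neighbours forces the Petersen
  graph.\<close>

lemma central_edge:
  assumes wx: "nb w x"
  shows "central w x"
proof (rule ccontr)
  assume nc: "\<not> central w x"
  obtain w1 w2 where w: "\<And>u. nb w u \<longleftrightarrow> u = x \<or> u = w1 \<or> u = w2" "x \<noteq> w1" "x \<noteq> w2" "w1 \<noteq> w2"
    using neighbours[OF wx] by metis
  have xw: "nb x w" using wx nb_sym by blast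
  obtain x1 x2 where x: "\<And>u. nb x u \<longleftrightarrow> u = w \<or> u = x1 \<or> u = x2" "w \<noteq> x1" "w \<noteq> x2" "x1 \<noteq> x2"
    using neighbours[OF xw] by metis
  have n: "\<not> nb w1 x1" "\<not> nb w1 x2" "\<not> nb w2 x1" "\<not> nb w2 x2"
    using central_square[OF w x] central_square[of w x w1 w2 x2 x1] central_square[of w x w2 w1 x1 x2]
      central_square[of w x w2 w1 x2 x1] nc w x by metis+
  have e: "nb w w1" "nb w1 w" "nb w w2" "nb w2 w" "nb x x1" "nb x1 x" "nb x x2" "nb x2 x"
    using w(1) x(1) nb_sym by blast+
  have t: "\<not> nb w1 w2" "\<not> nb w2 w1" "\<not> nb x1 x2" "\<not> nb x2 x1" "\<not> nb w1 x" "\<not> nb w2 x" "\<not> nb x1 w" "\<not> nb x2 w"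
    using no_chord e wx xw by blast+
  have ne: "w \<noteq> x" "w1 \<noteq> x1" "w1 \<noteq> x2" "w2 \<noteq> x1" "w2 \<noteq> x2" "w \<noteq> w1" "w \<noteq> w2" "x \<noteq> x1" "x \<noteq> x2"
    using e t wx nb_irrefl by blast+
  have n': "\<not> nb x1 w1" "\<not> nb x2 w1" "\<not> nb x1 w2" "\<not> nb x2 w2" using n nb_sym by blast+
  have yx: "\<not> nb v x" if "nb y v" "v \<noteq> w" "y = w1 \<or> y = w2" for y v
    using that x(1) nb_sym n by metis
  have zw: "\<not> nb v w" if "nb z v" "v \<noteq> x" "z = x1 \<or> z = x2" for z v
    using that w(1) nb_sym n' by metis
  have pair: "\<exists>c a b. (\<forall>u. nb y u \<longleftrightarrow> u = w \<or> u = c \<or> u = a) \<and> (\<forall>u. nb z u \<longleftrightarrow> u = x \<or> u = c \<or> u = b) \<and>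
      w \<noteq> c \<and> w \<noteq> a \<and> c \<noteq> a \<and> x \<noteq> c \<and> x \<noteq> b \<and> c \<noteq> b \<and> nb a b \<and> \<not> nb a z \<and> \<not> nb b y"
    if y: "y = w1 \<or> y = w2" and z: "z = x1 \<or> z = x2" for y z
  proof -
    have 1: "nb y w" "\<not> nb y x" "y \<noteq> x" "nb z x" "\<not> nb z w" "z \<noteq> w" "\<not> nb y z"
      using y z e t n w x by blast+
    obtain c a b where "\<And>u. nb y u \<longleftrightarrow> u = w \<or> u = c \<or> u = a" "w \<noteq> c" "w \<noteq> a" "c \<noteq> a"
      "\<And>u. nb z u \<longleftrightarrow> u = x \<or> u = c \<or> u = b" "x \<noteq> c" "x \<noteq> b" "c \<noteq> b" "nb a b" "\<not> nb a z" "\<not> nb b y"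
      by (rule blocked_pair[OF wx nc 1]) (use yx zw y z in blast)+
    then show ?thesis by blast
  qed
  obtain c a b where
    w1: "\<And>u. nb w1 u \<longleftrightarrow> u = w \<or> u = c \<or> u = a" and x1: "\<And>u. nb x1 u \<longleftrightarrow> u = x \<or> u = c \<or> u = b"
    and cab: "w \<noteq> c" "w \<noteq> a" "c \<noteq> a" "x \<noteq> c" "x \<noteq> b" "c \<noteq> b" "nb a b" "\<not> nb a x1" "\<not> nb b w1"
    using pair[of w1 x1] by blast
  obtain c' a' d where
    w1': "\<And>u. nb w1 u \<longleftrightarrow> u = w \<or> u = c' \<or> u = a'" and x2: "\<And>u. nb x2 u \<longleftrightarrow> u = x \<or> u = c' \<or> u = d"
    and cad: "w \<noteq> c'" "w \<noteq> a'" "c' \<noteq> a'" "x \<noteq> c'" "x \<noteq> d" "c' \<noteq> d" "nb a' d" "\<not> nb a' x2" "\<not> nb d w1"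
    using pair[of w1 x2] by blast
  obtain g h k where
    w2: "\<And>u. nb w2 u \<longleftrightarrow> u = w \<or> u = g \<or> u = h" and x1': "\<And>u. nb x1 u \<longleftrightarrow> u = x \<or> u = g \<or> u = k"
    and ghk: "w \<noteq> g" "w \<noteq> h" "g \<noteq> h" "x \<noteq> g" "x \<noteq> k" "g \<noteq> k" "nb h k" "\<not> nb h x1" "\<not> nb k w2"
    using pair[of w2 x1] by blast
  have f: "nb w1 c" "nb c w1" "nb w1 a" "nb a w1" "nb x1 c" "nb c x1" "nb x1 b" "nb b x1" "nb b a"
    using w1 x1 cab(7) nb_sym by blast+
  \<comment> \<open>Besides \<open>w\<close>, the vertex \<open>w1\<close> has only two neighbours,
    so its common neighbour with \<open>x2\<close> is either the one with \<open>x1\<close> or the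
    other one; likewise for \<open>x1\<close>.\<close>
  have cc: "c' = c \<and> a' = a \<or> c' = a \<and> a' = c" using w1 w1' cab(1-3) cad(1-3) by metis
  have gk: "g = c \<and> k = b \<or> g = b \<and> k = c" using x1 x1' cab(4-6) ghk(4-6) by metis
  from cc show False
  proof
    assume "c' = a \<and> a' = c"
    then have x2a: "nb x2 a" "nb a x2" "nb c d" "nb d c" "nb x2 d" "nb d x2" and cd: "a \<noteq> d" "\<not> nb c x2"
      using x2 cad nb_sym by blast+
    have d_ne: "d \<noteq> w1" "d \<noteq> x1" "d \<noteq> x2" "d \<noteq> w" using x2a n' t nb_irrefl by blast+
    \<comment> \<open>The neighbours of \<open>c\<close> are already \<open>w1\<close>,
      \<open>x1\<close> and \<open>d\<close>, so \<open>w2\<close> cannot be one.\<close>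
    have "g \<noteq> c"
    proof
      assume "g = c"
      then have "nb c w2" using w2 nb_sym by blast
      then have "w2 = w1 \<or> w2 = x1 \<or> w2 = d"
        using neighbour_cases[of c w1 x1 d w2] f x2a(3) ne(2) d_ne by blast
      moreover have "w2 \<noteq> d" using x2a(5) n'(4) by blast
      ultimately show False using w(4) ne(4) by blast
    qed
    then have gk': "g = b" "k = c" using gk by blast+
    then have "nb c h" using ghk(7) nb_sym by blast
    then have "h = w1 \<or> h = x1 \<or> h = d" using neighbour_cases[of c w1 x1 d h] f x2a(3) ne(2) d_ne by blast
    moreover have "nb w2 h" "nb w2 b" "nb b w2" using w2 gk' nb_sym by blast+
    ultimately have hd: "h = d" using t(2) n(3) by blast
    have w2d: "nb w2 d" "nb d w2" using \<open>nb w2 h\<close> hd nb_sym by blast+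
    have "b \<noteq> d" using ghk(3) gk' hd by blast
    moreover have "b \<noteq> x2" "b \<noteq> w1" "b \<noteq> w" "b \<noteq> w2" "b \<noteq> x1"
      using \<open>nb w2 b\<close> f n t nb_irrefl cab ghk gk' by blast+
    moreover have "a \<noteq> x" "a \<noteq> x1" "a \<noteq> x2" "a \<noteq> w1" "a \<noteq> b" "a \<noteq> w2" "c \<noteq> x1" "c \<noteq> x2" "c \<noteq> w1" "c \<noteq> w2" "c \<noteq> d"
      using f x2a t n n' nb_irrefl \<open>nb w2 b\<close> by blast+
    ultimately have "distinct [w, x, x1, c, a, w2, x2, b, d]"
      using ne w(2-4) x(2-4) cab(1-6) d_ne cad(5) cd w2d nb_irrefl by auto
    \<comment> \<open>Together with \<open>w1\<close> these nine vertices form the Petersen graph;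
      \<open>w1\<close> is the removed vertex, with neighbours \<open>w\<close>, \<open>c\<close>
      and \<open>a\<close>.\<close>
    then show False
      using no_petersen_minus[of w x x1 c a w2 x2 b d] wx e f x2a w2d \<open>nb w2 b\<close> cab(7) nb_sym by metis
  next
    assume "c' = c \<and> a' = a"
    then have x2c: "nb x2 c" "nb c x2" "nb a d" "nb d a" "nb x2 d" and cd: "c \<noteq> d"
      using x2 cad nb_sym by blast+
    \<comment> \<open>With \<open>w1\<close>, \<open>x1\<close> and \<open>x2\<close> all places at
      \<open>c\<close> are taken. Hence \<open>c\<close> is the private neighbour \<open>k\<close>
      of \<open>x1\<close> in the pair \<open>w2\<close>, \<open>x1\<close>, and the edge required
      between \<open>h\<close> and \<open>k\<close> is impossible.\<close>
    have c_full: "v = w1 \<or> v = x1 \<or> v = x2" if "nb c v" for v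
      using neighbour_cases[of c w1 x1 x2 v] f x2c(2) ne(2,3) x(4) that by blast
    have "g \<noteq> c"
    proof
      assume "g = c"
      then have "nb c w2" using w2 nb_sym by blast
      then show False using c_full w(4) ne by blast
    qed
    then have "k = c" using gk by blast
    then have "nb c h" using ghk(7) nb_sym by blast
    moreover have "nb w2 h" using w2 by blast
    ultimately show False using c_full t(2) n(3,4) by blast
  qed
qed

end

theorem theorem7:
  fixes V :: "'a set" and E :: "'a set set"
  assumes cub: "cubic V E"
    and conn: "three_connected V E"
    and nodec: "\<not> three_decomposition V E"
    and minimal: "\<And>(V' :: nat set) E'. cubic V' E' \<Longrightarrow> three_connected V' E' \<Longrightarrow>
                     \<not> three_decomposition V' E' \<Longrightarrow> card V \<le> card V'"
  shows "\<not> contains_subgraph V E triangle_V triangle_E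
       \<and> \<not> contains_subgraph V E K23_V K23_E
       \<and> \<not> contains_subgraph V E petersen_minus_V petersen_minus_E
       \<and> \<not> contains_subgraph V E claw_square_V claw_square_E
       \<and> \<not> contains_subgraph V E twin_house_V twin_house_E
       \<and> \<not> contains_subgraph V E domino_V domino_E
       \<and> (\<forall>c. is_cycle E c \<longrightarrow> length c \<ge> 4)
       \<and> (\<forall>c. is_cycle E c \<and> length c \<in> {4, 5, 6} \<longrightarrow> induced_cycle E c)
       \<and> (\<forall>w x. {w, x} \<in> E \<longrightarrow>
            (\<exists>p. length p = 6 \<and> set p \<subseteq> V \<and> induced_path E p \<and> {p ! 2, p ! 3} = {w, x}))"
proof -
  interpret minimal_counterexample V E
  proof
    show "cut_ge_3 V E" by (rule three_connected_imp_cut_ge_3[OF cub conn])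
    fix V' :: "nat set" and E' assume "cubic V' E'" "three_connected V' E'" "card V' < card V"
    then show "three_decomposition V' E'" using minimal[of V' E'] by linarith
  qed (fact cub nodec)+
  have "central w x" if "{w, x} \<in> E" for w x
    using central_edge that by (simp add: nb_def)
  then show ?thesis
    using no_triangle_subgraph no_K23_subgraph no_petersen_minus_subgraph no_claw_square_subgraph
      no_twin_house_subgraph no_domino_subgraph cycle_length_ge_4 short_cycle_induced
    unfolding central_def by blast
qed

end
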